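(* There exists a bivariate polynomial $f$ such that for all positive integers $n,N,k$ and all $A\in\mathcal{S}(n,N)$, the hafnian of $A$ modulo $2^k$, denoted $\operatorname{haf}_{2^k}A$, can be computed (by a single deterministic algorithm taking $A$ and $k$ as input) in $O(f(n,N)^k)$ time.
   Context: The hafnian of a $2n\times 2n$ symmetric matrix $A=(a_{ij})$ is $\operatorname{haf}A:=\sum_{M\in\mathcal{M}}\prod_{ij\in M}a_{ij}$, where $\mathcal{M}$ is the set of all partitions of $\{1,2,\dots,2n\}$ into $n$ (unordered) pairs, and $ij$ denotes the unordered pair $\{i,j\}$. $\mathcal{S}(n,N)$ denotes the set of all $2n\times 2n$ symmetric matrices with zero diagonal each of whose entries is a univariate polynomial (in an indeterminate $x$, with integer coefficients) of degree at most $N$. $\operatorname{haf}_{2^k}A$ is the polynomial $\operatorname{haf}A$ with its coefficients reduced modulo $2^k$. Running time is counted in arithmetic operations on coefficients. *)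

theory Defs
  imports
    "Jordan_Normal_Form.Matrix"
    "HOL-Library.Disjoint_Sets"
    "HOL-Computational_Algebra.Polynomial"
begin

text \<open>Rows and columns are indexed from 0, so \<open>{1, \<dots>, 2n}\<close> becomes \<open>{0..<2*n}\<close>.\<close>

definition pair_partitions :: "'a set \<Rightarrow> 'a set set set" where
  "pair_partitions V = {M. partition_on V M \<and> (\<forall>e\<in>M. card e = 2)}"

text \<open>The factor of an unordered pair \<open>e = {i, j}\<close> is \<open>a\<^bsub>ij\<^esub>\<close>, read off above the diagonal;
  the matrices below are symmetric.\<close>

definition hafnian :: "'a::comm_semiring_1 mat \<Rightarrow> 'a" where
  "hafnian A = (\<Sum>M\<in>pair_partitions {0..<dim_row A}. \<Prod>e\<in>M. A $$ (Min e, Max e))"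

definition poly_matrices :: "nat \<Rightarrow> nat \<Rightarrow> int poly mat set" where
  "poly_matrices n N = {A \<in> carrier_mat (2*n) (2*n). transpose_mat A = A \<and>
     (\<forall>i<2*n. A $$ (i,i) = 0) \<and> (\<forall>i<2*n. \<forall>j<2*n. degree (A $$ (i,j)) \<le> N)}"

definition hafnian_mod :: "nat \<Rightarrow> int poly mat \<Rightarrow> int poly" where
  "hafnian_mod k A = map_poly (\<lambda>c. c mod 2 ^ k) (hafnian A)"

definition eval2 :: "'a::comm_semiring_0 poly poly \<Rightarrow> 'a \<Rightarrow> 'a \<Rightarrow> 'a" where
  "eval2 f x y = poly (poly f [:x:]) y"

text \<open>
  Algorithms are programs for a random access machine with two unbounded memories: index cells
  hold natural numbers and are used for control and addressing; coefficient cells hold integers.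
  Every arithmetic operation on coefficients is carried out modulo \<open>m\<close> and has cost 1, and
  coefficients can be inspected only through their residues.  All index operations,
  memory accesses, tests and jumps are charged too.

  The restrictions are essential for cost 1 per operation to be a fair measure: coefficient
  registers never have to hold more than a residue, and indices can only be added
  and subtracted.  Multiplying unbounded integers at cost 1 would allow exponentially
  long numbers in polynomially many steps.
\<close>

datatype iexp =
    INum nat
  | ICell iexp
  | IAdd iexp iexp
  | ISub iexp iexp

datatype cexp =
    CNum int
  | CCell iexp
  | CAdd cexp cexp
  | CSub cexp cexp
  | CMul cexp cexp

datatype bexp =
    ILess iexp iexp
  | CZero cexp
  | BNeg bexp
  | BConj bexp bexp

datatype com =
    Skip
  | SetI iexp iexp
  | SetC iexp cexp
  | Seq com com
  | Cond bexp com com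
  | Loop bexp com
  | Call nat

text \<open>A program is a list of parameterless, possibly recursive procedures.  It is started by
  calling procedure 0.\<close>

type_synonym program = "com list"

record memory =
  idx :: "nat \<Rightarrow> nat"
  cof :: "nat \<Rightarrow> int"

fun ival :: "memory \<Rightarrow> iexp \<Rightarrow> nat" where
  "ival s (INum a) = a"
| "ival s (ICell e) = idx s (ival s e)"
| "ival s (IAdd d e) = ival s d + ival s e"
| "ival s (ISub d e) = ival s d - ival s e"

fun cval :: "int \<Rightarrow> memory \<Rightarrow> cexp \<Rightarrow> int" where
  "cval m s (CNum c) = c mod m"
| "cval m s (CCell e) = cof s (ival s e) mod m"
| "cval m s (CAdd d e) = (cval m s d + cval m s e) mod m"
| "cval m s (CSub d e) = (cval m s d - cval m s e) mod m"
| "cval m s (CMul d e) = (cval m s d * cval m s e) mod m"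

fun bval :: "int \<Rightarrow> memory \<Rightarrow> bexp \<Rightarrow> bool" where
  "bval m s (ILess d e) = (ival s d < ival s e)"
| "bval m s (CZero e) = (cval m s e = 0)"
| "bval m s (BNeg b) = (\<not> bval m s b)"
| "bval m s (BConj b c) = (bval m s b \<and> bval m s c)"

fun icost :: "iexp \<Rightarrow> nat" where
  "icost (INum a) = 1"
| "icost (ICell e) = icost e + 1"
| "icost (IAdd d e) = icost d + icost e + 1"
| "icost (ISub d e) = icost d + icost e + 1"

fun ccost :: "cexp \<Rightarrow> nat" where
  "ccost (CNum c) = 1"
| "ccost (CCell e) = icost e + 1"
| "ccost (CAdd d e) = ccost d + ccost e + 1"
| "ccost (CSub d e) = ccost d + ccost e + 1"
| "ccost (CMul d e) = ccost d + ccost e + 1"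

fun bcost :: "bexp \<Rightarrow> nat" where
  "bcost (ILess d e) = icost d + icost e + 1"
| "bcost (CZero e) = ccost e + 1"
| "bcost (BNeg b) = bcost b + 1"
| "bcost (BConj b c) = bcost b + bcost c + 1"

text \<open>\<open>exec P m c s t s'\<close>: with procedures \<open>P\<close> and coefficient arithmetic modulo \<open>m\<close>,
  command \<open>c\<close> started in \<open>s\<close> terminates in \<open>s'\<close> after time \<open>t\<close>.\<close>

inductive exec :: "program \<Rightarrow> int \<Rightarrow> com \<Rightarrow> memory \<Rightarrow> nat \<Rightarrow> memory \<Rightarrow> bool"
  for P :: program and m :: int where
  Skip: "exec P m Skip s 1 s"
| SetI: "exec P m (SetI a e) s (icost a + icost e + 1)
    (s\<lparr>idx := (idx s)(ival s a := ival s e)\<rparr>)"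
| SetC: "exec P m (SetC a e) s (icost a + ccost e + 1)
    (s\<lparr>cof := (cof s)(ival s a := cval m s e)\<rparr>)"
| Seq: "exec P m c1 s t1 s' \<Longrightarrow> exec P m c2 s' t2 s'' \<Longrightarrow>
    exec P m (Seq c1 c2) s (t1 + t2) s''"
| CondTrue: "bval m s b \<Longrightarrow> exec P m c1 s t s' \<Longrightarrow>
    exec P m (Cond b c1 c2) s (bcost b + t + 1) s'"
| CondFalse: "\<not> bval m s b \<Longrightarrow> exec P m c2 s t s' \<Longrightarrow>
    exec P m (Cond b c1 c2) s (bcost b + t + 1) s'"
| LoopFalse: "\<not> bval m s b \<Longrightarrow> exec P m (Loop b c) s (bcost b + 1) s"
| LoopTrue: "bval m s b \<Longrightarrow> exec P m c s t1 s' \<Longrightarrow> exec P m (Loop b c) s' t2 s'' \<Longrightarrow>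
    exec P m (Loop b c) s (bcost b + t1 + t2 + 1) s''"
| Call: "p < length P \<Longrightarrow> exec P m (P ! p) s t s' \<Longrightarrow> exec P m (Call p) s (t + 1) s'"

inductive_cases exec_elims:
  "exec P m Skip s t s'"
  "exec P m (SetI a e) s t s'"
  "exec P m (SetC a e) s t s'"
  "exec P m (Seq c1 c2) s t s'"
  "exec P m (Cond b c1 c2) s t s'"
  "exec P m (Loop b c) s t s'"
  "exec P m (Call p) s t s'"

lemma exec_deterministic:
  "exec P m c s t s' \<Longrightarrow> exec P m c s u s'' \<Longrightarrow> u = t \<and> s'' = s'"
proof (induction arbitrary: u s'' rule: exec.induct)
  case (Skip s)
  then show ?case by (rule exec_elims(1)) simp
next
  case (SetI a e s)
  then show ?case by (rule exec_elims(2)) simp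
next
  case (SetC a e s)
  then show ?case by (rule exec_elims(3)) simp
next
  case (Seq c1 s t1 s' c2 t2 s2)
  from Seq.prems show ?case
    by (rule exec_elims(4)) (use Seq.IH in blast)
next
  case (CondTrue s b c1 t s' c2)
  from CondTrue.prems show ?case
    by (rule exec_elims(5)) (use CondTrue.hyps(1) CondTrue.IH in fastforce)+
next
  case (CondFalse s b c2 t s' c1)
  from CondFalse.prems show ?case
    by (rule exec_elims(5)) (use CondFalse.hyps(1) CondFalse.IH in fastforce)+
next
  case (LoopFalse s b c)
  from LoopFalse.prems show ?case
    by (rule exec_elims(6)) (use LoopFalse.hyps in simp_all)
next
  case (LoopTrue s b c t1 s' t2 s2)
  from LoopTrue.prems show ?case
  proof (rule exec_elims(6))
    fix v1 r v2
    assume u: "u = Suc (bcost b + v1 + v2)"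
      and r: "exec P m c s v1 r" and l: "exec P m (Loop b c) r v2 s''"
    from LoopTrue.IH(1)[OF r] have "v1 = t1" "r = s'" by simp_all
    with LoopTrue.IH(2) l u show ?thesis by simp
  qed (use LoopTrue.hyps(1) in simp)
next
  case (Call p s t s')
  from Call.prems show ?case
    by (rule exec_elims(7)) (use Call.IH in fastforce)
qed

text \<open>Input: index cells 0, 1, 2 contain \<open>n\<close>, \<open>N\<close>, \<open>k\<close>; the coefficient memory contains
  the entries of \<open>A\<close> row by row, each as its \<open>N + 1\<close> coefficients in increasing degree.
  All other cells are 0.\<close>

definition input_memory :: "nat \<Rightarrow> nat \<Rightarrow> nat \<Rightarrow> int poly mat \<Rightarrow> memory" where
  "input_memory n N k A = \<lparr>
     idx = (\<lambda>_. 0)(0 := n, 1 := N, 2 := k),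
     cof = (\<lambda>a. let d = a mod (N + 1); r = a div (N + 1); i = r div (2*n); j = r mod (2*n)
                in if i < 2*n then coeff (A $$ (i,j)) d else 0)\<rparr>"

text \<open>Output: index cell 0 contains the length of the coefficient list of the result, which
  occupies the coefficient memory from address 0.\<close>

definition output_poly :: "memory \<Rightarrow> int poly" where
  "output_poly s = Poly (map (cof s) [0..<idx s 0])"

definition computes_within ::
  "program \<Rightarrow> nat \<Rightarrow> nat \<Rightarrow> nat \<Rightarrow> int poly mat \<Rightarrow> int poly \<Rightarrow> real \<Rightarrow> bool" where
  "computes_within P n N k A q T \<longleftrightarrow>
     (\<exists>t s. exec P (2 ^ k) (Call 0) (input_memory n N k A) t s \<and> output_poly s = q \<and> real t \<le> T)"

end

theory Submission
  imports Defs
begin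

text \<open>
  Work in \<open>\<int>[x]\<close> modulo \<open>2\<^sup>k\<close> and \<open>x\<^sup>D\<close> with \<open>D = nN + 1\<close>, which exceeds the degree of the hafnian.
  Subtracting \<open>z\<close> times row and column \<open>q\<close> from row and column \<open>p\<close> changes the hafnian by \<open>2z\<close>
  times a sum of hafnians of minors, because a matrix with two equal rows is expanded symmetrically
  in these rows.  So every elimination step is correct up to hafnians of \<open>O(n\<^sup>2)\<close> minors that are
  needed only modulo \<open>2\<^sup>k\<^sup>-\<^sup>1\<close>.  In the row that is processed choose as pivot the entry that has an odd
  coefficient of lowest degree; all other entries become even by subtracting monomial multiples
  of the pivot row, one coefficient at a time, and an even entry again contributes a minor with
  an even factor.  The row is then reduced to its pivot, which is a common factor of what is left.
  A problem of precision \<open>2\<^sup>j\<close> hence spawns polynomially many problems of precision \<open>2\<^sup>j\<^sup>-\<^sup>1\<close>, and the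
  recursion has depth \<open>k\<close>.
\<close>

section \<open>Hafnians of principal submatrices\<close>

text \<open>The machine works with one fixed modulus, so a problem of lower precision cannot be
  posed modulo a smaller power of two. Instead every problem carries a weight polynomial
  \<open>u\<close> and adds \<open>u * haf A\<close> to one global accumulator; precision
  \<open>j\<close> means that \<open>u\<close> is divisible by \<open>2 ^ (k - j)\<close>. At
  \<open>j = 0\<close> the weight vanishes modulo \<open>2 ^ k\<close> and nothing remains to be
  done. Correctness then becomes a conservation law: accumulator plus \<open>u * haf A\<close> does
  not change modulo \<open>2 ^ k\<close> and \<open>x ^ D\<close>, since every step only moves
  summands from the current matrix to the accumulator.

  The pivot must have lowest degree because \<open>x\<close> is not invertible: a monomial multiple
  of the pivot row reaches only degrees at or above that of the pivot. Inverses of odd numbers are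
  avoided altogether, as it suffices to make a coefficient even; the even remainder is passed on to
  a minor and then erased. A row without odd coefficients is emptied in this way with no pivot at
  all, and its remaining hafnian is zero.\<close>

definition haf_on :: "nat set \<Rightarrow> (nat \<Rightarrow> nat \<Rightarrow> 'a::comm_semiring_1) \<Rightarrow> 'a" where
  "haf_on V B = (\<Sum>M\<in>pair_partitions V. \<Prod>e\<in>M. B (Min e) (Max e))"

lemma finite_pair_partitions: "finite V \<Longrightarrow> finite (pair_partitions V)"
  unfolding pair_partitions_def by (rule finite_subset[OF _ finitely_many_partition_on[of V]]) auto

lemma pair_partitions_empty: "pair_partitions {} = {{}}"
  by (auto simp: pair_partitions_def partition_on_empty)

lemma haf_on_empty: "haf_on {} B = 1"
  by (simp add: haf_on_def pair_partitions_empty)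

lemma pair_partitions_subset: "M \<in> pair_partitions V \<Longrightarrow> e \<in> M \<Longrightarrow> e \<subseteq> V"
  unfolding pair_partitions_def partition_on_def by auto

text \<open>A block has two distinct elements, so its minimum is strictly below its maximum. The
  diagonal is never read, which leaves it free for other purposes.\<close>

lemma haf_on_cong:
  assumes "\<And>i j. i \<in> V \<Longrightarrow> j \<in> V \<Longrightarrow> i < j \<Longrightarrow> B i j = B' i j"
  shows "haf_on V B = haf_on V B'"
  unfolding haf_on_def
proof (intro sum.cong prod.cong refl)
  fix M e assume M: "M \<in> pair_partitions V" "e \<in> M"
  then obtain a b where e: "e = {a, b}" "a \<noteq> b"
    unfolding pair_partitions_def by (auto simp: card_2_iff)
  with pair_partitions_subset[OF M] show "B (Min e) (Max e) = B' (Min e) (Max e)"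
    by (auto simp: min_def max_def intro!: assms)
qed

lemma pair_partitions_insert:
  assumes "i \<in> V" "p \<in> V" "i \<noteq> p" "M \<in> pair_partitions (V - {i,p})"
  shows "insert {i,p} M \<in> pair_partitions V"
proof -
  have "partition_on ((V - {i,p}) \<union> {i,p}) (insert {i,p} M)"
    using assms by (auto simp: pair_partitions_def partition_on_def disjoint_def)
  moreover have "(V - {i,p}) \<union> {i,p} = V" using assms by auto
  ultimately show ?thesis using assms by (auto simp: pair_partitions_def)
qed

lemma pair_partitions_remove:
  assumes M: "M \<in> pair_partitions V" and i: "i \<in> V"
  obtains p where "p \<in> V - {i}" "{i,p} \<in> M" "M - {{i,p}} \<in> pair_partitions (V - {i,p})"
proof -
  from M have part: "partition_on V M" and card: "\<forall>e\<in>M. card e = 2"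
    by (auto simp: pair_partitions_def)
  from part i obtain e where e: "e \<in> M" "i \<in> e" by (auto simp: partition_on_def)
  from card e(1) obtain a b where "e = {a,b}" "a \<noteq> b" by (auto simp: card_2_iff)
  with e(2) obtain p where p: "e = {i,p}" "p \<noteq> i" by (cases "i = a") auto
  have "p \<in> V" using part e p by (auto simp: partition_on_def)
  moreover have "partition_on (V - {i,p}) (M - {{i,p}})"
  proof (rule partition_onI)
    have disj: "e' \<inter> {i,p} = {}" if "e' \<in> M - {{i,p}}" for e'
      using disjointD[OF partition_onD2[OF part], of e' "{i,p}"] that e p by blast
    show "\<Union> (M - {{i,p}}) = V - {i,p}"
      unfolding partition_onD1[OF part] using disj by blast
    show "disjnt e1 e2" if "e1 \<in> M - {{i,p}}" "e2 \<in> M - {{i,p}}" "e1 \<noteq> e2" for e1 e2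
      using disjointD[OF partition_onD2[OF part], of e1 e2] that by (simp add: disjnt_def)
    show "{} \<notin> M - {{i,p}}"
      using partition_onD3[OF part] by blast
  qed
  ultimately show ?thesis using that[of p] p e card by (auto simp: pair_partitions_def)
qed

text \<open>The analogue of Laplace expansion: partitions are sorted by the partner \<open>p\<close>
  of \<open>i\<close>, and the block \<open>{i,p}\<close> is split off. Symmetry of \<open>B\<close>
  is used because the factor of this block is read above the diagonal.\<close>

lemma haf_on_expand:
  assumes fin: "finite V" and i: "i \<in> V"
    and sym: "\<And>a b. a \<in> V \<Longrightarrow> b \<in> V \<Longrightarrow> B a b = B b a"
  shows "haf_on V B = (\<Sum>p\<in>V - {i}. B i p * haf_on (V - {i,p}) B)"
proof -
  let ?F = "\<lambda>p. insert {i,p} ` pair_partitions (V - {i,p})"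
  let ?w = "\<lambda>M. \<Prod>e\<in>M. B (Min e) (Max e)"
  have notin: "{i,p} \<notin> M" if "M \<in> pair_partitions (V - {i,p})" for p M
    using pair_partitions_subset[OF that] by auto
  have U: "pair_partitions V = (\<Union>p\<in>V - {i}. ?F p)"
  proof (intro equalityI subsetI)
    fix M assume M: "M \<in> pair_partitions V"
    from pair_partitions_remove[OF M i] obtain p where
      "p \<in> V - {i}" "{i,p} \<in> M" "M - {{i,p}} \<in> pair_partitions (V - {i,p})" .
    then show "M \<in> (\<Union>p\<in>V - {i}. ?F p)"
      by (intro UN_I[of p] image_eqI[of _ _ "M - {{i,p}}"]) auto
  next
    fix M assume "M \<in> (\<Union>p\<in>V - {i}. ?F p)"
    then show "M \<in> pair_partitions V" using i by (auto intro!: pair_partitions_insert)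
  qed
  have disj: "?F p \<inter> ?F p' = {}" if "p \<in> V - {i}" "p' \<in> V - {i}" "p \<noteq> p'" for p p'
  proof (rule ccontr)
    assume "?F p \<inter> ?F p' \<noteq> {}"
    then obtain M M' where M: "M \<in> pair_partitions (V - {i,p})" "M' \<in> pair_partitions (V - {i,p'})"
      "insert {i,p} M = insert {i,p'} M'" by auto
    then have "{i,p} \<in> M'" using that by (auto simp: doubleton_eq_iff)
    from pair_partitions_subset[OF M(2) this] show False by auto
  qed
  have "haf_on V B = (\<Sum>p\<in>V - {i}. \<Sum>M\<in>?F p. ?w M)"
    unfolding haf_on_def U
  proof (rule sum.UNION_disjoint)
    show "\<forall>p\<in>V - {i}. finite (?F p)"
      using fin by (simp add: finite_pair_partitions)
    show "finite (V - {i})" using fin by simp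
    show "\<forall>p\<in>V - {i}. \<forall>p'\<in>V - {i}. p \<noteq> p' \<longrightarrow> ?F p \<inter> ?F p' = {}"
      by (intro ballI impI disj)
  qed
  also have "\<dots> = (\<Sum>p\<in>V - {i}. B i p * haf_on (V - {i,p}) B)"
  proof (rule sum.cong[OF refl])
    fix p assume p: "p \<in> V - {i}"
    have inj: "inj_on (insert {i,p}) (pair_partitions (V - {i,p}))"
      by (rule inj_onI) (auto simp: insert_ident notin)
    have finM: "finite M" if "M \<in> pair_partitions (V - {i,p})" for M
      using that fin finite_elements[of "V - {i,p}" M] by (auto simp: pair_partitions_def)
    have B: "B (Min {i,p}) (Max {i,p}) = B i p"
      using p i sym by (auto simp: min_def max_def)
    have "(\<Sum>M\<in>?F p. ?w M) = (\<Sum>M\<in>pair_partitions (V - {i,p}). ?w (insert {i,p} M))"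
      by (simp add: sum.reindex[OF inj])
    also have "\<dots> = (\<Sum>M\<in>pair_partitions (V - {i,p}). B i p * ?w M)"
      by (rule sum.cong[OF refl]) (simp only: prod.insert[OF finM notin] B)
    finally show "(\<Sum>M\<in>?F p. ?w M) = B i p * haf_on (V - {i,p}) B"
      by (simp add: haf_on_def sum_distrib_left)
  qed
  finally show ?thesis .
qed

text \<open>This is where the factor 2 of the correction terms comes from: each unordered pair is
  counted in both orders.\<close>

lemma sum_pairs_symmetric:
  fixes f :: "nat \<Rightarrow> nat \<Rightarrow> 'a::comm_semiring_1"
  assumes fin: "finite S" and sym: "\<And>a b. a \<in> S \<Longrightarrow> b \<in> S \<Longrightarrow> f a b = f b a"
  shows "(\<Sum>s\<in>S. \<Sum>r\<in>S - {s}. f s r) = 2 * (\<Sum>r\<in>S. \<Sum>s\<in>{s\<in>S. s < r}. f r s)"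
proof -
  have split: "S - {s} = {r\<in>S. r < s} \<union> {r\<in>S. s < r}" for s by auto
  have "(\<Sum>s\<in>S. \<Sum>r\<in>S - {s}. f s r)
      = (\<Sum>s\<in>S. (\<Sum>r\<in>{r\<in>S. r < s}. f s r) + (\<Sum>r\<in>{r\<in>S. s < r}. f s r))"
    unfolding split by (intro sum.cong refl sum.union_disjoint) (use fin in auto)
  also have "\<dots> = (\<Sum>s\<in>S. \<Sum>r\<in>{r\<in>S. r < s}. f s r) + (\<Sum>s\<in>S. \<Sum>r\<in>{r\<in>S. s < r}. f s r)"
    by (simp add: sum.distrib)
  also have "(\<Sum>s\<in>S. \<Sum>r\<in>{r\<in>S. s < r}. f s r) = (\<Sum>r\<in>S. \<Sum>s\<in>{s\<in>S. s < r}. f s r)"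
    by (rule sum.swap_restrict) (use fin in auto)
  also have "\<dots> = (\<Sum>r\<in>S. \<Sum>s\<in>{s\<in>S. s < r}. f r s)"
    by (intro sum.cong refl) (auto intro: sym)
  finally show ?thesis by (simp only: mult_2)
qed

text \<open>By linearity in row \<open>p\<close>, the change is \<open>z\<close> times the hafnian
  of the matrix in which row \<open>p\<close> is a copy of row \<open>q\<close>; expanding along
  \<open>p\<close> and then along \<open>q\<close> gives a sum over ordered pairs that is symmetric.
  Entry \<open>(p, q)\<close> stays fixed because the operation would subtract a multiple of the
  diagonal entry at \<open>q\<close>, which counts as zero.\<close>

lemma haf_on_row_operation:
  fixes A :: "nat \<Rightarrow> nat \<Rightarrow> 'a::comm_ring_1"
  assumes fin: "finite V" and p: "p \<in> V" and q: "q \<in> V" "p \<noteq> q"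
    and sym: "\<And>a b. a \<in> V \<Longrightarrow> b \<in> V \<Longrightarrow> A a b = A b a"
    and sym': "\<And>a b. a \<in> V \<Longrightarrow> b \<in> V \<Longrightarrow> A' a b = A' b a"
    and off: "\<And>a b. a \<in> V - {p} \<Longrightarrow> b \<in> V - {p} \<Longrightarrow> A' a b = A a b"
    and pq: "A' p q = A p q"
    and row: "\<And>s. s \<in> V - {p,q} \<Longrightarrow> A' p s = A p s - z * A q s"
  shows "haf_on V A = haf_on V A' + 2 * z *
    (\<Sum>r\<in>V - {p,q}. \<Sum>s\<in>{s\<in>V - {p,q}. s < r}. A q r * A q s * haf_on (V - {p,q,r,s}) A)"
proof -
  let ?S = "V - {p,q}"
  let ?f = "\<lambda>s r. A q r * A q s * haf_on (V - {p,q,r,s}) A"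
  have fsym: "?f a b = ?f b a" for a b
    by (simp only: insert_commute[of a b] mult.commute[of "A q a"])
  \<comment> \<open>All changed entries lie in row or column \<open>p\<close>, and \<open>p\<close>
    has been removed here.\<close>
  have minor: "haf_on (V - {p,s}) A' = haf_on (V - {p,s}) A" for s
    by (rule haf_on_cong) (use off in auto)
  have split: "(\<Sum>s\<in>V - {p}. g s) = g q + (\<Sum>s\<in>?S. g s)" for g :: "nat \<Rightarrow> 'a"
  proof -
    have "V - {p} - {q} = ?S" by auto
    with sum.remove[of "V - {p}" q g] fin q show ?thesis by simp
  qed
  have "haf_on V A' = (\<Sum>s\<in>V - {p}. A' p s * haf_on (V - {p,s}) A)"
    by (subst haf_on_expand[OF fin p sym']) (auto simp: minor)
  also have "\<dots> = A p q * haf_on (V - {p,q}) A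
      + (\<Sum>s\<in>?S. (A p s - z * A q s) * haf_on (V - {p,s}) A)"
    unfolding split by (simp add: pq row)
  also have "\<dots> = (\<Sum>s\<in>V - {p}. A p s * haf_on (V - {p,s}) A)
      - z * (\<Sum>s\<in>?S. A q s * haf_on (V - {p,s}) A)"
    unfolding split by (simp add: algebra_simps sum_subtractf sum_distrib_left)
  also have "(\<Sum>s\<in>V - {p}. A p s * haf_on (V - {p,s}) A) = haf_on V A"
    by (rule haf_on_expand[OF fin p sym, symmetric]) auto
  also have "(\<Sum>s\<in>?S. A q s * haf_on (V - {p,s}) A) = (\<Sum>s\<in>?S. \<Sum>r\<in>?S - {s}. ?f s r)"
  proof (rule sum.cong[OF refl])
    fix s assume s: "s \<in> ?S"
    \<comment> \<open>The minor has lost \<open>p\<close> and \<open>s\<close> but still contains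
      \<open>q\<close>, so it can be expanded once more, along \<open>q\<close>.\<close>
    have 1: "haf_on (V - {p,s}) A = (\<Sum>r\<in>V - {p,s} - {q}. A q r * haf_on (V - {p,s} - {q,r}) A)"
      by (rule haf_on_expand) (use fin q s sym in auto)
    have 2: "V - {p,s} - {q} = ?S - {s}" by auto
    have 3: "V - {p,s} - {q,r} = V - {p,q,r,s}" for r by auto
    show "A q s * haf_on (V - {p,s}) A = (\<Sum>r\<in>?S - {s}. ?f s r)"
      unfolding 1 2 3 by (simp add: sum_distrib_left mult_ac)
  qed
  also have "(\<Sum>s\<in>?S. \<Sum>r\<in>?S - {s}. ?f s r) = 2 * (\<Sum>r\<in>?S. \<Sum>s\<in>{s\<in>?S. s < r}. ?f r s)"
    by (rule sum_pairs_symmetric) (use fin fsym in auto)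
  also have "(\<Sum>r\<in>?S. \<Sum>s\<in>{s\<in>?S. s < r}. ?f r s)
     = (\<Sum>r\<in>?S. \<Sum>s\<in>{s\<in>?S. s < r}. ?f s r)"
    by (intro sum.cong refl fsym)
  finally show ?thesis by (simp add: algebra_simps)
qed

section \<open>Truncated polynomials modulo an integer\<close>

text \<open>Congruence modulo the ideal generated by \<open>m\<close> and
  \<open>x ^ D\<close>.\<close>

definition pcong :: "int \<Rightarrow> nat \<Rightarrow> int poly \<Rightarrow> int poly \<Rightarrow> bool" where
  "pcong m D f g \<longleftrightarrow> (\<forall>t<D. m dvd coeff (f - g) t)"

lemma pcong_refl [simp]: "pcong m D f f"
  by (simp add: pcong_def)

lemma pcong_sym: "pcong m D f g \<Longrightarrow> pcong m D g f"
  by (simp add: pcong_def dvd_diff_commute)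

lemma pcong_trans [trans]:
  assumes "pcong m D f g" "pcong m D g h"
  shows "pcong m D f h"
  unfolding pcong_def
proof (intro allI impI)
  fix t assume "t < D"
  with assms have "m dvd coeff (f - g) t + coeff (g - h) t"
    unfolding pcong_def by (intro dvd_add) auto
  then show "m dvd coeff (f - h) t" by simp
qed

lemma pcong_eq_trans [trans]:
  "f = g \<Longrightarrow> pcong m D g h \<Longrightarrow> pcong m D f h"
  "pcong m D f g \<Longrightarrow> g = h \<Longrightarrow> pcong m D f h"
  by simp_all

lemma pcong_add:
  assumes "pcong m D f f'" "pcong m D g g'"
  shows "pcong m D (f + g) (f' + g')"
  unfolding pcong_def
proof (intro allI impI)
  fix t assume "t < D"
  with assms have "m dvd coeff (f - f') t + coeff (g - g') t"
    unfolding pcong_def by (intro dvd_add) auto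
  then show "m dvd coeff (f + g - (f' + g')) t" by (simp add: algebra_simps)
qed

lemma pcong_mult_left:
  assumes "pcong m D f g"
  shows "pcong m D (h * f) (h * g)"
proof -
  have "h * f - h * g = h * (f - g)" by (simp add: algebra_simps)
  with assms show ?thesis
    unfolding pcong_def by (auto simp: coeff_mult intro!: dvd_sum dvd_mult)
qed

lemma pcong_mult:
  assumes "pcong m D f f'" "pcong m D g g'"
  shows "pcong m D (f * g) (f' * g')"
proof -
  have "pcong m D (f * g) (f * g')" using assms(2) by (rule pcong_mult_left)
  also have "f * g' = g' * f" by (rule mult.commute)
  also have "pcong m D (g' * f) (g' * f')" using assms(1) by (rule pcong_mult_left)
  also have "g' * f' = f' * g'" by (rule mult.commute)
  finally show ?thesis .
qed

lemma pcong_sum: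
  "(\<And>x. x \<in> S \<Longrightarrow> pcong m D (f x) (g x)) \<Longrightarrow> pcong m D (sum f S) (sum g S)"
  by (induction S rule: infinite_finite_induct) (auto intro: pcong_add)

lemma pcong_prod:
  "(\<And>x. x \<in> S \<Longrightarrow> pcong m D (f x) (g x)) \<Longrightarrow> pcong m D (prod f S) (prod g S)"
  by (induction S rule: infinite_finite_induct) (auto intro: pcong_mult)

lemma pcong_haf_on:
  assumes "\<And>i j. i \<in> V \<Longrightarrow> j \<in> V \<Longrightarrow> i < j \<Longrightarrow> pcong m D (B i j) (B' i j)"
  shows "pcong m D (haf_on V B) (haf_on V B')"
proof -
  \<comment> \<open>Positions not covered by the hypothesis are filled from \<open>B\<close>; the
    congruence then holds at every position, and blocks need no further analysis.\<close>
  have "haf_on V B' = haf_on V (\<lambda>i j. if i \<in> V \<and> j \<in> V \<and> i < j then B' i j else B i j)"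
    by (rule haf_on_cong) auto
  also have "pcong m D (haf_on V B) \<dots>"
    unfolding haf_on_def using assms by (intro pcong_sum pcong_prod) auto
  finally show ?thesis .
qed

section \<open>Truncated polynomials as coefficient sequences\<close>

definition pol :: "nat \<Rightarrow> (nat \<Rightarrow> int) \<Rightarrow> int poly" where
  "pol D a = (\<Sum>t<D. monom (a t) t)"

lemma coeff_pol: "coeff (pol D a) t = (if t < D then a t else 0)"
  by (simp add: pol_def coeff_sum)

lemma pol_cong: "(\<And>t. t < D \<Longrightarrow> a t = b t) \<Longrightarrow> pol D a = pol D b"
  by (simp add: pol_def)

lemma pcong_iff_dvd: "pcong m D (pol D a) g \<longleftrightarrow> (\<forall>t<D. m dvd a t - coeff g t)"
  by (simp add: pcong_def coeff_pol)

lemma pcong_pol_zero: "(\<And>t. t < D \<Longrightarrow> m dvd a t) \<Longrightarrow> pcong m D (pol D a) 0"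
  by (simp add: pcong_iff_dvd)

lemma dvd_mod_diff: "(m::int) dvd a mod m - a"
  by (simp add: dvd_diff_commute[of m "a mod m"])

definition shift_scale :: "int \<Rightarrow> int \<Rightarrow> nat \<Rightarrow> (nat \<Rightarrow> int) \<Rightarrow> nat \<Rightarrow> int" where
  "shift_scale m z e u t = (if t < e then 0 else (z * u (t - e)) mod m)"

lemma pol_shift_scale: "pcong m D (pol D (shift_scale m z e u)) (monom z e * pol D u)"
  by (auto simp: pcong_iff_dvd shift_scale_def coeff_monom_mult coeff_pol dvd_mod_diff)

definition conv :: "int \<Rightarrow> (nat \<Rightarrow> int) \<Rightarrow> (nat \<Rightarrow> int) \<Rightarrow> nat \<Rightarrow> int" where
  "conv m a u t = (\<Sum>l\<le>t. a l * u (t - l)) mod m"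

lemma pol_conv: "pcong m D (pol D (conv m a u)) (pol D a * pol D u)"
  unfolding pcong_iff_dvd
proof (intro allI impI)
  fix t assume "t < D"
  then have "coeff (pol D a * pol D u) t = (\<Sum>l\<le>t. a l * u (t - l))"
    unfolding coeff_mult by (intro sum.cong refl) (auto simp: coeff_pol)
  then show "m dvd conv m a u t - coeff (pol D a * pol D u) t"
    by (simp add: conv_def dvd_mod_diff)
qed

text \<open>Subtraction of \<open>c * x ^ e\<close> times row and column \<open>q\<close> from row
  and column \<open>p\<close>, on stored coefficients. Degrees below \<open>e\<close> are out of
  reach of the multiple and are not even reduced. The diagonal and the positions of \<open>p\<close>
  against \<open>q\<close> stay as they are, in accordance with a hafnian that treats the diagonal
  as zero.\<close>

definition row_op :: "int \<Rightarrow> nat \<Rightarrow> nat \<Rightarrow> int \<Rightarrow> nat \<Rightarrow> (nat \<Rightarrow> nat \<Rightarrow> nat \<Rightarrow> int) \<Rightarrow> nat \<Rightarrow> nat \<Rightarrow> nat \<Rightarrow> int"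
  where "row_op m p q c e A x y t =
    (if x = p \<and> y \<noteq> p \<and> y \<noteq> q \<and> e \<le> t then (A p y t - c * A q y (t - e)) mod m
     else if y = p \<and> x \<noteq> p \<and> x \<noteq> q \<and> e \<le> t then (A p x t - c * A q x (t - e)) mod m
     else A x y t)"

definition clear :: "nat \<Rightarrow> nat \<Rightarrow> nat \<Rightarrow> (nat \<Rightarrow> nat \<Rightarrow> nat \<Rightarrow> int) \<Rightarrow> nat \<Rightarrow> nat \<Rightarrow> nat \<Rightarrow> int" where
  "clear i p d A x y t =
    (if (x = i \<and> y = p \<or> x = p \<and> y = i) \<and> t = d then 0 else A x y t)"

text \<open>The diagonal does not occur in the hafnian.  It serves as a mask: index \<open>i\<close> has been removed
  from the matrix iff the constant coefficient of entry \<open>(i, i)\<close> is nonzero modulo \<open>m\<close>.\<close>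

definition kill :: "nat \<Rightarrow> (nat \<Rightarrow> nat \<Rightarrow> nat \<Rightarrow> int) \<Rightarrow> nat \<Rightarrow> nat \<Rightarrow> nat \<Rightarrow> int" where
  "kill i A x y t = (if x = i \<and> y = i \<and> t = 0 then 1 else A x y t)"

section \<open>Effect of the elementary operations on the hafnian\<close>

locale hafnian_run =
  fixes n N k :: nat
  assumes n_pos: "n > 0" and N_pos: "N > 0" and k_pos: "k > 0"
begin

definition m :: int where "m = 2 ^ k"
definition D :: nat where "D = n * N + 1"

abbreviation eqv (infix "\<approx>" 50) where "f \<approx> g \<equiv> pcong m D f g"

definition al :: "(nat \<Rightarrow> nat \<Rightarrow> nat \<Rightarrow> int) \<Rightarrow> nat set" where
  "al A = {i. i < 2 * n \<and> m dvd A i i 0}"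

definition mat_of :: "(nat \<Rightarrow> nat \<Rightarrow> nat \<Rightarrow> int) \<Rightarrow> nat \<Rightarrow> nat \<Rightarrow> int poly" where
  "mat_of A i j = pol D (A i j)"

definition haf :: "(nat \<Rightarrow> nat \<Rightarrow> nat \<Rightarrow> int) \<Rightarrow> int poly" where
  "haf A = haf_on (al A) (mat_of A)"

definition symm :: "(nat \<Rightarrow> nat \<Rightarrow> nat \<Rightarrow> int) \<Rightarrow> bool" where
  "symm A \<longleftrightarrow> (\<forall>x<2*n. \<forall>y<2*n. \<forall>t<D. A x y t = A y x t)"

text \<open>Membership in \<open>al A\<close> controls only the constant coefficient of a diagonal
  entry. The other degrees have to vanish as well, since a row without pivot is finished by
  multiplying the weight with its diagonal entry.\<close>

definition zero_diag :: "(nat \<Rightarrow> nat \<Rightarrow> nat \<Rightarrow> int) \<Rightarrow> bool" where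
  "zero_diag A \<longleftrightarrow> (\<forall>x\<in>al A. \<forall>t<D. m dvd A x x t)"

lemma m_gt_1: "m > 1"
  using k_pos by (simp add: m_def)

lemma D_pos: "0 < D" by (simp add: D_def)

lemma finite_al [simp]: "finite (al A)"
  by (simp add: al_def)

lemma al_less: "x \<in> al A \<Longrightarrow> x < 2 * n"
  by (simp add: al_def)

lemma mat_of_sym: "symm A \<Longrightarrow> x \<in> al A \<Longrightarrow> y \<in> al A \<Longrightarrow> mat_of A x y = mat_of A y x"
  unfolding mat_of_def symm_def by (intro pol_cong) (simp add: al_def)

lemma al_row_op [simp]: "al (row_op m p q c e A) = al A"
  by (auto simp: al_def row_op_def)

lemma al_clear [simp]: "i \<noteq> p \<Longrightarrow> al (clear i p d A) = al A"
  by (auto simp: al_def clear_def)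

lemma al_kill: "al (kill i A) = al A - {i}"
  using m_gt_1 by (auto simp: al_def kill_def)

lemma symm_row_op: "symm A \<Longrightarrow> symm (row_op m p q c e A)"
  unfolding symm_def row_op_def by auto

lemma symm_clear: "symm A \<Longrightarrow> symm (clear i p d A)"
  unfolding symm_def clear_def by auto

lemma symm_kill: "symm A \<Longrightarrow> symm (kill i A)"
  unfolding symm_def kill_def by auto

lemma zero_diag_row_op: "zero_diag A \<Longrightarrow> zero_diag (row_op m p q c e A)"
  by (simp add: zero_diag_def) (auto simp: row_op_def)

lemma zero_diag_clear: "i \<noteq> p \<Longrightarrow> zero_diag A \<Longrightarrow> zero_diag (clear i p d A)"
  by (simp add: zero_diag_def) (auto simp: clear_def)

lemma zero_diag_kill: "zero_diag A \<Longrightarrow> zero_diag (kill i A)"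
  by (simp add: zero_diag_def al_kill) (auto simp: kill_def)

lemma mat_of_kill: "x \<noteq> y \<Longrightarrow> mat_of (kill i A) x y = mat_of A x y"
  unfolding mat_of_def by (intro pol_cong) (auto simp: kill_def)

lemma haf_kill: "haf (kill i A) = haf_on (al A - {i}) (mat_of A)"
  unfolding haf_def al_kill by (rule haf_on_cong) (simp add: mat_of_kill)

lemma haf_kill2: "haf (kill i (kill p A)) = haf_on (al A - {i,p}) (mat_of A)"
proof -
  have "al A - {p} - {i} = al A - {i,p}" by auto
  then show ?thesis
    unfolding haf_kill al_kill by (simp, intro haf_on_cong) (simp add: mat_of_kill)
qed

lemma haf_kill4:
  "haf (kill p (kill q (kill r (kill s A)))) = haf_on (al A - {p,q,r,s}) (mat_of A)"
proof -
  have "al A - {s} - {r} - {p,q} = al A - {p,q,r,s}" by auto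
  then show ?thesis
    unfolding haf_kill2 al_kill by (simp, intro haf_on_cong) (simp add: mat_of_kill)
qed

text \<open>The row operation on exact polynomials satisfies the identity exactly; the stored array
  differs from it by reduction modulo \<open>m\<close> and truncation only, which costs equality in
  favour of congruence.\<close>

lemma haf_row_op:
  assumes sym: "symm A" and p: "p \<in> al A" and q: "q \<in> al A" "p \<noteq> q"
  shows "haf A \<approx> haf (row_op m p q c e A) + 2 * monom c e *
    (\<Sum>r\<in>al A - {p,q}. \<Sum>s\<in>{s\<in>al A - {p,q}. s < r}.
       mat_of A q r * mat_of A q s * haf_on (al A - {p,q,r,s}) (mat_of A))"
    (is "_ \<approx> _ + ?S")
proof -
  let ?V = "al A"
  let ?R = "row_op m p q c e A"
  let ?new = "\<lambda>y. mat_of A p y - monom c e * mat_of A q y"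
  define B where "B = (\<lambda>x y. if x = p \<and> y \<noteq> p \<and> y \<noteq> q then ?new y
    else if y = p \<and> x \<noteq> p \<and> x \<noteq> q then ?new x else mat_of A x y)"
  have "haf A = haf_on ?V B + ?S"
    unfolding haf_def
    by (rule haf_on_row_operation[OF finite_al p q]) (use mat_of_sym[OF sym] q in \<open>auto simp: B_def\<close>)
  moreover have "haf_on ?V B \<approx> haf ?R"
    unfolding haf_def al_row_op
  proof (rule pcong_haf_on)
    fix x y assume xy: "x \<in> ?V" "y \<in> ?V" "x < y"
    have new: "?new y \<approx> pol D (?R p y)" if "y \<noteq> p" "y \<noteq> q" for y
    proof -
      have "pol D (?R p y) \<approx> ?new y"
        using that by (auto simp: pcong_iff_dvd row_op_def coeff_monom_mult mat_of_def coeff_pol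
            dvd_mod_diff)
      then show ?thesis by (rule pcong_sym)
    qed
    have R': "pol D (?R x p) = pol D (?R p x)" if "x \<in> ?V" for x
      using symm_row_op[OF sym] that p by (intro pol_cong) (simp add: symm_def al_def)
    show "B x y \<approx> mat_of ?R x y"
    proof (cases "x = p \<and> y \<noteq> p \<and> y \<noteq> q \<or> y = p \<and> x \<noteq> p \<and> x \<noteq> q")
      case True
      then show ?thesis using new[of x] new[of y] R'[OF xy(1)]
        by (auto simp: B_def mat_of_def[of ?R])
    next
      case False
      then have "B x y = mat_of ?R x y"
        by (auto simp: B_def mat_of_def row_op_def[abs_def])
      then show ?thesis by simp
    qed
  qed
  ultimately show ?thesis by (simp add: pcong_add)
qed

text \<open>The hafnian is linear in row \<open>i\<close>, so erasing one monomial of entry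
  \<open>(i, p)\<close> costs that monomial times the minor without \<open>i\<close> and
  \<open>p\<close>. No reduction takes place, hence a true equality.\<close>

lemma haf_clear:
  assumes sym: "symm A" and i: "i \<in> al A" and p: "p \<in> al A" "p \<noteq> i" and d: "d < D"
  shows "haf A = haf (clear i p d A) + monom (A i p d) d * haf_on (al A - {i,p}) (mat_of A)"
proof -
  let ?V = "al A" and ?C = "clear i p d A"
  have [simp]: "al ?C = ?V" using p by (intro al_clear) simp
  have minor: "haf_on (?V - {i,r}) (mat_of ?C) = haf_on (?V - {i,r}) (mat_of A)" for r
    by (rule haf_on_cong) (auto simp: mat_of_def clear_def intro!: pol_cong)
  have other: "mat_of ?C i r = mat_of A i r" if "r \<noteq> p" for r
    using that p by (auto simp: mat_of_def clear_def intro!: pol_cong)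
  have ip: "mat_of A i p = mat_of ?C i p + monom (A i p d) d"
    using d by (intro poly_eqI) (auto simp: mat_of_def coeff_pol clear_def)
  have "haf A = (\<Sum>r\<in>?V - {i}. mat_of A i r * haf_on (?V - {i,r}) (mat_of A))"
    unfolding haf_def by (rule haf_on_expand[OF finite_al i mat_of_sym[OF sym]])
  moreover have "haf ?C = (\<Sum>r\<in>?V - {i}. mat_of ?C i r * haf_on (?V - {i,r}) (mat_of A))"
    unfolding haf_def \<open>al ?C = ?V\<close> minor[symmetric]
    by (rule haf_on_expand[OF finite_al i]) (use mat_of_sym[OF symm_clear[OF sym]] in auto)
  ultimately show ?thesis
    using p by (simp add: sum.remove[of "?V - {i}" p] ip other algebra_simps)
qed

text \<open>Only the term of column \<open>q\<close> survives the expansion along \<open>i\<close>.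
  The case \<open>q = i\<close> stands for a row in which no pivot was found: the hafnian is then
  zero, and so is the right-hand side modulo \<open>m\<close>, because it contains the diagonal
  entry of a live index.\<close>

lemma haf_single_entry:
  assumes sym: "symm A" and diag: "zero_diag A" and i: "i \<in> al A" and q: "q \<in> al A"
    and zero: "\<And>p t. p \<in> al A \<Longrightarrow> p \<noteq> i \<Longrightarrow> p \<noteq> q \<Longrightarrow> t < D \<Longrightarrow> A i p t = 0"
  shows "pol D u * haf A \<approx> pol D (conv m (A i q) u) * haf (kill i (kill q A))"
proof -
  let ?V = "al A"
  have "haf A = (\<Sum>r\<in>?V - {i}. mat_of A i r * haf_on (?V - {i,r}) (mat_of A))"
    unfolding haf_def by (rule haf_on_expand[OF finite_al i mat_of_sym[OF sym]])
  also have "\<dots> = (\<Sum>r\<in>?V - {i}. if r = q then mat_of A i q * haf_on (?V - {i,q}) (mat_of A) else 0)"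
  proof (rule sum.cong[OF refl])
    fix r assume r: "r \<in> ?V - {i}"
    have "mat_of A i r = 0" if "r \<noteq> q"
      unfolding mat_of_def using zero[of r] r that by (auto intro!: poly_eqI simp: coeff_pol)
    then show "mat_of A i r * haf_on (?V - {i,r}) (mat_of A)
      = (if r = q then mat_of A i q * haf_on (?V - {i,q}) (mat_of A) else 0)" by auto
  qed
  also have "\<dots> = (if q = i then 0 else mat_of A i q * haf_on (?V - {i,q}) (mat_of A))"
    using q by simp
  also have "\<dots> \<approx> mat_of A i q * haf_on (?V - {i,q}) (mat_of A)"
  proof (cases "q = i")
    case True
    have "mat_of A i i \<approx> 0"
      unfolding mat_of_def using diag i by (intro pcong_pol_zero) (simp add: zero_diag_def)
    from pcong_mult[OF this pcong_refl, of "haf_on (?V - {i,i}) (mat_of A)"] True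
    show ?thesis by (simp add: pcong_sym)
  qed simp
  finally have "pol D u * haf A \<approx> pol D u * (mat_of A i q * haf_on (?V - {i,q}) (mat_of A))"
    by (rule pcong_mult_left)
  also have "\<dots> = (pol D (A i q) * pol D u) * haf (kill i (kill q A))"
    by (simp add: haf_kill2 mat_of_def)
  also have "\<dots> \<approx> pol D (conv m (A i q) u) * haf (kill i (kill q A))"
    by (intro pcong_mult pcong_refl pcong_sym[OF pol_conv])
  finally show ?thesis .
qed

text \<open>A hafnian with such a weight is needed only modulo \<open>2\<^sup>j\<close>.\<close>

definition dvw :: "nat \<Rightarrow> (nat \<Rightarrow> int) \<Rightarrow> bool" where
  "dvw j u \<longleftrightarrow> (\<forall>t<D. 2 ^ (k - j) dvd u t)"

lemma power_dvd_m: "(2::int) ^ (k - j) dvd m"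
  unfolding m_def by (rule le_imp_power_dvd) simp

text \<open>An even factor supplies the additional power of two by which precision may drop.
  Reduction modulo \<open>m\<close> does not spoil it, as \<open>2 ^ (k - j)\<close> divides
  \<open>m\<close>.\<close>

lemma dvw_shift_scale:
  assumes "dvw (Suc j) u" "Suc j \<le> k" "even z"
  shows "dvw j (shift_scale m z e u)"
  unfolding dvw_def
proof (intro allI impI)
  fix t assume t: "t < D"
  have "k - j = Suc (k - Suc j)" using assms(2) by simp
  then have pow: "(2::int) ^ (k - j) = 2 * 2 ^ (k - Suc j)" by simp
  from t assms(1) have "(2::int) ^ (k - Suc j) dvd u (t - e)" by (simp add: dvw_def)
  with assms(3) have "2 ^ (k - j) dvd z * u (t - e)"
    unfolding pow by (rule mult_dvd_mono)
  with power_dvd_m show "2 ^ (k - j) dvd shift_scale m z e u t"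
    by (simp add: shift_scale_def dvd_mod)
qed

lemma dvw_conv: "dvw j u \<Longrightarrow> dvw j (conv m a u)"
  unfolding dvw_def conv_def
  by (intro allI impI dvd_mod dvd_sum dvd_mult power_dvd_m) auto

text \<open>Base of the recursion: at precision 0 the weight is a multiple of \<open>m\<close>, so
  the whole contribution may be skipped.\<close>

lemma dvw_0_eqv: "dvw 0 u \<Longrightarrow> pol D u * f \<approx> 0"
  using pcong_mult[OF pcong_pol_zero[of D m u] pcong_refl, of f] by (simp add: dvw_def m_def)

lemma dvw_k: "dvw k u"
  by (simp add: dvw_def)

end

section \<open>Rules for terminating programs\<close>

text \<open>Total correctness with a time bound. Sequences are treated by taking a
  \<open>runs\<close> statement about the second command as postcondition of the first, so that
  proofs follow the program text.\<close>

definition runs :: "program \<Rightarrow> int \<Rightarrow> com \<Rightarrow> memory \<Rightarrow> nat \<Rightarrow> (memory \<Rightarrow> bool) \<Rightarrow> bool" where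
  "runs P m c s T Q \<longleftrightarrow> (\<exists>t s'. exec P m c s t s' \<and> t \<le> T \<and> Q s')"

lemma runs_mono:
  "runs P m c s T Q \<Longrightarrow> T \<le> T' \<Longrightarrow> (\<And>s'. Q s' \<Longrightarrow> Q' s') \<Longrightarrow> runs P m c s T' Q'"
  unfolding runs_def by (meson le_trans)

lemma runs_Skip: "Q s \<Longrightarrow> 1 \<le> T \<Longrightarrow> runs P m Skip s T Q"
  unfolding runs_def using exec.Skip by blast

lemma runs_SetI:
  "Q (s\<lparr>idx := (idx s)(ival s a := ival s e)\<rparr>) \<Longrightarrow> icost a + icost e + 1 \<le> T \<Longrightarrow>
    runs P m (SetI a e) s T Q"
  unfolding runs_def using exec.SetI by blast

lemma runs_SetC:
  "Q (s\<lparr>cof := (cof s)(ival s a := cval m s e)\<rparr>) \<Longrightarrow> icost a + ccost e + 1 \<le> T \<Longrightarrow>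
    runs P m (SetC a e) s T Q"
  unfolding runs_def using exec.SetC by blast

lemma runs_Seq:
  assumes "runs P m c1 s T1 (\<lambda>s'. runs P m c2 s' T2 Q)" "T1 + T2 \<le> T"
  shows "runs P m (Seq c1 c2) s T Q"
  using assms unfolding runs_def by (meson add_mono exec.Seq le_trans)

lemma runs_Cond:
  assumes "bval m s b \<Longrightarrow> runs P m c1 s T1 Q" "\<not> bval m s b \<Longrightarrow> runs P m c2 s T1 Q"
    and "bcost b + T1 + 1 \<le> T"
  shows "runs P m (Cond b c1 c2) s T Q"
proof (cases "bval m s b")
  case True
  with assms(1) obtain t s' where "exec P m c1 s t s'" "t \<le> T1" "Q s'" by (auto simp: runs_def)
  then show ?thesis unfolding runs_def using exec.CondTrue[of m s b P c1 t s' c2] True assms(3)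
    by (intro exI[of _ "bcost b + t + 1"] exI[of _ s']) auto
next
  case False
  with assms(2) obtain t s' where "exec P m c2 s t s'" "t \<le> T1" "Q s'" by (auto simp: runs_def)
  then show ?thesis unfolding runs_def using exec.CondFalse[of m s b P c2 t s' c1] False assms(3)
    by (intro exI[of _ "bcost b + t + 1"] exI[of _ s']) auto
qed

lemma runs_Call:
  "p < length P \<Longrightarrow> runs P m (P ! p) s T1 Q \<Longrightarrow> T1 + 1 \<le> T \<Longrightarrow> runs P m (Call p) s T Q"
  unfolding runs_def by (meson add_le_mono1 exec.Call le_trans)

definition For :: "nat \<Rightarrow> iexp \<Rightarrow> com \<Rightarrow> com" where
  "For x e c = Seq (SetI (INum x) (INum 0))
    (Loop (ILess (ICell (INum x)) e) (Seq c (SetI (INum x) (IAdd (ICell (INum x)) (INum 1)))))"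

text \<open>The bound \<open>e\<close> is evaluated anew before every round, so the invariant has to
  fix its value. A round costs \<open>icost e + 3\<close> for the test, \<open>B\<close> for the
  body, 6 for the increment and 1 for the loop; the initial assignment adds 3 and the failing test
  \<open>icost e + 4\<close>.\<close>

lemma runs_For:
  assumes init: "I 0 (s\<lparr>idx := (idx s)(x := 0)\<rparr>)"
    and inv: "\<And>i s'. i \<le> bnd \<Longrightarrow> I i s' \<Longrightarrow> idx s' x = i \<and> ival s' e = bnd"
    and step: "\<And>i s'. i < bnd \<Longrightarrow> I i s' \<Longrightarrow>
      runs P m c s' B (\<lambda>s''. I (Suc i) (s''\<lparr>idx := (idx s'')(x := Suc (idx s'' x))\<rparr>))"
    and final: "\<And>s'. I bnd s' \<Longrightarrow> Q s'"
    and time: "bnd * (B + icost e + 10) + icost e + 7 \<le> T"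
  shows "runs P m (For x e c) s T Q"
proof -
  let ?b = "ILess (ICell (INum x)) e"
  let ?c = "Seq c (SetI (INum x) (IAdd (ICell (INum x)) (INum 1)))"
  have loop: "runs P m (Loop ?b ?c) s' (r * (B + icost e + 10) + icost e + 4) Q"
    if "r \<le> bnd" "I (bnd - r) s'" for r s'
    using that
  proof (induction r arbitrary: s')
    case 0
    with inv[of bnd s'] have "\<not> bval m s' ?b" by simp
    from exec.LoopFalse[OF this, of P ?c] 0 final show ?case
      unfolding runs_def by (intro exI conjI) auto
  next
    case (Suc r)
    then have i: "bnd - Suc r < bnd" "Suc (bnd - Suc r) = bnd - r" by auto
    with inv[of "bnd - Suc r" s'] Suc.prems have b: "bval m s' ?b" by simp
    from step[OF i(1) Suc.prems(2)] i(2) obtain t s'' where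
      s'': "exec P m c s' t s''" "t \<le> B" "I (bnd - r) (s''\<lparr>idx := (idx s'')(x := Suc (idx s'' x))\<rparr>)"
      by (auto simp: runs_def)
    let ?s = "s''\<lparr>idx := (idx s'')(x := Suc (idx s'' x))\<rparr>"
    have "exec P m (SetI (INum x) (IAdd (ICell (INum x)) (INum 1))) s'' 6 ?s"
      using exec.SetI[of P m "INum x" "IAdd (ICell (INum x)) (INum 1)" s''] by (simp add: numeral_eq_Suc)
    from exec.Seq[OF s''(1) this] have body: "exec P m ?c s' (t + 6) ?s" .
    from Suc.IH[OF _ s''(3)] Suc.prems obtain t' s3 where
      rest: "exec P m (Loop ?b ?c) ?s t' s3" "t' \<le> r * (B + icost e + 10) + icost e + 4" "Q s3"
      by (auto simp: runs_def)
    from exec.LoopTrue[OF b body rest(1)] rest s''(2) show ?case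
      unfolding runs_def by (intro exI conjI) auto
  qed
  have "runs P m (SetI (INum x) (INum 0)) s 3
      (\<lambda>s'. runs P m (Loop ?b ?c) s' (bnd * (B + icost e + 10) + icost e + 4) Q)"
  proof (rule runs_SetI)
    show "runs P m (Loop ?b ?c) (s\<lparr>idx := (idx s)(ival s (INum x) := ival s (INum 0))\<rparr>)
      (bnd * (B + icost e + 10) + icost e + 4) Q"
      using loop[of bnd "s\<lparr>idx := (idx s)(x := 0)\<rparr>"] init by simp
  qed simp
  then show ?thesis unfolding For_def by (rule runs_Seq) (use time in simp)
qed

abbreviation R :: "nat \<Rightarrow> iexp" where "R x \<equiv> ICell (INum x)"

section \<open>Memory layout and subroutines\<close>

text \<open>
  Index cells: 3 holds \<open>2n\<close>, 4 \<open>D\<close>, 5 the base \<open>b\<close> of the current frame, 6 the frame size, 7 the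
  stack pointer, 8 the precision \<open>j\<close>, 9 the offset of the weight in a frame; 10 to 16 are the variables
  \<open>i\<close> (row), \<open>d\<close> (degree), \<open>p\<close> (column), \<open>q\<close> (pivot column, equal to \<open>i\<close> as long as there is no pivot),
  \<open>v\<close> (degree of the pivot), \<open>r\<close> and \<open>s\<close> (pair of a correction term); 17 to 19 are loop counters.
  Since indices cannot be multiplied, row and column offsets are tabulated from cell 30 and from the
  cell whose address is in 21; the stack of saved variables follows.

  Coefficient cells: the result is accumulated in the first \<open>D\<close> cells, cell \<open>D\<close> holds \<open>2\<^sup>k\<^sup>-\<^sup>1\<close> for parity
  tests, cell \<open>D + 1\<close> is temporary.  A frame consists of a matrix, each entry by its \<open>D\<close>
  coefficients, and of the weight polynomial of its hafnian.  The recursive call works on the frame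
  that follows the current one.
\<close>

definition ENT :: "iexp \<Rightarrow> iexp \<Rightarrow> iexp \<Rightarrow> iexp \<Rightarrow> iexp" where
  "ENT b x y t = IAdd b (IAdd (ICell (IAdd (INum 30) x)) (IAdd (ICell (IAdd (R 21) y)) t))"

lemma icost_ENT [simp]: "icost (ENT b x y t) = icost b + icost x + icost y + icost t + 10"
  by (simp add: ENT_def)

abbreviation INeq :: "iexp \<Rightarrow> iexp \<Rightarrow> bexp" where
  "INeq d e \<equiv> BNeg (BConj (BNeg (ILess d e)) (BNeg (ILess e d)))"

lemma bval_INeq: "bval m s (INeq d e) \<longleftrightarrow> ival s d \<noteq> ival s e"
  by auto

definition copy_frame :: com where
  "copy_frame = For 17 (R 6) (SetC (IAdd (R 5) (IAdd (R 6) (R 17))) (CCell (IAdd (R 5) (R 17))))"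

definition scale_child :: "cexp \<Rightarrow> iexp \<Rightarrow> com" where
  "scale_child z e = For 17 (R 4)
    (Cond (ILess (R 17) e)
      (SetC (IAdd (IAdd (R 5) (R 6)) (IAdd (R 9) (R 17))) (CNum 0))
      (SetC (IAdd (IAdd (R 5) (R 6)) (IAdd (R 9) (R 17)))
        (CMul z (CCell (IAdd (R 5) (IAdd (R 9) (ISub (R 17) e)))))))"

text \<open>The product replaces one of its factors in place. This works from the highest degree
  downwards: coefficient \<open>t\<close> of the product depends on old coefficients of degree at
  most \<open>t\<close>, which are still intact. The term with the old coefficient \<open>t\<close>
  itself comes first, since its cell then takes the partial sum.\<close>

definition mult_weight :: "iexp \<Rightarrow> iexp \<Rightarrow> com" where
  "mult_weight w a = For 17 (R 4)
    (Seq (SetI (INum 18) (ISub (R 4) (IAdd (R 17) (INum 1))))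
    (Seq (SetC (IAdd w (R 18)) (CMul (CCell a) (CCell (IAdd w (R 18)))))
      (For 19 (R 18) (SetC (IAdd w (R 18)) (CAdd (CCell (IAdd w (R 18)))
        (CMul (CCell (IAdd a (IAdd (R 19) (INum 1))))
          (CCell (IAdd w (ISub (R 18) (IAdd (R 19) (INum 1))))))))))) "

definition add_weight :: com where
  "add_weight = For 17 (R 4) (SetC (R 17) (CAdd (CCell (R 17)) (CCell (IAdd (R 5) (IAdd (R 9) (R 17))))))"

text \<open>The multiplier is saved first because the entry it is read from belongs to row
  \<open>p\<close> and is itself overwritten. Row \<open>q\<close> can be read during the whole
  loop, since the positions written have \<open>p\<close> as one index and avoid \<open>q\<close>.
  The counter 18 is the degree in the pivot row, shifted by \<open>d - v\<close> for the
  target.\<close>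

definition sub_row :: com where
  "sub_row = Seq (SetC (IAdd (R 4) (INum 1)) (CCell (ENT (R 5) (R 10) (R 12) (R 11))))
    (For 17 (R 3) (Cond (BConj (INeq (R 17) (R 12)) (INeq (R 17) (R 13)))
      (For 18 (ISub (R 4) (ISub (R 11) (R 14)))
        (Seq (SetC (ENT (R 5) (R 12) (R 17) (IAdd (R 18) (ISub (R 11) (R 14))))
          (CSub (CCell (ENT (R 5) (R 12) (R 17) (IAdd (R 18) (ISub (R 11) (R 14)))))
            (CMul (CCell (IAdd (R 4) (INum 1))) (CCell (ENT (R 5) (R 13) (R 17) (R 18))))))
         (SetC (ENT (R 5) (R 17) (R 12) (IAdd (R 18) (ISub (R 11) (R 14))))
          (CCell (ENT (R 5) (R 12) (R 17) (IAdd (R 18) (ISub (R 11) (R 14))))))))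
      Skip))"

definition idx_eq :: "nat set \<Rightarrow> memory \<Rightarrow> memory \<Rightarrow> bool" where
  "idx_eq X s s' \<longleftrightarrow> (\<forall>a. a \<notin> X \<longrightarrow> idx s' a = idx s a)"

lemma idx_eq_refl [simp]: "idx_eq X s s" by (simp add: idx_eq_def)

lemma idx_eq_cof [simp]: "idx_eq X s (s'\<lparr>cof := c\<rparr>) = idx_eq X s s'"
  by (simp add: idx_eq_def)

abbreviation scratch :: "nat set" where "scratch \<equiv> {17, 18, 19}"

context hafnian_run
begin

section \<open>Addresses, and correctness of the subroutines\<close>

definition WO :: nat where "WO = 2 * n * (2 * n * D)"
definition W :: nat where "W = WO + D"
definition ent :: "nat \<Rightarrow> nat \<Rightarrow> nat \<Rightarrow> nat" where "ent x y t = x * (2 * n * D) + (y * D + t)"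

lemma entry_less: "y < 2 * n \<Longrightarrow> t < D \<Longrightarrow> y * D + t < 2 * n * D"
proof -
  assume "y < 2 * n" "t < D"
  then have "y * D + t < (y + 1) * D" by simp
  also have "\<dots> \<le> 2 * n * D" using \<open>y < 2 * n\<close> by (intro mult_right_mono) auto
  finally show ?thesis .
qed

lemma ent_less: "x < 2 * n \<Longrightarrow> y < 2 * n \<Longrightarrow> t < D \<Longrightarrow> ent x y t < WO"
proof -
  assume x: "x < 2 * n" and "y < 2 * n" "t < D"
  then have "ent x y t < x * (2 * n * D) + 2 * n * D" using entry_less by (simp add: ent_def)
  also have "\<dots> = (x + 1) * (2 * n * D)" by simp
  also have "\<dots> \<le> WO" unfolding WO_def using x by (intro mult_right_mono) auto
  finally show ?thesis .
qed

lemma ent_inj: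
  assumes "y < 2 * n" "t < D" "y' < 2 * n" "t' < D"
  shows "ent x y t = ent x' y' t' \<longleftrightarrow> x = x' \<and> y = y' \<and> t = t'"
proof
  assume eq: "ent x y t = ent x' y' t'"
  have quot: "(a * c + r) div c = a" if "r < c" for a c r :: nat using that by simp
  from arg_cong[OF eq, of "\<lambda>a. a div (2 * n * D)"] have "x = x'"
    unfolding ent_def quot[OF entry_less[OF assms(1,2)]] quot[OF entry_less[OF assms(3,4)]] .
  with eq have "y * D + t = y' * D + t'" by (simp add: ent_def)
  with arg_cong[OF this, of "\<lambda>a. a div D"] have "y = y'"
    unfolding quot[OF assms(2)] quot[OF assms(4)] by simp
  with \<open>x = x'\<close> eq show "x = x' \<and> y = y' \<and> t = t'" by (simp add: ent_def)
qed simp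

text \<open>Frames start at \<open>WO\<close> or later; below them there is room for the accumulator
  and the two auxiliary cells.\<close>

lemma D_add_2_le_WO: "D + 2 \<le> WO"
proof -
  have "D + 2 \<le> 2 * D + 2 * D" using D_pos n_pos N_pos by (simp add: D_def)
  also have "\<dots> = 2 * (2 * D)" by simp
  also have "\<dots> \<le> 2 * n * (2 * n * D)" using n_pos by (intro mult_mono) auto
  finally show ?thesis by (simp add: WO_def)
qed

text \<open>The last two bounds keep the frames above the accumulator, and the stack above the two
  address tables of length \<open>2 * n\<close> each.\<close>

definition env :: "nat \<Rightarrow> nat \<Rightarrow> nat \<Rightarrow> memory \<Rightarrow> bool" where
  "env b sp j s \<longleftrightarrow> idx s 3 = 2 * n \<and> idx s 4 = D \<and> idx s 5 = b \<and> idx s 6 = W \<and> idx s 7 = sp \<and>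
    idx s 8 = j \<and> idx s 9 = WO \<and> idx s 21 = 30 + 2 * n \<and>
    (\<forall>x<2*n. idx s (30 + x) = x * (2 * n * D) \<and> idx s (30 + 2 * n + x) = x * D) \<and>
    cof s D = 2 ^ (k - 1) \<and> WO \<le> b \<and> 30 + 4 * n \<le> sp"

lemma envD:
  assumes "env b sp j s"
  shows "idx s 3 = 2 * n" "idx s 4 = D" "idx s 5 = b" "idx s 6 = W" "idx s 7 = sp"
    "idx s 8 = j" "idx s 9 = WO" "idx s 21 = 30 + 2 * n" "cof s D = 2 ^ (k - 1)"
    "WO \<le> b" "30 + 4 * n \<le> sp"
  using assms unfolding env_def by simp_all

lemma env_idx_eq:
  assumes "env b sp j s" "idx_eq {10..<20} s s'" "cof s' D = cof s D"
  shows "env b sp j s'"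
  using assms unfolding env_def idx_eq_def by auto

lemma ival_ENT:
  assumes "env b sp j s" "ival s x < 2 * n" "ival s y < 2 * n"
  shows "ival s (ENT c x y t) = ival s c + ent (ival s x) (ival s y) (ival s t)"
  using assms unfolding env_def by (simp add: ENT_def ent_def)

definition frame :: "memory \<Rightarrow> nat \<Rightarrow> (nat \<Rightarrow> nat \<Rightarrow> nat \<Rightarrow> int) \<Rightarrow> (nat \<Rightarrow> int) \<Rightarrow> bool" where
  "frame s b A u \<longleftrightarrow> (\<forall>x<2*n. \<forall>y<2*n. \<forall>t<D. cof s (b + ent x y t) = A x y t) \<and>
    (\<forall>t<D. cof s (b + WO + t) = u t)"

lemma frame_cong:
  assumes "\<And>a. b \<le> a \<Longrightarrow> a < b + W \<Longrightarrow> cof s' a = cof s a"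
  shows "frame s' b A u = frame s b A u"
proof -
  have "cof s' (b + ent x y t) = cof s (b + ent x y t)" if "x < 2 * n" "y < 2 * n" "t < D" for x y t
    using ent_less[OF that] by (intro assms) (auto simp: W_def)
  moreover have "cof s' (b + WO + t) = cof s (b + WO + t)" if "t < D" for t
    using that by (intro assms) (auto simp: W_def)
  ultimately show ?thesis by (auto simp: frame_def)
qed

definition T_copy :: nat where "T_copy = W * 50 + 50"

text \<open>Reading a cell reduces it modulo \<open>m\<close>, so a copy is faithful only for cells
  that are already reduced.\<close>

lemma runs_copy_frame:
  assumes env: "env b sp j s" and red: "\<And>a. WO \<le> a \<Longrightarrow> cof s a mod m = cof s a"
  shows "runs P m copy_frame s T_copy (\<lambda>s'. idx_eq scratch s s' \<and>
    (\<forall>a. cof s' a = (if b + W \<le> a \<and> a < b + W + W then cof s (a - W) else cof s a)))"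
  unfolding copy_frame_def
proof (rule runs_For[where bnd = W and B = 30 and I = "\<lambda>i s'. idx_eq scratch s s' \<and> idx s' 17 = i \<and>
    (\<forall>a. cof s' a = (if b + W \<le> a \<and> a < b + W + i then cof s (a - W) else cof s a))"],
    goal_cases)
  case (3 i s')
  then have e: "idx s' 5 = b" "idx s' 6 = W"
    using envD[OF env] by (auto simp: idx_eq_def)
  show ?case
    by (rule runs_SetC) (use 3 e red envD(10)[OF env] in \<open>auto simp: add.assoc idx_eq_def\<close>)
qed (use envD[OF env] in \<open>auto simp: idx_eq_def T_copy_def\<close>)

text \<open>\<open>z\<close> and \<open>e\<close> are evaluated afresh in each round, hence the
  assumptions about all states that agree in the non-scratch registers. \<open>z\<close> may rely on
  coefficient cells below the child frame, because the loop writes only the weight of the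
  child.\<close>

lemma runs_scale_child:
  assumes env: "env b sp j s"
    and z: "\<And>s'. idx_eq scratch s s' \<Longrightarrow> (\<And>a. a < b + W \<Longrightarrow> cof s' a = cof s a) \<Longrightarrow>
      cval m s' z = zv mod m"
    and e: "\<And>s'. idx_eq scratch s s' \<Longrightarrow> ival s' e = ev"
    and T: "D * (ccost z + 2 * icost e + 50) + 20 \<le> T"
  shows "runs P m (scale_child z e) s T (\<lambda>s'. idx_eq scratch s s' \<and>
    (\<forall>t<D. cof s' (b + W + WO + t) = shift_scale m zv ev (\<lambda>t. cof s (b + WO + t)) t) \<and>
    (\<forall>a. (a < b + W + WO \<or> b + W + W \<le> a) \<longrightarrow> cof s' a = cof s a))"
  unfolding scale_child_def
proof (rule runs_For[where bnd = D and B = "ccost z + 2 * icost e + 36" and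
    I = "\<lambda>i s'. idx_eq scratch s s' \<and> idx s' 17 = i \<and>
    (\<forall>t<i. cof s' (b + W + WO + t) = shift_scale m zv ev (\<lambda>t. cof s (b + WO + t)) t) \<and>
    (\<forall>a. (a < b + W + WO \<or> b + W + W \<le> a) \<longrightarrow> cof s' a = cof s a)"],
    goal_cases)
  case (3 i s')
  then have eq: "idx_eq scratch s s'" and cof: "\<And>a. a < b + W + WO \<Longrightarrow> cof s' a = cof s a"
    and iv: "idx s' 17 = i" by auto
  then have r: "idx s' 4 = D" "idx s' 5 = b" "idx s' 6 = W" "idx s' 9 = WO"
    using envD[OF env] by (auto simp: idx_eq_def)
  have ez: "cval m s' z = zv mod m" "ival s' e = ev"
    using z[OF eq] e[OF eq] cof by auto
  have src: "cof s' (b + (WO + (i - ev))) = cof s (b + WO + (i - ev))"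
    using 3 cof by (simp add: W_def add.assoc)
  have iW: "b + W + WO + i < b + W + W" using 3 by (simp add: W_def)
  show ?case
  proof (rule runs_Cond[where ?T1.0 = "ccost z + icost e + 32"], goal_cases)
    case 1
    then show ?case
      by (intro runs_SetC) (use 3 r ez iv iW in \<open>auto simp: shift_scale_def idx_eq_def less_Suc_eq add.assoc\<close>)
  next
    case 2
    then show ?case
      by (intro runs_SetC) (use 3 r ez iv iW src in
          \<open>auto simp: shift_scale_def idx_eq_def less_Suc_eq add.assoc mod_mult_left_eq mod_mult_right_eq\<close>)
  qed simp
qed (use envD[OF env] T in \<open>auto simp: idx_eq_def algebra_simps\<close>)

lemma runs_mult_weight:
  assumes env: "env b sp j s"
    and a: "\<And>s'. idx_eq scratch s s' \<Longrightarrow> ival s' a = av"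
    and w: "\<And>s'. idx_eq scratch s s' \<Longrightarrow> ival s' w = wv"
    and sep: "av + D \<le> wv"
    and T: "D * (D * (icost a + 3 * icost w + 60) + icost a + 3 * icost w + 60) + 20 \<le> T"
  shows "runs P m (mult_weight w a) s T (\<lambda>s'. idx_eq scratch s s' \<and>
    (\<forall>x. cof s' x = (if wv \<le> x \<and> x < wv + D
      then conv m (\<lambda>t. cof s (av + t)) (\<lambda>t. cof s (wv + t)) (x - wv) else cof s x)))"
  unfolding mult_weight_def
proof (rule runs_For[where bnd = D and
    B = "D * (icost a + 3 * icost w + 55) + icost a + 3 * icost w + 45" and
    I = "\<lambda>i s'. idx_eq scratch s s' \<and> idx s' 17 = i \<and>
    (\<forall>x. cof s' x = (if wv + (D - i) \<le> x \<and> x < wv + D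
      then conv m (\<lambda>t. cof s (av + t)) (\<lambda>t. cof s (wv + t)) (x - wv) else cof s x))"],
    goal_cases)
  case (3 i s')
  let ?a = "\<lambda>t. cof s (av + t)" and ?w = "\<lambda>t. cof s (wv + t)"
  \<comment> \<open>The degree completed in round \<open>i\<close>; everything above it already
    holds the product, everything up to it the old weight.\<close>
  define t where "t = D - (i + 1)"
  then have t: "t < D" "wv + (D - i) = wv + t + 1" "D - Suc i = t" using 3 by auto
  have eq: "idx_eq scratch s s'" and iv: "idx s' 17 = i" using 3 by auto
  have D4: "idx s' 4 = D" using envD[OF env] eq by (simp add: idx_eq_def)
  have low: "cof s' x = cof s x" if "x \<le> wv + t" for x
    using 3 that t by auto
  let ?s1 = "s'\<lparr>idx := (idx s')(18 := t)\<rparr>"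
  let ?s2 = "?s1\<lparr>cof := (cof ?s1)(wv + t := (?a 0 * ?w t) mod m)\<rparr>"
  have eq1: "idx_eq scratch s ?s1" using eq by (simp add: idx_eq_def)
  show ?case
  proof (rule runs_Seq[where ?T1.0 = 10 and ?T2.0 = "D * (icost a + 3 * icost w + 55) + icost a + 3 * icost w + 35"],
      rule runs_SetI, goal_cases)
    case 1
    have "runs P m (For 19 (R 18) (SetC (IAdd w (R 18)) (CAdd (CCell (IAdd w (R 18)))
        (CMul (CCell (IAdd a (IAdd (R 19) (INum 1))))
          (CCell (IAdd w (ISub (R 18) (IAdd (R 19) (INum 1))))))))) ?s2
        (D * (icost a + 3 * icost w + 55) + 20)
      (\<lambda>s''. idx_eq scratch s s'' \<and> idx s'' 17 = i \<and>
        cof s'' = (cof s')(wv + t := conv m ?a ?w t))"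
    proof (rule runs_For[where bnd = t and B = "icost a + 3 * icost w + 40" and
      I = "\<lambda>l s''. idx_eq scratch s s'' \<and> idx s'' 17 = i \<and> idx s'' 18 = t \<and> idx s'' 19 = l \<and>
        cof s'' = (cof s')(wv + t := (\<Sum>q\<le>l. ?a q * ?w (t - q)) mod m)"], goal_cases)
      case 1
      then show ?case using eq iv by (simp add: idx_eq_def)
    next
      case (3 l s'')
      then have v: "ival s'' a = av" "ival s'' w = wv" using a w by auto
      have "cof s'' (av + Suc l) = ?a (Suc l)"
        "cof s'' (wv + (t - Suc l)) = ?w (t - Suc l)"
        using 3 low sep t by (auto simp: add.assoc)
      then have V: "cval m s'' (CAdd (CCell (IAdd w (R 18)))
        (CMul (CCell (IAdd a (IAdd (R 19) (INum 1))))
          (CCell (IAdd w (ISub (R 18) (IAdd (R 19) (INum 1)))))))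
        = (\<Sum>q\<le>Suc l. ?a q * ?w (t - q)) mod m"
        using 3 v by (simp add: mod_simps)
      have W: "ival s'' (IAdd w (R 18)) = wv + t" using 3 v by simp
      show ?case
        by (rule runs_SetC, unfold V W) (use 3 in \<open>simp_all add: idx_eq_def del: sum.atMost_Suc\<close>)
    next
      case (5)
      have "t * (icost a + 3 * icost w + 55) \<le> D * (icost a + 3 * icost w + 55)"
        using t by (intro mult_right_mono) auto
      then show ?case by (simp add: algebra_simps)
    qed (use t in \<open>auto simp: conv_def idx_eq_def\<close>)
    then have loop: "runs P m (For 19 (R 18) (SetC (IAdd w (R 18)) (CAdd (CCell (IAdd w (R 18)))
        (CMul (CCell (IAdd a (IAdd (R 19) (INum 1))))
          (CCell (IAdd w (ISub (R 18) (IAdd (R 19) (INum 1))))))))) ?s2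
        (D * (icost a + 3 * icost w + 55) + 20)
      (\<lambda>s''. idx_eq scratch s (s''\<lparr>idx := (idx s'')(17 := Suc (idx s'' 17))\<rparr>) \<and> idx s'' 17 = i \<and>
        (\<forall>x. cof s'' x = (if wv + (D - Suc i) \<le> x \<and> x < wv + D then conv m ?a ?w (x - wv) else cof s x)))"
    proof (rule runs_mono)
      fix s'' assume *: "idx_eq scratch s s'' \<and> idx s'' 17 = i \<and> cof s'' = (cof s')(wv + t := conv m ?a ?w t)"
      have "cof s'' x = (if wv + (D - Suc i) \<le> x \<and> x < wv + D then conv m ?a ?w (x - wv) else cof s x)" for x
        using * 3 t by (cases "x = wv + t") auto
      with * show "idx_eq scratch s (s''\<lparr>idx := (idx s'')(17 := Suc (idx s'' 17))\<rparr>) \<and> idx s'' 17 = i \<and>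
        (\<forall>x. cof s'' x = (if wv + (D - Suc i) \<le> x \<and> x < wv + D then conv m ?a ?w (x - wv) else cof s x))"
        by (simp add: idx_eq_def)
    qed simp
    have t': "ival s' (ISub (R 4) (IAdd (R 17) (INum 1))) = t" using iv D4 by (simp add: t_def)
    have addr: "ival ?s1 (IAdd w (R 18)) = wv + t" using w[OF eq1] by simp
    have val: "cval m ?s1 (CMul (CCell a) (CCell (IAdd w (R 18)))) = (?a 0 * ?w t) mod m"
      using a[OF eq1] w[OF eq1] low[of av] low[of "wv + t"] sep t by (simp add: mod_simps)
    show ?case
    proof (unfold t' ival.simps(1), rule runs_Seq[where ?T1.0 = "icost a + 2 * icost w + 15" and ?T2.0 = "D * (icost a + 3 * icost w + 55) + 20"],
        rule runs_SetC, unfold addr val, goal_cases)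
      case 1
      show ?case by (rule runs_mono[OF loop]) auto
    qed auto
  next
    case 2
    show ?case by simp
  qed simp
qed (use envD[OF env] T in \<open>auto simp: idx_eq_def algebra_simps\<close>)

lemma runs_add_weight:
  assumes env: "env b sp j s" and T: "D * 60 + 20 \<le> T"
  shows "runs P m add_weight s T (\<lambda>s'. idx_eq scratch s s' \<and>
    (\<forall>x. cof s' x = (if x < D then (cof s x + cof s (b + WO + x)) mod m else cof s x)))"
  unfolding add_weight_def
proof (rule runs_For[where bnd = D and B = 40 and I = "\<lambda>i s'. idx_eq scratch s s' \<and> idx s' 17 = i \<and>
    (\<forall>x. cof s' x = (if x < i then (cof s x + cof s (b + WO + x)) mod m else cof s x))"],
    goal_cases)
  case (3 i s')
  then have r: "idx s' 5 = b" "idx s' 9 = WO" "idx s' 17 = i"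
    using envD[OF env] by (auto simp: idx_eq_def)
  have src: "cof s' (b + (WO + i)) = cof s (b + (WO + i))"
    using 3 D_add_2_le_WO by auto
  show ?case
    by (rule runs_SetC) (use 3 r src in \<open>auto simp: add.assoc idx_eq_def mod_simps less_Suc_eq\<close>)
qed (use envD[OF env] T in \<open>auto simp: idx_eq_def\<close>)

section \<open>The row operation in memory\<close>

definition entries :: "memory \<Rightarrow> nat \<Rightarrow> (nat \<Rightarrow> nat \<Rightarrow> nat \<Rightarrow> int) \<Rightarrow> bool" where
  "entries s b A \<longleftrightarrow> (\<forall>x<2*n. \<forall>y<2*n. \<forall>t<D. cof s (b + ent x y t) = A x y t)"

lemma entriesD: "entries s b A \<Longrightarrow> x < 2 * n \<Longrightarrow> y < 2 * n \<Longrightarrow> t < D \<Longrightarrow> cof s (b + ent x y t) = A x y t"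
  by (simp add: entries_def)

lemma frame_iff: "frame s b A u \<longleftrightarrow> entries s b A \<and> (\<forall>t<D. cof s (b + WO + t) = u t)"
  by (simp add: frame_def entries_def)

lemma entries_update:
  assumes "entries s b A" "x < 2 * n" "y < 2 * n" "t < D"
  shows "entries (s\<lparr>cof := (cof s)(b + ent x y t := v)\<rparr>) b
    (\<lambda>x' y' t'. if x' = x \<and> y' = y \<and> t' = t then v else A x' y' t')"
  using assms unfolding entries_def by (auto simp: ent_inj)

lemma entries_idx [simp]: "entries (s\<lparr>idx := f\<rparr>) b A = entries s b A"
  by (simp add: entries_def)

lemma entries_mono:
  "entries s b A \<Longrightarrow> (\<And>x y t. x < 2 * n \<Longrightarrow> y < 2 * n \<Longrightarrow> t < D \<Longrightarrow> A x y t = A' x y t) \<Longrightarrow> entries s b A'"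
  by (simp add: entries_def)

definition outside :: "nat \<Rightarrow> nat \<Rightarrow> memory \<Rightarrow> memory \<Rightarrow> bool" where
  "outside b l s s' \<longleftrightarrow> (\<forall>a. a \<noteq> D + 1 \<and> (a < b \<or> b + l \<le> a) \<longrightarrow> cof s' a = cof s a)"

lemma outside_idx [simp]: "outside b l s (s'\<lparr>idx := f\<rparr>) = outside b l s s'"
  by (simp add: outside_def)

lemma outside_update:
  "outside b l s s' \<Longrightarrow> b \<le> a \<Longrightarrow> a < b + l \<Longrightarrow> outside b l s (s'\<lparr>cof := (cof s')(a := v)\<rparr>)"
  by (auto simp: outside_def)

text \<open>A row operation interrupted in the middle: \<open>P\<close> marks the columns and
  degrees that have been treated so far. It serves as invariant of both nested loops.\<close>

definition part_row ::
    "nat \<Rightarrow> nat \<Rightarrow> int \<Rightarrow> nat \<Rightarrow> (nat \<Rightarrow> nat \<Rightarrow> bool) \<Rightarrow> (nat \<Rightarrow> nat \<Rightarrow> nat \<Rightarrow> int) \<Rightarrow> nat \<Rightarrow> nat \<Rightarrow> nat \<Rightarrow> int"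
  where "part_row p q c e P A x y t =
    (if x = p \<and> y \<noteq> p \<and> y \<noteq> q \<and> e \<le> t \<and> P y t then (A p y t - c * A q y (t - e)) mod m
     else if y = p \<and> x \<noteq> p \<and> x \<noteq> q \<and> e \<le> t \<and> P x t then (A p x t - c * A q x (t - e)) mod m
     else A x y t)"

lemma mod_coefficient: "(a - c mod m * b) mod m = (a - c * b) mod (m::int)"
  by (metis mod_diff_right_eq mod_mult_left_eq)

definition T_row :: nat where "T_row = 2 * n * (D * 400 + 400) + 400"

lemma runs_sub_row:
  assumes env: "env b sp j s" and fr: "frame s b A u"
    and regs: "idx s 10 = i" "idx s 11 = d" "idx s 12 = p" "idx s 13 = q" "idx s 14 = v"
    and lt: "i < 2 * n" "d < D" "p < 2 * n" "q < 2 * n" and pq: "p \<noteq> q"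
    and sym: "symm A"
  shows "runs P m sub_row s T_row (\<lambda>s'. idx_eq scratch s s' \<and> outside b WO s s' \<and>
    frame s' b (row_op m p q (A i p d) (d - v) A) u)"
proof -
  define e where "e = d - v"
  \<comment> \<open>The machine keeps the multiplier in reduced form; \<open>mod_coefficient\<close>
    restores the unreduced one at the end.\<close>
  define c where "c = A i p d mod m"
  let ?PR = "\<lambda>P. part_row p q c e P A"
  let ?s1 = "s\<lparr>cof := (cof s)(D + 1 := c)\<rparr>"
  have Wb: "WO \<le> b" using envD[OF env] by simp
  then have Db: "D + 1 < b" using D_add_2_le_WO by simp
  have ent_s: "entries s b A" using fr by (simp add: frame_iff)
  have addr_c: "ival s (ENT (R 5) (R 10) (R 12) (R 11)) = b + ent i p d"
    by (subst ival_ENT[OF env]) (use regs lt envD[OF env] in simp_all)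
  have val_c: "cval m s (CCell (ENT (R 5) (R 10) (R 12) (R 11))) = c"
    unfolding cval.simps addr_c c_def using entriesD[OF ent_s] lt by simp
  define I where "I = (\<lambda>x P s'. idx_eq scratch s s' \<and> idx s' 17 = x \<and> cof s' (D + 1) = c \<and>
    outside b WO s s' \<and> entries s' b (?PR P))"
  have I_env: "env b sp j s'" if "I x P s'" for x P s'
    by (rule env_idx_eq[OF env])
      (use that D_add_2_le_WO Wb in \<open>auto simp: I_def outside_def idx_eq_def\<close>)
  have I_regs: "idx s' 11 = d" "idx s' 12 = p" "idx s' 13 = q" "idx s' 14 = v" "idx s' 17 = x"
    if "I x P s'" for x P s'
    using that regs by (auto simp: I_def idx_eq_def)
  have inner: "runs P m (For 18 (ISub (R 4) (ISub (R 11) (R 14)))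
        (Seq (SetC (ENT (R 5) (R 12) (R 17) (IAdd (R 18) (ISub (R 11) (R 14))))
          (CSub (CCell (ENT (R 5) (R 12) (R 17) (IAdd (R 18) (ISub (R 11) (R 14)))))
            (CMul (CCell (IAdd (R 4) (INum 1))) (CCell (ENT (R 5) (R 13) (R 17) (R 18))))))
         (SetC (ENT (R 5) (R 17) (R 12) (IAdd (R 18) (ISub (R 11) (R 14))))
          (CCell (ENT (R 5) (R 12) (R 17) (IAdd (R 18) (ISub (R 11) (R 14)))))))) s'
        (D * 300 + 50) (\<lambda>s''. I x (\<lambda>y t. y < Suc x) s'')"
    if x: "x < 2 * n" "x \<noteq> p" "x \<noteq> q" and s': "I x (\<lambda>y t. y < x) s'" for x s'
  proof (rule runs_For[where bnd = "D - e" and B = 200 and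
        I = "\<lambda>l s''. idx s'' 18 = l \<and> I x (\<lambda>y t. y < x \<or> y = x \<and> t < e + l) s''"], goal_cases)
    case 1
    \<comment> \<open>In degrees below \<open>e\<close> nothing is ever done, so column
      \<open>x\<close> may count as treated there from the start.\<close>
    have "part_row p q c e (\<lambda>y t. y < x \<or> y = x \<and> t < e + 0) A = part_row p q c e (\<lambda>y t. y < x) A"
      by (intro ext) (auto simp: part_row_def)
    then show ?case using s' by (simp add: I_def idx_eq_def)
  next
    case (2 l s'')
    then show ?case using envD(2)[OF I_env] I_regs by (auto simp: e_def)
  next
    case (3 l s'')
    let ?Pr = "\<lambda>y t. y < x \<or> y = x \<and> t < e + l"
    from 3 have I'': "I x ?Pr s''" and l: "idx s'' 18 = l" "l + e < D" "l < D" by auto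
    note en = I_env[OF I''] and rg = I_regs[OF I'']
    have E: "entries s'' b (?PR ?Pr)" using I'' by (simp add: I_def)
    have a1: "ival s'' (ENT (R 5) (R 12) (R 17) (IAdd (R 18) (ISub (R 11) (R 14)))) = b + ent p x (l + e)"
      by (subst ival_ENT[OF en]) (use rg lt x l envD[OF en] in \<open>simp_all add: e_def\<close>)
    have a2: "ival s'' (ENT (R 5) (R 13) (R 17) (R 18)) = b + ent q x l"
      by (subst ival_ENT[OF en]) (use rg lt x l envD[OF en] in \<open>simp_all add: e_def\<close>)
    have v1: "cval m s'' (CSub (CCell (ENT (R 5) (R 12) (R 17) (IAdd (R 18) (ISub (R 11) (R 14)))))
            (CMul (CCell (IAdd (R 4) (INum 1))) (CCell (ENT (R 5) (R 13) (R 17) (R 18)))))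
        = (A p x (l + e) - c * A q x l) mod m"
    proof -
      have "cof s'' (b + ent p x (l + e)) = A p x (l + e)" "cof s'' (b + ent q x l) = A q x l"
        using entriesD[OF E] lt x l pq by (auto simp: part_row_def)
      moreover have "cof s'' (D + 1) = c" using I'' by (simp add: I_def)
      ultimately show ?thesis using envD[OF en] unfolding cval.simps a1 a2 by (simp add: mod_simps)
    qed
    define w where "w = (A p x (l + e) - c * A q x l) mod m"
    let ?s2 = "s''\<lparr>cof := (cof s'')(b + ent p x (l + e) := w)\<rparr>"
    have lp: "ent p x (l + e) < WO" "ent x p (l + e) < WO"
      using lt x l by (auto intro!: ent_less)
    have en2: "env b sp j ?s2"
      by (rule env_idx_eq[OF en]) (use Db in \<open>simp_all add: idx_eq_def\<close>)
    have b1: "ival ?s2 (ENT (R 5) (R 17) (R 12) (IAdd (R 18) (ISub (R 11) (R 14)))) = b + ent x p (l + e)"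
      by (subst ival_ENT[OF en2]) (use rg lt x l envD[OF en] in \<open>simp_all add: e_def\<close>)
    have b2: "ival ?s2 (ENT (R 5) (R 12) (R 17) (IAdd (R 18) (ISub (R 11) (R 14)))) = b + ent p x (l + e)"
      by (subst ival_ENT[OF en2]) (use rg lt x l envD[OF en] in \<open>simp_all add: e_def\<close>)
    have v2: "cval m ?s2 (CCell (ENT (R 5) (R 12) (R 17) (IAdd (R 18) (ISub (R 11) (R 14))))) = w"
      unfolding cval.simps b2 by (simp add: w_def)
    let ?s3 = "?s2\<lparr>cof := (cof ?s2)(b + ent x p (l + e) := w)\<rparr>"
    have E3: "entries ?s3 b (?PR (\<lambda>y t. y < x \<or> y = x \<and> t < e + Suc l))"
    proof (rule entries_mono[OF entries_update[OF entries_update[OF E]]])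
      fix y z t
      have P: "y < x \<or> y = x \<and> t < e + Suc l \<longleftrightarrow> (y = x \<and> t = l + e) \<or> ?Pr y t" for y t
        by (cases "y = x") (simp_all add: less_Suc_eq disj_commute add.commute)
      consider "y = p" | "y \<noteq> p" "z = p" | "y \<noteq> p" "z \<noteq> p" by blast
      then show "(if y = x \<and> z = p \<and> t = l + e then w
          else if y = p \<and> z = x \<and> t = l + e then w else ?PR ?Pr y z t)
        = ?PR (\<lambda>y t. y < x \<or> y = x \<and> t < e + Suc l) y z t"
      proof cases
        case 1
        then show ?thesis using x unfolding P part_row_def
          by (cases "z = x \<and> t = l + e") (auto simp: w_def)
      next
        case 2
        then show ?thesis using x unfolding P part_row_def
          by (cases "y = x \<and> t = l + e") (auto simp: w_def)
      next
        case 3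
        then show ?thesis by (auto simp: part_row_def)
      qed
    qed (use lt x l in simp_all)
    have out3: "outside b WO s ?s3"
      using I'' lp by (intro outside_update) (auto simp: I_def)
    have "I x (\<lambda>y t. y < x \<or> y = x \<and> t < e + Suc l) (?s3\<lparr>idx := (idx ?s3)(18 := Suc (idx ?s3 18))\<rparr>)"
      unfolding I_def entries_idx outside_idx
      using I'' E3 out3 Db by (auto simp: I_def idx_eq_def)
    then show ?case
      by (intro runs_Seq[where ?T1.0 = 90 and ?T2.0 = 100] runs_SetC; (unfold a1 v1 w_def[symmetric] b1 v2)?)
        (use l in simp_all)
  next
    case (4 s'')
    have "entries s'' b (?PR (\<lambda>y t. y < Suc x))"
      by (rule entries_mono[of _ _ "?PR (\<lambda>y t. y < x \<or> y = x \<and> t < e + (D - e))"])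
        (use 4 in \<open>auto simp: I_def part_row_def less_Suc_eq\<close>)
    with 4 show ?case by (simp add: I_def)
  next
    case 5
    have "(D - e) * 300 \<le> D * 300" by (intro mult_right_mono) auto
    then show ?case by simp
  qed
  have "runs P m (For 17 (R 3) (Cond (BConj (INeq (R 17) (R 12)) (INeq (R 17) (R 13)))
      (For 18 (ISub (R 4) (ISub (R 11) (R 14)))
        (Seq (SetC (ENT (R 5) (R 12) (R 17) (IAdd (R 18) (ISub (R 11) (R 14))))
          (CSub (CCell (ENT (R 5) (R 12) (R 17) (IAdd (R 18) (ISub (R 11) (R 14)))))
            (CMul (CCell (IAdd (R 4) (INum 1))) (CCell (ENT (R 5) (R 13) (R 17) (R 18))))))
         (SetC (ENT (R 5) (R 17) (R 12) (IAdd (R 18) (ISub (R 11) (R 14))))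
          (CCell (ENT (R 5) (R 12) (R 17) (IAdd (R 18) (ISub (R 11) (R 14))))))))
      Skip)) ?s1 (2 * n * (D * 300 + 200) + 100)
      (\<lambda>s'. idx_eq scratch s s' \<and> outside b WO s s' \<and> frame s' b (row_op m p q (A i p d) (d - v) A) u)"
  proof (rule runs_For[where bnd = "2 * n" and B = "D * 300 + 120" and
        I = "\<lambda>x. I x (\<lambda>y t. y < x)"], goal_cases)
    case 1
    have "entries ?s1 b A"
      using ent_s Db by (auto simp: entries_def)
    moreover have "?PR (\<lambda>y t. y < 0) = A"
      by (intro ext) (simp add: part_row_def)
    ultimately show ?case by (simp add: I_def idx_eq_def outside_def)
  next
    case (2 x s')
    then show ?case using envD(1)[OF I_env] I_regs by auto
  next
    case (3 x s')
    note rg = I_regs[OF 3(2)]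
    have upd: "I (Suc x) P' (s''\<lparr>idx := (idx s'')(17 := Suc (idx s'' 17))\<rparr>)" if "I x P' s''" for s'' P'
      using that by (simp add: I_def idx_eq_def)
    show ?case
    proof (rule runs_Cond[where ?T1.0 = "D * 300 + 60"], goal_cases)
      case 1
      then have "x \<noteq> p" "x \<noteq> q" using rg by auto
      from runs_mono[OF inner[OF 3(1) this 3(2)] _ upd] show ?case by simp
    next
      case 2
      then have x: "x = p \<or> x = q" using rg by auto
      have "entries s' b (?PR (\<lambda>y t. y < Suc x))"
        by (rule entries_mono[of _ _ "?PR (\<lambda>y t. y < x)"])
          (use 3(2) x in \<open>auto simp: I_def part_row_def less_Suc_eq\<close>)
      with 3(2) have "I x (\<lambda>y t. y < Suc x) s'" by (simp add: I_def)
      from upd[OF this] show ?case by (intro runs_Skip) auto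
    qed simp
  next
    case (4 s')
    have "entries s' b (row_op m p q (A i p d) (d - v) A)"
      by (rule entries_mono[of _ _ "?PR (\<lambda>y t. y < 2 * n)"])
        (use 4 in \<open>auto simp: I_def part_row_def row_op_def c_def e_def mod_coefficient\<close>)
    moreover have "cof s' (b + WO + t) = u t" if "t < D" for t
      using 4 fr that Db by (auto simp: I_def outside_def frame_iff)
    ultimately show ?case using 4 by (simp add: I_def frame_iff)
  qed (simp add: algebra_simps)
  then show ?thesis unfolding sub_row_def
    by (intro runs_Seq[where ?T1.0 = 60 and ?T2.0 = "2 * n * (D * 300 + 200) + 100"] runs_SetC;
        (unfold val_c)?) (use envD[OF env] in \<open>simp_all add: T_row_def algebra_simps\<close>)
qed

end

section \<open>Recursive calls\<close>

definition alive :: "iexp \<Rightarrow> bexp" where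
  "alive x = CZero (CCell (ENT (R 5) x x (INum 0)))"

definition kill_cell :: "iexp \<Rightarrow> iexp \<Rightarrow> com" where
  "kill_cell b x = SetC (ENT b x x (INum 0)) (CNum 1)"

text \<open>Frame base and precision are recovered by inverse arithmetic, which is safe because
  calls occur only at precision at least 1, so the truncated subtraction loses nothing. The stack
  has to hold only the variables of the elimination.\<close>

definition recurse :: com where
  "recurse = Seq (SetI (INum 5) (IAdd (R 5) (R 6))) (Seq (SetI (INum 8) (ISub (R 8) (INum 1)))
    (Seq (Call 1) (Seq (SetI (INum 5) (ISub (R 5) (R 6))) (SetI (INum 8) (IAdd (R 8) (INum 1))))))"

definition current :: cexp where
  "current = CCell (ENT (R 5) (R 10) (R 12) (R 11))"

abbreviation child_base :: iexp where "child_base \<equiv> IAdd (R 5) (R 6)"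

definition spawn_entry :: com where
  "spawn_entry = Seq copy_frame (Seq (scale_child current (R 11))
    (Seq (kill_cell child_base (R 12)) (Seq (kill_cell child_base (R 10)) recurse)))"

text \<open>The factor 2 of the correction term enters as \<open>CAdd current current\<close>; it
  lowers the precision of the child even if the coefficient is odd. The two entries of the pivot row
  are read from the parent frame, which still holds the matrix before the row operation.\<close>

definition spawn_pair :: com where
  "spawn_pair = Seq copy_frame (Seq (scale_child (CAdd current current) (ISub (R 11) (R 14)))
    (Seq (mult_weight (IAdd child_base (R 9)) (ENT (R 5) (R 13) (R 15) (INum 0)))
    (Seq (mult_weight (IAdd child_base (R 9)) (ENT (R 5) (R 13) (R 16) (INum 0)))
    (Seq (kill_cell child_base (R 16)) (Seq (kill_cell child_base (R 15))
    (Seq (kill_cell child_base (R 13)) (Seq (kill_cell child_base (R 12)) recurse)))))))"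

lemma runs_Seq':
  "runs P m c1 s T1 Q1 \<Longrightarrow> (\<And>s'. Q1 s' \<Longrightarrow> runs P m c2 s' T2 Q) \<Longrightarrow> T1 + T2 \<le> T \<Longrightarrow>
    runs P m (Seq c1 c2) s T Q"
  by (rule runs_Seq[OF runs_mono[OF _ order_refl]])

lemma cval_reduced: "cval m s e mod m = cval m s e"
  by (cases e) simp_all

text \<open>Every store into coefficient memory writes a value of \<open>cval\<close>, which is
  reduced. Hence reducedness passes through arbitrary programs and needs no care in the individual
  subroutines.\<close>

lemma exec_reduced:
  "exec P m c s t s' \<Longrightarrow> cof s a mod m = cof s a \<Longrightarrow> cof s' a mod m = cof s' a"
  by (induction rule: exec.induct) (auto simp: cval_reduced)

context hafnian_run
begin

section \<open>The contract of a recursive call and the assembly of its frame\<close>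

definition reduced :: "memory \<Rightarrow> bool" where
  "reduced s \<longleftrightarrow> (\<forall>a\<ge>WO. cof s a mod m = cof s a)"

lemma runs_reduced:
  "runs P m c s T Q \<Longrightarrow> reduced s \<Longrightarrow> runs P m c s T (\<lambda>s'. Q s' \<and> reduced s')"
  unfolding runs_def reduced_def using exec_reduced by blast

text \<open>The licence given to a call: it may ruin its own frame and all later ones, the stack
  from \<open>sp\<close> on, the accumulator and the temporary cell. The frame of the caller ends
  where that of the callee begins, and therefore survives.\<close>

definition after :: "nat set \<Rightarrow> nat \<Rightarrow> nat \<Rightarrow> memory \<Rightarrow> memory \<Rightarrow> bool" where
  "after X b sp s s' \<longleftrightarrow> (\<forall>a<sp. a \<notin> X \<longrightarrow> idx s' a = idx s a) \<and>
    (\<forall>a. D \<le> a \<and> a < b \<and> a \<noteq> D + 1 \<longrightarrow> cof s' a = cof s a)"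

lemma after_refl [simp]: "after X b sp s s"
  by (simp add: after_def)

lemma after_trans [trans]: "after X b sp s s' \<Longrightarrow> after X b sp s' s'' \<Longrightarrow> after X b sp s s''"
  by (simp add: after_def)

lemma after_mono: "after X b sp s s' \<Longrightarrow> X \<subseteq> Y \<Longrightarrow> b' \<le> b \<Longrightarrow> sp' \<le> sp \<Longrightarrow> after Y b' sp' s s'"
  unfolding after_def by (meson less_le_trans subsetD)

lemma after_env:
  assumes "env b sp j s" "after X b' sp s s'" "X \<subseteq> {10..<20}" "b \<le> b'"
  shows "env b sp j s'"
proof -
  have *: "idx s' a = idx s a" if "a < 30 + 4 * n" "a \<notin> {10..<20}" for a
  proof -
    have "a < sp" "a \<notin> X" using that envD(11)[OF assms(1)] assms(3) by auto
    with assms(2) show ?thesis by (simp add: after_def)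
  qed
  have "cof s' D = cof s D"
    using assms D_add_2_le_WO envD(10)[OF assms(1)] by (simp add: after_def)
  with assms(1) show ?thesis unfolding env_def using n_pos by (auto simp: *)
qed

lemma after_frame:
  assumes "after X b' sp s s'" "b + W \<le> b'" "WO \<le> b"
  shows "frame s' b A u = frame s b A u"
  by (rule frame_cong) (use assms D_add_2_le_WO in \<open>auto simp: after_def\<close>)

lemma after_idx_eq:
  "idx_eq X s s' \<Longrightarrow> (\<And>a. D \<le> a \<Longrightarrow> a < b \<Longrightarrow> a \<noteq> D + 1 \<Longrightarrow> cof s' a = cof s a) \<Longrightarrow> after X b sp s s'"
  by (auto simp: after_def idx_eq_def)

definition acc :: "memory \<Rightarrow> int poly" where
  "acc s = pol D (cof s)"

lemma acc_cong: "(\<And>a. a < D \<Longrightarrow> cof s' a = cof s a) \<Longrightarrow> acc s' = acc s"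
  unfolding acc_def by (rule pol_cong)

text \<open>The result is stated modulo the full \<open>2 ^ k\<close> at every precision; the loss
  of precision is hidden in the divisibility of the weight.\<close>

definition solves :: "program \<Rightarrow> nat \<Rightarrow> nat \<Rightarrow> bool" where
  "solves P j T \<longleftrightarrow> (\<forall>b sp s A u. env b sp j s \<longrightarrow> reduced s \<longrightarrow> frame s b A u \<longrightarrow> symm A \<longrightarrow>
    zero_diag A \<longrightarrow> dvw j u \<longrightarrow> runs P m (Call 1) s T (\<lambda>s'. after scratch b sp s s' \<and> reduced s' \<and>
      acc s' \<approx> acc s + pol D u * haf A))"

lemma runs_recurse:
  assumes F: "solves P j T" and env: "env b sp (Suc j) s" and red: "reduced s"
    and fr: "frame s (b + W) A u" and A: "symm A" "zero_diag A" "dvw j u"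
  shows "runs P m recurse s (T + 40) (\<lambda>s'. after scratch (b + W) sp s s' \<and> reduced s' \<and>
      acc s' \<approx> acc s + pol D u * haf A)"
proof -
  let ?s1 = "s\<lparr>idx := (idx s)(5 := b + W, 8 := j)\<rparr>"
  have e: "env (b + W) sp j ?s1" using env unfolding env_def by auto
  have "reduced ?s1" "frame ?s1 (b + W) A u" "acc ?s1 = acc s"
    using red fr by (simp_all add: reduced_def frame_def acc_def)
  from F[unfolded solves_def, rule_format, OF e this(1,2) A, unfolded this(3)]
  have "runs P m (Call 1) ?s1 T (\<lambda>s'. after scratch (b + W) sp ?s1 s' \<and> reduced s' \<and>
      acc s' \<approx> acc s + pol D u * haf A)"
    .
  then have "runs P m (Seq (Call 1) (Seq (SetI (INum 5) (ISub (R 5) (R 6))) (SetI (INum 8) (IAdd (R 8) (INum 1)))))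
      ?s1 (T + 20) (\<lambda>s'. after scratch (b + W) sp s s' \<and> reduced s' \<and> acc s' \<approx> acc s + pol D u * haf A)"
  proof (rule runs_Seq'[where ?T2.0 = 20], goal_cases)
    case (1 s')
    then have r: "idx s' 5 = b + W" "idx s' 6 = W" "idx s' 8 = j"
      using envD[OF e] by (auto simp: after_def)
    let ?s2 = "s'\<lparr>idx := (idx s')(5 := b, 8 := Suc j)\<rparr>"
    have "idx s 5 = b" "idx s 8 = Suc j" using envD[OF env] by simp_all
    then have "after scratch (b + W) sp s ?s2" using 1 by (auto simp: after_def)
    moreover have "reduced ?s2" "acc ?s2 = acc s'" using 1 by (simp_all add: reduced_def acc_def)
    ultimately show ?case using 1 r
      by (intro runs_Seq[where ?T1.0 = 9 and ?T2.0 = 9] runs_SetI) simp_all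
  qed simp
  then show ?thesis unfolding recurse_def using envD[OF env]
    by - (rule runs_Seq[where ?T1.0 = 9 and ?T2.0 = "T + 30"], rule runs_SetI,
      rule runs_Seq[where ?T1.0 = 9 and ?T2.0 = "T + 20"], rule runs_SetI, simp_all)
qed

definition child :: "nat \<Rightarrow> nat \<Rightarrow> nat \<Rightarrow> (nat \<Rightarrow> nat \<Rightarrow> nat \<Rightarrow> int) \<Rightarrow> (nat \<Rightarrow> int) \<Rightarrow> memory \<Rightarrow>
    (nat \<Rightarrow> nat \<Rightarrow> nat \<Rightarrow> int) \<Rightarrow> (nat \<Rightarrow> int) \<Rightarrow> memory \<Rightarrow> bool" where
  "child b sp j A u s A' u' s' \<longleftrightarrow> env b sp j s' \<and> reduced s' \<and> frame s' b A u \<and>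
    frame s' (b + W) A' u' \<and> after scratch (b + W) sp s s' \<and> acc s' = acc s"

lemma child_frame_of_after:
  assumes "env b sp j s" "frame s b A u" "idx_eq scratch s s'"
    "\<And>a. a < b + W \<Longrightarrow> cof s' a = cof s a"
  shows "env b sp j s' \<and> frame s' b A u \<and> after scratch (b + W) sp s s' \<and> acc s' = acc s"
proof -
  have af: "after scratch (b + W) sp s s'" by (rule after_idx_eq) (use assms in auto)
  have "D < b" using envD(10)[OF assms(1)] D_add_2_le_WO by simp
  then show ?thesis
    using after_env[OF assms(1) af] after_frame[OF af order_refl envD(10)[OF assms(1)]] af assms(2,4)
      acc_cong[of s' s] by (auto simp: W_def)
qed

lemma child_copy:
  assumes "env b sp j s" "reduced s" "frame s b A u"
  shows "runs P m copy_frame s T_copy (child b sp j A u s A u)"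
proof (rule runs_mono[OF runs_reduced[OF runs_copy_frame[OF assms(1)] assms(2)]], goal_cases)
  case (1 a)
  then show ?case using assms(2) by (simp add: reduced_def)
next
  case (3 s')
  have "frame s' (b + W) A u"
    unfolding frame_def
  proof (intro conjI allI impI)
    fix x y t assume "x < 2 * n" "y < 2 * n" "t < D"
    from ent_less[OF this] entriesD[of s b A, OF _ this] show "cof s' (b + W + ent x y t) = A x y t"
      using 3 assms(3) by (simp add: frame_iff W_def)
  next
    fix t assume "t < D"
    then have "b + W + WO + t < b + W + W" "b + W + WO + t - W = b + WO + t" by (simp_all add: W_def)
    then show "cof s' (b + W + WO + t) = u t"
      using 3 assms(3) \<open>t < D\<close> by (simp add: frame_iff add.assoc)
  qed
  moreover have "idx_eq scratch s s'" "reduced s'" "\<And>a. a < b + W \<Longrightarrow> cof s' a = cof s a"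
    using 3 by auto
  ultimately show ?case using child_frame_of_after[OF assms(1,3), of s'] by (simp add: child_def)
qed simp

lemma child_scale:
  assumes c: "child b sp j A u s A u s1"
    and z: "\<And>s'. idx_eq scratch s1 s' \<Longrightarrow> (\<And>a. a < b + W \<Longrightarrow> cof s' a = cof s1 a) \<Longrightarrow>
      cval m s' z = zv mod m"
    and e: "\<And>s'. idx_eq scratch s1 s' \<Longrightarrow> ival s' e = ev"
    and T: "D * (ccost z + 2 * icost e + 50) + 20 \<le> T"
  shows "runs P m (scale_child z e) s1 T (child b sp j A u s A (shift_scale m zv ev u))"
proof -
  from c have env: "env b sp j s1" and red: "reduced s1" and fr: "frame s1 b A u"
    and fr': "frame s1 (b + W) A u" by (auto simp: child_def)
  show ?thesis
  proof (rule runs_mono[OF runs_reduced[OF runs_scale_child[OF env z e T] red]], goal_cases)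
    case (5 s')
    then have low: "\<And>a. a < b + W + WO \<Longrightarrow> cof s' a = cof s1 a"
      and new: "\<And>t. t < D \<Longrightarrow> cof s' (b + W + WO + t) = shift_scale m zv ev (\<lambda>t. cof s1 (b + WO + t)) t"
      by auto
    have "frame s' (b + W) A (shift_scale m zv ev u)"
      unfolding frame_def
    proof (intro conjI allI impI)
      fix x y t assume xyt: "x < 2 * n" "y < 2 * n" "t < D"
      from ent_less[OF this] low fr' xyt show "cof s' (b + W + ent x y t) = A x y t"
        by (simp add: frame_def)
    next
      fix t assume t: "t < D"
      then have "cof s1 (b + WO + (t - ev)) = u (t - ev)" using fr by (simp add: frame_def)
      with t show "cof s' (b + W + WO + t) = shift_scale m zv ev u t"
        by (auto simp: new shift_scale_def)
    qed
    moreover have "idx_eq scratch s1 s'" "reduced s'" "\<And>a. a < b + W \<Longrightarrow> cof s' a = cof s1 a"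
      using 5 low by auto
    ultimately show ?case using child_frame_of_after[OF env fr, of s'] c
      by (auto simp: child_def intro: after_trans)
  qed auto
qed

lemma child_mult:
  assumes c: "child b sp j A u s A' u' s1" and x: "idx s1 rx = x" "x < 2 * n" and y: "idx s1 ry = y" "y < 2 * n"
    and rx: "rx \<notin> scratch" "ry \<notin> scratch" and T: "D * (D * 300 + 300) + 20 \<le> T"
  shows "runs P m (mult_weight (IAdd child_base (R 9)) (ENT (R 5) (R rx) (R ry) (INum 0))) s1 T
    (child b sp j A u s A' (conv m (A x y) u'))"
proof -
  from c have env: "env b sp j s1" and red: "reduced s1" and fr: "frame s1 b A u"
    and fr': "frame s1 (b + W) A' u'" by (auto simp: child_def)
  have env': "env b sp j s'" if "idx_eq scratch s1 s'" "cof s' D = cof s1 D" for s'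
    by (rule env_idx_eq[OF env]) (use that in \<open>auto simp: idx_eq_def\<close>)
  have a: "ival s' (ENT (R 5) (R rx) (R ry) (INum 0)) = b + ent x y 0" if "idx_eq scratch s1 s'" for s'
  proof -
    \<comment> \<open>Addresses depend on index cells alone. Exchanging the coefficient memory makes
      \<open>env\<close> available, which also speaks about a coefficient cell.\<close>
    have "ival s' (ENT (R 5) (R rx) (R ry) (INum 0)) =
        ival (s'\<lparr>cof := cof s1\<rparr>) (ENT (R 5) (R rx) (R ry) (INum 0))" by (simp add: ENT_def)
    also have "\<dots> = b + ent x y 0"
      by (subst ival_ENT[OF env']) (use that x y rx envD[OF env] in \<open>auto simp: idx_eq_def\<close>)
    finally show ?thesis .
  qed
  have w: "ival s' (IAdd child_base (R 9)) = b + W + WO" if "idx_eq scratch s1 s'" for s'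
    using that envD[OF env] by (simp add: idx_eq_def)
  have sep: "b + ent x y 0 + D \<le> b + W + WO"
    using ent_less[OF x(2) y(2), of 0] D_pos by (simp add: W_def)
  show ?thesis
  proof (rule runs_mono[OF runs_reduced[OF runs_mult_weight[OF env a w sep] red]], goal_cases)
    case (5 s')
    then have new: "\<And>z. cof s' z = (if b + W + WO \<le> z \<and> z < b + W + WO + D
      then conv m (\<lambda>t. cof s1 (b + ent x y 0 + t)) (\<lambda>t. cof s1 (b + W + WO + t)) (z - (b + W + WO)) else cof s1 z)"
      by blast
    have row: "cof s1 (b + ent x y 0 + t) = A x y t" if "t < D" for t
      using fr x y that by (simp add: frame_def ent_def add.assoc)
    have "frame s' (b + W) A' (conv m (A x y) u')"
      unfolding frame_def
    proof (intro conjI allI impI)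
      fix x y t assume xyt: "x < 2 * n" "y < 2 * n" "t < D"
      from ent_less[OF this] fr' xyt show "cof s' (b + W + ent x y t) = A' x y t"
        by (simp add: frame_def new)
    next
      fix t assume t: "t < D"
      have "(\<Sum>l\<le>t. cof s1 (b + ent x y 0 + l) * cof s1 (b + W + WO + (t - l)))
          = (\<Sum>l\<le>t. A x y l * u' (t - l))"
      proof (intro sum.cong refl)
        fix l assume "l \<in> {..t}"
        with t have "l < D" "t - l < D" by auto
        moreover from this(2) have "cof s1 (b + W + WO + (t - l)) = u' (t - l)"
          using fr' unfolding frame_def by blast
        ultimately show "cof s1 (b + ent x y 0 + l) * cof s1 (b + W + WO + (t - l)) = A x y l * u' (t - l)"
          by (simp only: row)
      qed
      with t show "cof s' (b + W + WO + t) = conv m (A x y) u' t"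
        by (simp add: new conv_def)
    qed
    moreover have "idx_eq scratch s1 s'" "reduced s'" using 5 by auto
    moreover have "cof s' a = cof s1 a" if "a < b + W" for a using that by (simp add: new)
    ultimately show ?case using child_frame_of_after[OF env fr, of s'] c
      by (auto simp: child_def intro: after_trans)
  qed (use T in \<open>auto simp: algebra_simps\<close>)
qed

lemma child_kill:
  assumes c: "child b sp j A u s A' u' s1" and x: "idx s1 rx = x" "x < 2 * n" and T: "40 \<le> T"
  shows "runs P m (kill_cell child_base (R rx)) s1 T (child b sp j A u s (kill x A') u')"
proof -
  from c have env: "env b sp j s1" and red: "reduced s1" and fr: "frame s1 b A u"
    and fr': "frame s1 (b + W) A' u'" by (auto simp: child_def)
  let ?a = "b + W + ent x x 0"
  have a: "ival s1 (ENT child_base (R rx) (R rx) (INum 0)) = ?a"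
    by (subst ival_ENT[OF env]) (use x envD[OF env] in auto)
  let ?s = "s1\<lparr>cof := (cof s1)(?a := 1)\<rparr>"
  have lt: "ent x x 0 < WO" using ent_less[OF x(2) x(2) D_pos] .
  have "entries ?s (b + W) (kill x A')"
    by (rule entries_mono[OF entries_update[of s1 "b + W" A' x x 0 1]])
      (use fr' x D_pos in \<open>auto simp: frame_iff kill_def\<close>)
  moreover have "cof ?s (b + W + WO + t) = u' t" if "t < D" for t
    using fr' that lt by (simp add: frame_iff)
  ultimately have fr'': "frame ?s (b + W) (kill x A') u'" by (simp add: frame_iff)
  have "reduced ?s" using red m_gt_1 by (simp add: reduced_def)
  with child_frame_of_after[OF env fr, of ?s] fr'' c have "child b sp j A u s (kill x A') u' ?s"
    by (auto simp: child_def intro: after_trans)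
  then show ?thesis unfolding kill_cell_def
    by (intro runs_SetC) (use a m_gt_1 T in simp_all)
qed

lemma child_reg:
  "child b sp j A u s A' u' s' \<Longrightarrow> a < 30 \<Longrightarrow> a \<notin> scratch \<Longrightarrow> idx s' a = idx s a"
  using envD(11)[of b sp j s'] by (auto simp: child_def after_def)

lemma child_recurse:
  assumes F: "solves P j T" and c: "child b sp (Suc j) A u s A' u' s1"
    and A: "symm A'" "zero_diag A'" "dvw j u'" and f: "pol D u' * haf A' \<approx> f"
  shows "runs P m recurse s1 (T + 40) (\<lambda>s'. after scratch (b + W) sp s s' \<and> reduced s' \<and>
      acc s' \<approx> acc s + f)"
proof (rule runs_mono[OF runs_recurse[OF F _ _ _ A, where s = s1 and b = b and sp = sp]], goal_cases)
  case (5 s')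
  then have "acc s' \<approx> acc s1 + pol D u' * haf A'" by simp
  also have "\<dots> \<approx> acc s + f" using c f by (intro pcong_add) (simp_all add: child_def)
  finally show ?case using 5 c by (auto simp: child_def intro: after_trans)
qed (use c in \<open>auto simp: child_def\<close>)

definition T_spawn :: "nat \<Rightarrow> nat" where
  "T_spawn T = T_copy + D * 200 + 2 * (D * (D * 300 + 300) + 20) + 500 + T"

lemma cval_current:
  assumes "env b sp j s" "frame s b A u" "idx s 10 = i" "idx s 11 = d" "idx s 12 = p"
    "i < 2 * n" "p < 2 * n" "d < D"
    and "idx_eq scratch s s'" "\<And>a. a < b + W \<Longrightarrow> cof s' a = cof s a"
  shows "cval m s' current = A i p d mod m"
proof -
  have "env b sp j s'" "frame s' b A u" using child_frame_of_after[OF assms(1,2,9,10)] by auto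
  moreover have "idx s' 10 = i" "idx s' 11 = d" "idx s' 12 = p" using assms by (auto simp: idx_eq_def)
  ultimately show ?thesis using assms envD(3)[of b sp j s']
    by (simp add: current_def ival_ENT[of b sp j s'] frame_def)
qed

lemma runs_spawn_entry:
  assumes F: "solves P j T" and env: "env b sp (Suc j) s" and red: "reduced s"
    and fr: "frame s b A u" and A: "symm A" "zero_diag A" "dvw (Suc j) u" and j: "Suc j \<le> k"
    and regs: "idx s 10 = i" "idx s 11 = d" "idx s 12 = p"
    and lt: "i < 2 * n" "p < 2 * n" "d < D" and even: "even (A i p d)"
  shows "runs P m spawn_entry s (T_spawn T) (\<lambda>s'. after scratch (b + W) sp s s' \<and> reduced s' \<and>
      acc s' \<approx> acc s + pol D u * (monom (A i p d) d * haf_on (al A - {i,p}) (mat_of A)))"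
  unfolding spawn_entry_def
proof (rule runs_Seq'[OF child_copy[OF env red fr], where ?T2.0 = "D * 200 + 20 + 150 + T"], goal_cases)
  case (1 s1)
  note rg = child_reg[OF 1]
  have r: "idx s1 10 = i" "idx s1 11 = d" "idx s1 12 = p" using rg regs by simp_all
  have e1: "env b sp (Suc j) s1" "frame s1 b A u" using 1 by (auto simp: child_def)
  have cs: "runs P m (scale_child current (R 11)) s1 (D * 200 + 20)
     (child b sp (Suc j) A u s A (shift_scale m (A i p d) d u))"
  proof (rule child_scale[OF 1])
    show "cval m s' current = A i p d mod m"
      if "idx_eq scratch s1 s'" "\<And>a. a < b + W \<Longrightarrow> cof s' a = cof s1 a" for s'
      by (rule cval_current[OF e1 r lt that])
  qed (use r in \<open>auto simp: idx_eq_def current_def\<close>)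
  show ?case
  proof (rule runs_Seq'[OF cs, where ?T2.0 = "150 + T"], goal_cases)
    case (1 s2)
    note rg2 = child_reg[OF 1]
    show ?case
    proof (rule runs_Seq'[OF child_kill[OF 1, of 12 p 40], where ?T2.0 = "90 + T"], goal_cases)
      case (4 s3)
      note rg3 = child_reg[OF 4]
      show ?case
      proof (rule runs_Seq'[OF child_kill[OF 4, of 10 i 40], where ?T2.0 = "T + 40"], goal_cases)
        case (4 s4)
        have "pol D (shift_scale m (A i p d) d u) * haf (kill i (kill p A))
          \<approx> (monom (A i p d) d * pol D u) * haf_on (al A - {i,p}) (mat_of A)"
          unfolding haf_kill2 by (intro pcong_mult pcong_refl pol_shift_scale)
        also have "\<dots> = pol D u * (monom (A i p d) d * haf_on (al A - {i,p}) (mat_of A))"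
          by (simp add: mult_ac)
        finally show ?case
          using A j even by (intro child_recurse[OF F 4] symm_kill zero_diag_kill dvw_shift_scale)
      qed (use rg3 regs lt in simp_all)
    qed (use rg2 regs lt in simp_all)
  qed simp
qed (simp add: T_spawn_def)

lemma runs_spawn_pair:
  assumes F: "solves P j T" and env: "env b sp (Suc j) s" and red: "reduced s"
    and fr: "frame s b A u" and A: "symm A" "zero_diag A" "dvw (Suc j) u" and j: "Suc j \<le> k"
    and regs: "idx s 10 = i" "idx s 11 = d" "idx s 12 = p" "idx s 13 = q" "idx s 14 = v"
      "idx s 15 = r" "idx s 16 = w"
    and lt: "i < 2 * n" "p < 2 * n" "d < D" "q < 2 * n" "r < 2 * n" "w < 2 * n"
  shows "runs P m spawn_pair s (T_spawn T) (\<lambda>s'. after scratch (b + W) sp s s' \<and> reduced s' \<and>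
      acc s' \<approx> acc s + pol D u * (2 * monom (A i p d) (d - v) *
        (mat_of A q r * mat_of A q w * haf_on (al A - {p,q,r,w}) (mat_of A))))"
  unfolding spawn_pair_def
proof (rule runs_Seq'[OF child_copy[OF env red fr], where ?T2.0 = "D * 200 + 20 + 2 * (D * (D * 300 + 300) + 20) + 250 + T"],
    goal_cases)
  case (1 s1)
  let ?M = "D * (D * 300 + 300) + 20"
  let ?u1 = "shift_scale m (2 * A i p d) (d - v) u"
  note rg = child_reg[OF 1]
  have r: "idx s1 10 = i" "idx s1 11 = d" "idx s1 12 = p" using rg regs by simp_all
  have e1: "env b sp (Suc j) s1" "frame s1 b A u" using 1 by (auto simp: child_def)
  have cs: "runs P m (scale_child (CAdd current current) (ISub (R 11) (R 14))) s1 (D * 200 + 20)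
     (child b sp (Suc j) A u s A ?u1)"
  proof (rule child_scale[OF 1])
    show "cval m s' (CAdd current current) = 2 * A i p d mod m"
      if "idx_eq scratch s1 s'" "\<And>a. a < b + W \<Longrightarrow> cof s' a = cof s1 a" for s'
      using cval_current[OF e1 r lt(1-3) that] by (simp add: mod_simps)
    show "ival s' (ISub (R 11) (R 14)) = d - v" if "idx_eq scratch s1 s'" for s'
      using that rg regs by (simp add: idx_eq_def)
  qed (auto simp: current_def)
  show ?case
  proof (rule runs_Seq'[OF cs, where ?T2.0 = "2 * ?M + 250 + T"], goal_cases)
    case (1 s2)
    note rg2 = child_reg[OF 1]
    show ?case
    proof (rule runs_Seq'[OF child_mult[OF 1, of 13 q 15 r ?M], where ?T2.0 = "?M + 250 + T"], goal_cases)
      case (8 s3)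
      note rg3 = child_reg[OF 8]
      show ?case
      proof (rule runs_Seq'[OF child_mult[OF 8, of 13 q 16 w ?M], where ?T2.0 = "250 + T"], goal_cases)
        case (8 s4)
        note rg4 = child_reg[OF 8]
        show ?case
        proof (rule runs_Seq'[OF child_kill[OF 8, of 16 w 40], where ?T2.0 = "200 + T"], goal_cases)
          case (4 s5)
          note rg5 = child_reg[OF 4]
          show ?case
          proof (rule runs_Seq'[OF child_kill[OF 4, of 15 r 40], where ?T2.0 = "150 + T"], goal_cases)
            case (4 s6)
            note rg6 = child_reg[OF 4]
            show ?case
            proof (rule runs_Seq'[OF child_kill[OF 4, of 13 q 40], where ?T2.0 = "100 + T"], goal_cases)
              case (4 s7)
              note rg7 = child_reg[OF 4]
              show ?case
              proof (rule runs_Seq'[OF child_kill[OF 4, of 12 p 40], where ?T2.0 = "T + 40"], goal_cases)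
                case (4 s8)
                have "pol D (conv m (A q w) (conv m (A q r) ?u1))
                  \<approx> mat_of A q w * (mat_of A q r * (monom (2 * A i p d) (d - v) * pol D u))"
                  unfolding mat_of_def
                  by (intro pcong_trans[OF pol_conv] pcong_mult_left pol_shift_scale)
                then have "pol D (conv m (A q w) (conv m (A q r) ?u1)) * haf (kill p (kill q (kill r (kill w A))))
                  \<approx> (mat_of A q w * (mat_of A q r * (monom (2 * A i p d) (d - v) * pol D u))) *
                    haf_on (al A - {p,q,r,w}) (mat_of A)"
                  unfolding haf_kill4 by (rule pcong_mult[OF _ pcong_refl])
                also have "monom (2 * A i p d) (d - v) = 2 * monom (A i p d) (d - v)"
                  by (simp add: numeral_poly smult_monom)
                also have "(mat_of A q w * (mat_of A q r * (2 * monom (A i p d) (d - v) * pol D u))) *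
                    haf_on (al A - {p,q,r,w}) (mat_of A)
                  = pol D u * (2 * monom (A i p d) (d - v) *
                    (mat_of A q r * mat_of A q w * haf_on (al A - {p,q,r,w}) (mat_of A)))"
                  by (simp only: mult_ac)
                \<comment> \<open>The evenness required by \<open>dvw_shift_scale\<close> is that of
                  \<open>2 * A i p d\<close>; the two convolutions preserve the divisibility
                  gained.\<close>
                finally show ?case using A j
                  by (intro child_recurse[OF F 4] symm_kill zero_diag_kill dvw_shift_scale dvw_conv) simp_all
              qed (use rg7 regs lt in simp_all)
            qed (use rg6 regs lt in simp_all)
          qed (use rg5 regs lt in simp_all)
        qed (use rg4 regs lt in simp_all)
      qed (use rg3 regs lt in simp_all)
    qed (use rg2 regs lt in simp_all)
  qed simp
qed (simp add: T_spawn_def)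

end

section \<open>Elimination\<close>

definition clear_current :: com where
  "clear_current = Seq (SetC (ENT (R 5) (R 10) (R 12) (R 11)) (CNum 0))
    (SetC (ENT (R 5) (R 12) (R 10) (R 11)) (CNum 0))"

definition spawn_pairs :: com where
  "spawn_pairs = For 15 (R 3) (For 16 (R 15)
    (Cond (BConj (BConj (alive (R 15)) (BConj (INeq (R 15) (R 12)) (INeq (R 15) (R 13))))
        (BConj (alive (R 16)) (BConj (INeq (R 16) (R 12)) (INeq (R 16) (R 13)))))
      spawn_pair Skip))"

text \<open>Coefficients can be compared only with zero modulo \<open>2 ^ k\<close>. Multiplication
  by \<open>2 ^ (k - 1)\<close> moves the lowest bit to the top, so the product vanishes exactly for
  even coefficients.\<close>

definition current_odd :: bexp where
  "current_odd = BNeg (CZero (CMul (CCell (R 4)) current))"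

text \<open>Corrections are spawned before the matrix is touched, as they are minors of the
  unmodified matrix. With a pivot the row operation is performed whatever the parity; without one
  the coefficient is even in this branch. Either way \<open>spawn_entry\<close> receives an even
  coefficient.\<close>

definition elimination_step :: com where
  "elimination_step = Cond (BConj (alive (R 12)) (BConj (INeq (R 12) (R 10)) (INeq (R 12) (R 13))))
    (Cond (BConj (BNeg (INeq (R 13) (R 10))) current_odd)
      (Seq (SetI (INum 13) (R 12)) (SetI (INum 14) (R 11)))
      (Seq (Cond (INeq (R 13) (R 10)) (Seq spawn_pairs sub_row) Skip) (Seq spawn_entry clear_current)))
    Skip"

context hafnian_run
begin

lemma bval_alive:
  assumes "env b sp j s" "frame s b A u" "idx s rx = x" "x < 2 * n"
  shows "bval m s (alive (R rx)) \<longleftrightarrow> x \<in> al A"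
  using assms envD(3)[OF assms(1)] D_pos
  by (simp add: alive_def ival_ENT[OF assms(1)] frame_def al_def mod_eq_0_iff_dvd)

lemma bcost_alive: "bcost (alive (R rx)) = 19"
  by (simp add: alive_def)

text \<open>\<open>X\<close> is the conserved value: what has been accumulated plus what the current
  frame is still worth. \<open>s0\<close> is the reference state against which side effects are
  measured.\<close>

definition state_inv :: "memory \<Rightarrow> nat \<Rightarrow> nat \<Rightarrow> nat \<Rightarrow> int poly \<Rightarrow> (nat \<Rightarrow> nat \<Rightarrow> nat \<Rightarrow> int) \<Rightarrow> (nat \<Rightarrow> int) \<Rightarrow> memory \<Rightarrow> bool"
  where "state_inv s0 b sp j X A u s \<longleftrightarrow> env b sp (Suc j) s \<and> reduced s \<and> frame s b A u \<and> symm A \<and>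
    zero_diag A \<and> dvw (Suc j) u \<and> after {10..<20} b sp s0 s \<and> acc s + pol D u * haf A \<approx> X"

lemma state_invD:
  assumes "state_inv s0 b sp j X A u s"
  shows "env b sp (Suc j) s" "reduced s" "frame s b A u" "symm A" "zero_diag A" "dvw (Suc j) u"
    "after {10..<20} b sp s0 s" "acc s + pol D u * haf A \<approx> X"
  using assms by (simp_all add: state_inv_def)

lemma state_inv_update:
  assumes inv: "state_inv s0 b sp j X A u s" and af: "after Y b sp s s'" "Y \<subseteq> {10..<20}"
    and "reduced s'" "frame s' b A' u'" "symm A'" "zero_diag A'" "dvw (Suc j) u'"
    and val: "acc s' + pol D u' * haf A' \<approx> acc s + pol D u * haf A"
  shows "state_inv s0 b sp j X A' u' s'"
proof -
  have "after {10..<20} b sp s s'" by (rule after_mono[OF af]) simp_all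
  then have "after {10..<20} b sp s0 s'" using state_invD(7)[OF inv] by (blast intro: after_trans)
  then show ?thesis
    using assms after_env[OF state_invD(1)[OF inv] af order_refl] pcong_trans[OF val state_invD(8)[OF inv]]
    by (simp add: state_inv_def)
qed

lemma state_inv_set_idx:
  assumes "state_inv s0 b sp j X A u s" "a \<in> {10..<20}"
  shows "state_inv s0 b sp j X A u (s\<lparr>idx := (idx s)(a := v)\<rparr>)"
  by (rule state_inv_update[OF assms(1), of "{a}"])
    (use assms state_invD[OF assms(1)] in \<open>auto simp: after_def reduced_def frame_def acc_def\<close>)

lemma after_outside:
  "idx_eq X s s' \<Longrightarrow> outside b l s s' \<Longrightarrow> after X b sp s s'"
  by (auto simp: after_def idx_eq_def outside_def)

lemma acc_outside: "env b sp j s \<Longrightarrow> outside b l s s' \<Longrightarrow> acc s' = acc s"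
  using envD(10)[of b sp j s] D_add_2_le_WO by (intro acc_cong) (auto simp: outside_def)

lemma runs_clear_current:
  assumes env: "env b sp j s" and fr: "frame s b A u" and regs: "idx s 10 = i" "idx s 11 = d" "idx s 12 = p"
    and lt: "i < 2 * n" "d < D" "p < 2 * n"
  shows "runs P m clear_current s 60 (\<lambda>s'. idx_eq scratch s s' \<and> outside b WO s s' \<and> frame s' b (clear i p d A) u)"
proof -
  let ?s1 = "s\<lparr>cof := (cof s)(b + ent i p d := 0)\<rparr>"
  let ?s2 = "?s1\<lparr>cof := (cof ?s1)(b + ent p i d := 0)\<rparr>"
  have Wb: "D < b" using envD(10)[OF env] D_add_2_le_WO by simp
  have lt': "ent i p d < WO" "ent p i d < WO" using lt by (auto intro!: ent_less)
  have env1: "env b sp j ?s1" by (rule env_idx_eq[OF env]) (use Wb in \<open>auto simp: idx_eq_def\<close>)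
  have a1: "ival s (ENT (R 5) (R 10) (R 12) (R 11)) = b + ent i p d"
    by (subst ival_ENT[OF env]) (use lt regs envD[OF env] in simp_all)
  have a2: "ival ?s1 (ENT (R 5) (R 12) (R 10) (R 11)) = b + ent p i d"
    by (subst ival_ENT[OF env1]) (use lt regs envD[OF env] in simp_all)
  have E: "entries ?s2 b (clear i p d A)"
    by (rule entries_mono[OF entries_update[OF entries_update[of s b A]]])
      (use fr lt in \<open>auto simp: frame_iff clear_def\<close>)
  have out: "outside b WO s ?s2" using lt' by (intro outside_update) (auto simp: outside_def)
  have "frame ?s2 b (clear i p d A) u" using E fr lt' by (auto simp: frame_iff)
  with out show ?thesis unfolding clear_current_def
    by - (rule runs_Seq[where ?T1.0 = 30 and ?T2.0 = 30], rule runs_SetC, rule runs_SetC,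
      unfold a1 cval.simps mod_0 a2, simp_all add: idx_eq_def)
qed

lemma runs_kill_cell:
  assumes env: "env b sp j s" and fr: "frame s b A u" and x: "idx s rx = x" "x < 2 * n"
  shows "runs P m (kill_cell (R 5) (R rx)) s 40 (\<lambda>s'. idx_eq scratch s s' \<and> outside b WO s s' \<and> frame s' b (kill x A) u)"
proof -
  let ?s = "s\<lparr>cof := (cof s)(b + ent x x 0 := 1)\<rparr>"
  have a: "ival s (ENT (R 5) (R rx) (R rx) (INum 0)) = b + ent x x 0"
    by (subst ival_ENT[OF env]) (use x envD[OF env] in auto)
  have lt: "ent x x 0 < WO" using ent_less[OF x(2) x(2) D_pos] .
  have "entries ?s b (kill x A)"
    by (rule entries_mono[OF entries_update[of s b A x x 0 1]])
      (use fr x D_pos in \<open>auto simp: frame_iff kill_def\<close>)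
  moreover have "cof ?s (b + WO + t) = u t" if "t < D" for t
    using fr that lt by (simp add: frame_iff)
  ultimately have "frame ?s b (kill x A) u" by (simp add: frame_iff)
  moreover have "outside b WO s ?s" using lt by (auto simp: outside_def)
  ultimately show ?thesis unfolding kill_cell_def
    by (intro runs_SetC) (use a m_gt_1 in \<open>simp_all add: idx_eq_def\<close>)
qed

lemma runs_mult_own:
  assumes env: "env b sp j s" and fr: "frame s b A u" and regs: "idx s 10 = i" "idx s 13 = q"
    and lt: "i < 2 * n" "q < 2 * n"
  shows "runs P m (mult_weight (IAdd (R 5) (R 9)) (ENT (R 5) (R 10) (R 13) (INum 0))) s
    (D * (D * 300 + 300) + 20) (\<lambda>s'. idx_eq scratch s s' \<and> outside b W s s' \<and> frame s' b A (conv m (A i q) u))"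
proof -
  have a: "ival s' (ENT (R 5) (R 10) (R 13) (INum 0)) = b + ent i q 0" if "idx_eq scratch s s'" for s'
  proof -
    have "env b sp j (s'\<lparr>cof := cof s\<rparr>)"
      by (rule env_idx_eq[OF env]) (use that in \<open>auto simp: idx_eq_def\<close>)
    then have "ival (s'\<lparr>cof := cof s\<rparr>) (ENT (R 5) (R 10) (R 13) (INum 0)) = b + ent i q 0"
      by (subst ival_ENT) (use that regs lt envD[OF env] in \<open>auto simp: idx_eq_def\<close>)
    then show ?thesis by (simp add: ENT_def)
  qed
  have w: "ival s' (IAdd (R 5) (R 9)) = b + WO" if "idx_eq scratch s s'" for s'
    using that envD[OF env] by (simp add: idx_eq_def)
  have sep: "b + ent i q 0 + D \<le> b + WO"
    using ent_less[OF lt, of "D - 1"] D_pos by (simp add: ent_def)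
  show ?thesis
  proof (rule runs_mono[OF runs_mult_weight[OF env a w sep]], goal_cases)
    case (5 s')
    then have new: "\<And>z. cof s' z = (if b + WO \<le> z \<and> z < b + WO + D
      then conv m (\<lambda>t. cof s (b + ent i q 0 + t)) (\<lambda>t. cof s (b + WO + t)) (z - (b + WO)) else cof s z)"
      by blast
    have row: "cof s (b + ent i q 0 + t) = A i q t" if "t < D" for t
      using fr lt that by (simp add: frame_def ent_def add.assoc)
    have "frame s' b A (conv m (A i q) u)"
      unfolding frame_def
    proof (intro conjI allI impI)
      fix x y t assume xyt: "x < 2 * n" "y < 2 * n" "t < D"
      from ent_less[OF this] fr xyt show "cof s' (b + ent x y t) = A x y t"
        by (simp add: frame_def new)
    next
      fix t assume t: "t < D"
      have "(\<Sum>l\<le>t. cof s (b + ent i q 0 + l) * cof s (b + WO + (t - l)))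
          = (\<Sum>l\<le>t. A i q l * u (t - l))"
      proof (intro sum.cong refl)
        fix l assume "l \<in> {..t}"
        with t have "l < D" "t - l < D" by auto
        moreover from this(2) have "cof s (b + WO + (t - l)) = u (t - l)"
          using fr unfolding frame_def by blast
        ultimately show "cof s (b + ent i q 0 + l) * cof s (b + WO + (t - l)) = A i q l * u (t - l)"
          by (simp only: row)
      qed
      with t show "cof s' (b + WO + t) = conv m (A i q) u t" by (simp add: new conv_def)
    qed
    moreover have "outside b W s s'" by (auto simp: outside_def new W_def)
    ultimately show ?case using 5 by blast
  qed (auto simp: algebra_simps)
qed

definition T_pairs :: "nat \<Rightarrow> nat" where
  "T_pairs T = 2 * n * (2 * n * (T_spawn T + 300) + 300) + 300"

lemma sum_lessThan_Suc_filter: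
  fixes f :: "nat \<Rightarrow> 'a::comm_monoid_add"
  assumes "finite S"
  shows "sum f {x\<in>S. x < Suc r} = sum f {x\<in>S. x < r} + (if r \<in> S then f r else 0)"
proof (cases "r \<in> S")
  case True
  then have "{x\<in>S. x < Suc r} = insert r {x\<in>S. x < r}" by auto
  with assms True show ?thesis by (simp add: add.commute)
next
  case False
  then have "{x\<in>S. x < Suc r} = {x\<in>S. x < r}" by (auto simp: less_Suc_eq)
  with False show ?thesis by simp
qed

lemma runs_spawn_pairs:
  assumes F: "solves P j T" and env: "env b sp (Suc j) s" and red: "reduced s"
    and fr: "frame s b A u" and A: "symm A" "zero_diag A" "dvw (Suc j) u" and j: "Suc j \<le> k"
    and regs: "idx s 10 = i" "idx s 11 = d" "idx s 12 = p" "idx s 13 = q" "idx s 14 = v"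
    and lt: "i < 2 * n" "p < 2 * n" "d < D" "q < 2 * n"
  shows "runs P m spawn_pairs s (T_pairs T) (\<lambda>s'. after {15..<20} (b + W) sp s s' \<and> reduced s' \<and>
      acc s' \<approx> acc s + pol D u * (2 * monom (A i p d) (d - v) *
        (\<Sum>r\<in>al A - {p,q}. \<Sum>w\<in>{w\<in>al A - {p,q}. w < r}.
          mat_of A q r * mat_of A q w * haf_on (al A - {p,q,r,w}) (mat_of A))))"
proof -
  define S where "S = al A - {p,q}"
  define G where "G = (\<lambda>r w. mat_of A q r * mat_of A q w * haf_on (al A - {p,q,r,w}) (mat_of A))"
  define K where "K = 2 * monom (A i p d) (d - v)"
  have finS: "finite S" by (simp add: S_def)
  have sp: "30 + 4 * n \<le> sp" using envD(11)[OF env] .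
  define Done where "Done = (\<lambda>f s'. after {15..<20} (b + W) sp s s' \<and> reduced s' \<and>
    acc s' \<approx> acc s + pol D u * (K * f))"
  have Done_idx: "Done f (s'\<lparr>idx := (idx s')(a := z)\<rparr>)" if "Done f s'" "a \<in> {15..<20}" for f s' a z
    using that by (auto simp: Done_def after_def reduced_def acc_def)
  have Done_regs: "idx s' 3 = 2 * n" "idx s' 10 = i" "idx s' 11 = d" "idx s' 12 = p" "idx s' 13 = q"
    "idx s' 14 = v" "env b sp (Suc j) s'" "frame s' b A u" "reduced s'" if "Done f s'" for f s'
  proof -
    from that have af: "after {15..<20} (b + W) sp s s'" by (simp add: Done_def)
    show "env b sp (Suc j) s'" "frame s' b A u"
      using after_env[OF env af] after_frame[OF af order_refl envD(10)[OF env]] fr by auto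
    then show "idx s' 3 = 2 * n" by (simp add: env_def)
    show "idx s' 10 = i" "idx s' 11 = d" "idx s' 12 = p" "idx s' 13 = q" "idx s' 14 = v"
      using af regs sp by (auto simp: after_def)
  qed (use that in \<open>simp add: Done_def\<close>)
  let ?body = "Cond (BConj (BConj (alive (R 15)) (BConj (INeq (R 15) (R 12)) (INeq (R 15) (R 13))))
        (BConj (alive (R 16)) (BConj (INeq (R 16) (R 12)) (INeq (R 16) (R 13)))))
      spawn_pair Skip"
  \<comment> \<open>\<open>?outer r\<close> collects the pairs whose larger index is below
    \<open>r\<close>; \<open>?inner r w\<close> adds those with larger index \<open>r\<close> and
    smaller index below \<open>w\<close>.\<close>
  let ?outer = "\<lambda>r. \<Sum>r'\<in>{x\<in>S. x < r}. \<Sum>w\<in>{x\<in>S. x < r'}. G r' w"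
  let ?inner = "\<lambda>r w. ?outer r + (if r \<in> S then \<Sum>w'\<in>{x\<in>S. x < w}. G r w' else 0)"
  have inner: "runs P m (For 16 (R 15) ?body) s' (2 * n * (T_spawn T + 300) + 100)
      (\<lambda>s''. Done (?outer (Suc r)) s'' \<and> idx s'' 15 = r)"
    if s': "Done (?outer r) s'" "idx s' 15 = r" "r < 2 * n" for r s'
  proof (rule runs_For[where bnd = r and B = "T_spawn T + 200" and
      I = "\<lambda>w s''. Done (?inner r w) s'' \<and> idx s'' 15 = r \<and> idx s'' 16 = w"], goal_cases)
    case 1
    then show ?case using Done_idx[OF s'(1), of 16 0] s' by simp
  next
    case (3 w s'')
    then have D: "Done (?inner r w) s''" and r: "idx s'' 15 = r" "idx s'' 16 = w" "w < 2 * n"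
      using s'(3) by auto
    note rg = Done_regs[OF D]
    have cond: "bval m s'' (BConj (BConj (alive (R 15)) (BConj (INeq (R 15) (R 12)) (INeq (R 15) (R 13))))
        (BConj (alive (R 16)) (BConj (INeq (R 16) (R 12)) (INeq (R 16) (R 13))))) \<longleftrightarrow> r \<in> S \<and> w \<in> S"
      unfolding bval.simps(4) bval_INeq bval_alive[OF rg(7,8) r(1) s'(3)] bval_alive[OF rg(7,8) r(2,3)]
      using rg r by (auto simp: S_def)
    have upd: "Done (?inner r (Suc w)) (s3\<lparr>idx := (idx s3)(16 := Suc (idx s3 16))\<rparr>)"
      if "Done (?inner r (Suc w)) s3" for s3
      using Done_idx[OF that] by simp
    have step: "?inner r (Suc w) = ?inner r w + (if r \<in> S \<and> w \<in> S then G r w else 0)"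
      by (simp add: sum_lessThan_Suc_filter[OF finS] algebra_simps)
    show ?case
    proof (rule runs_Cond[where ?T1.0 = "T_spawn T + 1"], goal_cases)
      case 1
      then have rw: "r \<in> S" "w \<in> S" using cond by auto
      show ?case
      proof (rule runs_mono[OF runs_spawn_pair[OF F rg(7,9,8) A j rg(2-6) r(1,2) lt(1-4) s'(3) r(3)]], goal_cases)
        case (2 s3)
        then have af: "after scratch (b + W) sp s'' s3" and ac: "acc s3 \<approx> acc s'' + pol D u * (K * G r w)"
          by (simp_all add: K_def G_def)
        have "after {15..<20} (b + W) sp s'' s3" by (rule after_mono[OF af]) auto
        then have af': "after {15..<20} (b + W) sp s s3" using D by (auto simp: Done_def intro: after_trans)
        note ac
        also have "acc s'' + pol D u * (K * G r w) \<approx> (acc s + pol D u * (K * ?inner r w)) + pol D u * (K * G r w)"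
          using D by (intro pcong_add) (simp_all add: Done_def)
        also have "\<dots> = acc s + pol D u * (K * ?inner r (Suc w))"
          unfolding step using rw by (simp add: algebra_simps)
        finally have "Done (?inner r (Suc w)) s3" using af' 2 by (simp add: Done_def)
        from upd[OF this] af r sp show ?case by (auto simp: after_def)
      qed simp
    next
      case 2
      then have "Done (?inner r (Suc w)) s''" unfolding step using cond D by auto
      from upd[OF this] r show ?case by (intro runs_Skip) auto
    qed (simp add: bcost_alive)
  next
    case (4 s'')
    then show ?case by (simp add: sum_lessThan_Suc_filter[OF finS])
  next
    case 5
    have "r * (T_spawn T + 300) \<le> 2 * n * (T_spawn T + 300)" using s'(3) by (intro mult_right_mono) auto
    then show ?case by (simp add: algebra_simps)
  qed simp_all
  have "runs P m spawn_pairs s (T_pairs T) (Done (?outer (2 * n)))"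
    unfolding spawn_pairs_def
  proof (rule runs_For[where bnd = "2 * n" and B = "2 * n * (T_spawn T + 300) + 100" and
      I = "\<lambda>r s'. Done (?outer r) s' \<and> idx s' 15 = r"], goal_cases)
    case 1
    have "Done (?outer 0) s" using red by (simp add: Done_def)
    from Done_idx[OF this, of 15 0] show ?case by simp
  next
    case (2 r s')
    then show ?case using Done_regs(1)[of _ s'] by auto
  next
    case (3 r s')
    then have "Done (?outer r) s'" "idx s' 15 = r" by auto
    from inner[OF this 3(1)] show ?case
      by (rule runs_mono) (use Done_idx in auto)
  qed (auto simp: T_pairs_def algebra_simps)
  moreover have "{x\<in>S. x < 2 * n} = S" by (auto simp: S_def al_def)
  ultimately show ?thesis unfolding Done_def K_def G_def S_def by simp
qed

end

section \<open>Processing a row, and the recursive procedure\<close>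

text \<open>The pivot register starts with the row index itself as a sign that there is no pivot. If
  it stays so, the multiplication by the diagonal entry annihilates the weight modulo
  \<open>m\<close>, and both removals concern the same index.\<close>

definition process_row :: com where
  "process_row = Cond (alive (R 10))
    (Seq (SetI (INum 13) (R 10))
    (Seq (For 11 (R 4) (For 12 (R 3) elimination_step))
    (Seq (mult_weight (IAdd (R 5) (R 9)) (ENT (R 5) (R 10) (R 13) (INum 0)))
    (Seq (kill_cell (R 5) (R 13)) (kill_cell (R 5) (R 10))))))
    Skip"

definition save_cell :: "nat \<Rightarrow> com" where
  "save_cell x = SetI (IAdd (R 7) (INum (x - 10))) (R x)"

definition restore_cell :: "nat \<Rightarrow> com" where
  "restore_cell x = SetI (INum x) (ICell (IAdd (R 7) (INum (x - 10))))"

primrec sequence :: "com list \<Rightarrow> com \<Rightarrow> com" where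
  "sequence [] c = c"
| "sequence (d # ds) c = Seq d (sequence ds c)"

lemma runs_sequence:
  assumes "I 0 s" "\<And>i s'. i < length ds \<Longrightarrow> I i s' \<Longrightarrow> runs P m (ds ! i) s' B (I (Suc i))"
    and "\<And>s'. I (length ds) s' \<Longrightarrow> runs P m c s' T2 Q" "length ds * B + T2 \<le> T"
  shows "runs P m (sequence ds c) s T Q"
  using assms
proof (induction ds arbitrary: I s T)
  case Nil
  then show ?case by (auto intro: runs_mono)
next
  case (Cons d ds)
  have "runs P m d s B (I (Suc 0))" using Cons.prems(2)[of 0 s] Cons.prems(1) by simp
  then show ?case unfolding sequence.simps
  proof (rule runs_Seq'[where ?T2.0 = "length ds * B + T2"])
    fix s' assume "I (Suc 0) s'"
    moreover have "runs P m (ds ! i) s'' B (I (Suc (Suc i)))" if "i < length ds" "I (Suc i) s''" for i s''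
      using Cons.prems(2)[of "Suc i" s''] that by simp
    ultimately show "runs P m (sequence ds c) s' (length ds * B + T2) Q"
      using Cons.prems(3) by (intro Cons.IH[of "\<lambda>i. I (Suc i)"]) auto
  qed (use Cons.prems(4) in simp)
qed

text \<open>Cells 17 to 19 are excluded: their loops are finished whenever a call takes
  place.\<close>

definition save_registers :: com where
  "save_registers = sequence (map save_cell [10..<17]) (SetI (INum 7) (IAdd (R 7) (INum 7)))"

definition restore_registers :: com where
  "restore_registers = Seq (SetI (INum 7) (ISub (R 7) (INum 7)))
    (sequence (map restore_cell [10..<17]) Skip)"

definition solver :: com where
  "solver = Cond (ILess (INum 0) (R 8))
    (Seq save_registers (Seq (For 10 (R 3) process_row) (Seq add_weight restore_registers)))
    Skip"

context hafnian_run
begin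

text \<open>Coefficients are visited by degree and, within a degree, by column; everything visited
  outside columns \<open>i\<close> and \<open>q\<close> is exactly zero. In this order the first odd
  coefficient found has lowest degree, and its column has already been cleared in all lower
  degrees.\<close>

definition pivot_inv :: "nat set \<Rightarrow> nat \<Rightarrow> nat \<Rightarrow> nat \<Rightarrow> (nat \<Rightarrow> nat \<Rightarrow> nat \<Rightarrow> int) \<Rightarrow> nat \<Rightarrow> nat \<Rightarrow> bool" where
  "pivot_inv V i d p A q v \<longleftrightarrow> al A = V \<and> q \<in> V \<and>
    (\<forall>p'\<in>V. \<forall>t<D. p' \<noteq> i \<longrightarrow> p' \<noteq> q \<longrightarrow> (t < d \<or> t = d \<and> p' < p) \<longrightarrow> A i p' t = 0) \<and>
    (q \<noteq> i \<longrightarrow> v \<le> d \<and> odd (A i q v) \<and> (\<forall>t<v. A i q t = 0))"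

definition row_inv :: "memory \<Rightarrow> nat \<Rightarrow> nat \<Rightarrow> nat \<Rightarrow> int poly \<Rightarrow> (nat \<Rightarrow> int) \<Rightarrow> nat set \<Rightarrow> nat \<Rightarrow> nat \<Rightarrow> nat \<Rightarrow> memory \<Rightarrow> bool"
  where "row_inv s0 b sp j X u V i d p s \<longleftrightarrow> (\<exists>A q v. state_inv s0 b sp j X A u s \<and> pivot_inv V i d p A q v \<and>
    idx s 10 = i \<and> idx s 13 = q \<and> idx s 14 = v)"

lemma row_inv_set_idx:
  assumes "row_inv s0 b sp j X u V i d p s" "a \<in> {11, 12}"
  shows "row_inv s0 b sp j X u V i d p (s\<lparr>idx := (idx s)(a := z)\<rparr>)"
proof -
  from assms(1) obtain A q v where A: "state_inv s0 b sp j X A u s" "pivot_inv V i d p A q v"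
    "idx s 10 = i" "idx s 13 = q" "idx s 14 = v" unfolding row_inv_def by blast
  have "state_inv s0 b sp j X A u (s\<lparr>idx := (idx s)(a := z)\<rparr>)"
    using assms(2) by (intro state_inv_set_idx[OF A(1)]) auto
  with A assms(2) show ?thesis unfolding row_inv_def
    by (intro exI[of _ A] exI[of _ q] exI[of _ v]) auto
qed

definition T_step :: "nat \<Rightarrow> nat" where
  "T_step T = T_pairs T + T_row + T_spawn T + 500"

lemma even_m: "even m"
  using k_pos by (simp add: m_def)

lemma even_mod_m: "even (a mod m) \<longleftrightarrow> even a"
  using even_m by (metis dvd_mod_iff)

lemma current_odd_iff:
  assumes "env b sp j s" "frame s b A u" "idx s 10 = i" "idx s 11 = d" "idx s 12 = p"
    "i < 2 * n" "p < 2 * n" "d < D"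
  shows "bval m s current_odd \<longleftrightarrow> odd (A i p d)"
proof -
  have m: "m = 2 * 2 ^ (k - 1)" unfolding m_def using k_pos by (simp add: power_eq_if)
  have "cval m s current = A i p d mod m"
    by (rule cval_current[OF assms]) simp_all
  then have "bval m s current_odd \<longleftrightarrow> \<not> m dvd 2 ^ (k - 1) * A i p d"
    using envD[OF assms(1)] by (simp add: current_odd_def mod_simps dvd_eq_mod_eq_0)
  also have "m dvd 2 ^ (k - 1) * A i p d \<longleftrightarrow> even (A i p d)"
    unfolding m by (simp add: mult.commute)
  finally show ?thesis .
qed

text \<open>When a pivot is available, the entry is made even: subtracting \<open>c x\<^sup>e\<close> times the pivot row
  replaces the coefficient \<open>c\<close> by \<open>c (1 - a)\<close> with \<open>a\<close> odd.\<close>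

lemma pivot_inv_row_op:
  assumes P: "pivot_inv V i d p A q v" and sym: "symm A" and p: "p \<in> V" "p \<noteq> i" "p \<noteq> q"
    and q: "q \<noteq> i" and i: "i \<in> V" and d: "d < D"
  shows "pivot_inv V i d p (row_op m p q (A i p d) (d - v) A) q v"
    "even (row_op m p q (A i p d) (d - v) A i p d)"
proof -
  let ?B = "row_op m p q (A i p d) (d - v) A"
  have al: "al A = V" "q \<in> V" using P by (auto simp: pivot_inv_def)
  have piv: "v \<le> d" "odd (A i q v)" "\<And>t. t < v \<Longrightarrow> A i q t = 0"
    using P q by (auto simp: pivot_inv_def)
  have sy: "A x i t = A i x t" if "x \<in> V" "t < D" for x t
    using that i sym al by (auto simp: symm_def al_def)
  have row: "?B i p t = (if d - v \<le> t then (A i p t - A i p d * A i q (t - (d - v))) mod m else A i p t)"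
    if "t < D" for t
    using p q sy al(2) that by (auto simp: row_op_def)
  have other: "?B i y t = A i y t" if "y \<noteq> p" for y t
    using that p by (auto simp: row_op_def)
  \<comment> \<open>The multiple of the pivot row starts in degree \<open>(d - v) + v = d\<close>,
    so it does not disturb the degrees already cleared.\<close>
  have "?B i p t = 0" if "A i p t = 0" "t < d" for t
    using that row[of t] d piv(1) piv(3)[of "t - (d - v)"] by auto
  with P show "pivot_inv V i d p ?B q v"
    unfolding pivot_inv_def using other p by (auto simp: al) (metis other)+
  have "?B i p d = (A i p d * (1 - A i q v)) mod m"
    using row[OF d] piv by (simp add: algebra_simps)
  then show "even (?B i p d)" using piv by (simp add: even_mod_m)
qed

lemma pivot_inv_clear:
  assumes P: "pivot_inv V i d p A q v" and p: "p \<noteq> i" "p \<noteq> q"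
  shows "pivot_inv V i d (Suc p) (clear i p d A) q v"
  using assms unfolding pivot_inv_def by (auto simp: clear_def less_Suc_eq)

lemma runs_elimination_step:
  assumes F: "solves P j T" and j: "Suc j \<le> k"
    and I: "row_inv s0 b sp j X u V i d p s" and regs: "idx s 11 = d" "idx s 12 = p"
    and lt: "d < D" "p < 2 * n" and i: "i \<in> V"
  shows "runs P m elimination_step s (T_step T)
    (\<lambda>s'. row_inv s0 b sp j X u V i d (Suc p) s' \<and> idx s' 11 = d \<and> idx s' 12 = p)"
proof -
  from I obtain A q v where S: "state_inv s0 b sp j X A u s" and P: "pivot_inv V i d p A q v"
    and r: "idx s 10 = i" "idx s 13 = q" "idx s 14 = v"
    unfolding row_inv_def by blast
  note S' = state_invD[OF S]
  have al: "al A = V" "q \<in> V" using P by (auto simp: pivot_inv_def)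
  have lt': "i < 2 * n" "q < 2 * n" using i al al_less by blast+
  have sp: "30 + 4 * n \<le> sp" using envD(11)[OF S'(1)] .
  have cand: "bval m s (BConj (alive (R 12)) (BConj (INeq (R 12) (R 10)) (INeq (R 12) (R 13))))
      \<longleftrightarrow> p \<in> V \<and> p \<noteq> i \<and> p \<noteq> q"
    unfolding bval.simps(4) bval_INeq bval_alive[OF S'(1,3) regs(2) lt(2)] using regs r al by auto
  have odd: "bval m s current_odd \<longleftrightarrow> odd (A i p d)"
    by (rule current_odd_iff[OF S'(1,3) r(1) regs lt'(1) lt(2,1)])
  show ?thesis unfolding elimination_step_def
  proof (rule runs_Cond[where ?T1.0 = "T_pairs T + T_row + T_spawn T + 400"], goal_cases)
    case 1
    then have p: "p \<in> V" "p \<noteq> i" "p \<noteq> q" using cand by auto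
    show ?case
    proof (rule runs_Cond[where ?T1.0 = "T_pairs T + T_row + T_spawn T + 300"], goal_cases)
      case 1
      then have q: "q = i" and "odd (A i p d)" using odd r by (auto simp: bval_INeq)
      let ?s = "s\<lparr>idx := (idx s)(13 := p, 14 := d)\<rparr>"
      have "state_inv s0 b sp j X A u ?s"
        using state_inv_set_idx[OF state_inv_set_idx[OF S, of 13 p], of 14 d] by simp
      \<comment> \<open>That the new pivot has no coefficient below degree \<open>d\<close> is the
        clearing clause of the old invariant for column \<open>p\<close>.\<close>
      moreover have "pivot_inv V i d (Suc p) A p d"
        using P p q \<open>odd (A i p d)\<close> lt al by (auto simp: pivot_inv_def less_Suc_eq)
      ultimately have "row_inv s0 b sp j X u V i d (Suc p) ?s"
        unfolding row_inv_def using r by auto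
      then show ?case
        by (intro runs_Seq[where ?T1.0 = 5 and ?T2.0 = 5] runs_SetI) (use regs in simp_all)
    next
      case 2
      \<comment> \<open>If there is a pivot, the parity is unknown at this point and is enforced by
        the row operation.\<close>
      then have ev: "even (A i p d)" if "q = i" using odd r that by (auto simp: bval_INeq)
      have "runs P m (Cond (INeq (R 13) (R 10)) (Seq spawn_pairs sub_row) Skip) s (T_pairs T + T_row + 20)
        (\<lambda>s'. \<exists>A'. state_inv s0 b sp j X A' u s' \<and> pivot_inv V i d p A' q v \<and> even (A' i p d) \<and>
          after {15..<20} b sp s s')"
      proof (rule runs_Cond[where ?T1.0 = "T_pairs T + T_row"], goal_cases)
        case 1
        then have q: "q \<noteq> i" using r by (simp only: bval_INeq) simp
        let ?S = "2 * monom (A i p d) (d - v) *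
            (\<Sum>r\<in>al A - {p,q}. \<Sum>w\<in>{w\<in>al A - {p,q}. w < r}.
              mat_of A q r * mat_of A q w * haf_on (al A - {p,q,r,w}) (mat_of A))"
        let ?B = "row_op m p q (A i p d) (d - v) A"
        show ?case
        proof (rule runs_Seq'[OF runs_spawn_pairs[OF F S'(1-6) j r(1) regs r(2,3) lt'(1) lt(2,1) lt'(2)],
              where ?T2.0 = T_row], goal_cases)
          case (1 s1)
          then have af: "after {15..<20} (b + W) sp s s1" and red: "reduced s1"
            and ac: "acc s1 \<approx> acc s + pol D u * ?S" by auto
          have env1: "env b sp (Suc j) s1" by (rule after_env[OF S'(1) af]) simp_all
          have fr1: "frame s1 b A u"
            using after_frame[OF af order_refl envD(10)[OF S'(1)]] S'(3) by simp
          have regs1: "idx s1 10 = i" "idx s1 11 = d" "idx s1 12 = p" "idx s1 13 = q" "idx s1 14 = v"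
            using af sp regs r by (auto simp: after_def)
          show ?case
          proof (rule runs_mono[OF runs_reduced[OF runs_sub_row[OF env1 fr1 regs1 lt'(1) lt lt'(2) p(3) S'(4)] red]], goal_cases)
            case (2 s2)
            then have eq: "idx_eq scratch s1 s2" and out: "outside b WO s1 s2" and fr2: "frame s2 b ?B u"
              and red2: "reduced s2" by auto
            have "after {15..<20} b sp s1 s2"
              by (rule after_mono[OF after_outside[OF eq out]]) auto
            then have af2: "after {15..<20} b sp s s2"
              using after_mono[OF af order_refl, of b sp] by (auto intro: after_trans)
            have haf: "haf A \<approx> haf ?B + ?S"
              by (rule haf_row_op) (use S' p al in auto)
            \<comment> \<open>What the row operation takes from the hafnian has just been added to
              the accumulator by the spawned pairs, so the conserved value is the same as
              before.\<close>
            have "acc s2 + pol D u * haf ?B \<approx> (acc s + pol D u * ?S) + pol D u * haf ?B"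
              unfolding acc_outside[OF env1 out] using ac by (intro pcong_add) simp_all
            also have "\<dots> = acc s + pol D u * (haf ?B + ?S)" by (simp add: algebra_simps)
            also have "\<dots> \<approx> acc s + pol D u * haf A"
              by (intro pcong_add pcong_mult_left pcong_refl pcong_sym[OF haf])
            finally have "state_inv s0 b sp j X ?B u s2"
              by (intro state_inv_update[OF S af2 _ red2 fr2] symm_row_op zero_diag_row_op) (use S' in auto)
            with pivot_inv_row_op[OF P S'(4) p q i lt(1)] af2 show ?case by blast
          qed simp
        qed simp
      next
        case 2
        then have q: "q = i" using r by (simp only: bval_INeq) simp
        show ?case by (rule runs_Skip) (use S P ev[OF q] in \<open>auto simp: T_row_def\<close>)
      qed simp
      then show ?case
      proof (rule runs_Seq'[where ?T2.0 = "T_spawn T + 100"], goal_cases)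
        case (1 s1)
        then obtain B where S1: "state_inv s0 b sp j X B u s1" and P1: "pivot_inv V i d p B q v"
          and even: "even (B i p d)" and af: "after {15..<20} b sp s s1" by blast
        note S1' = state_invD[OF S1]
        have al1: "al B = V" using P1 by (simp add: pivot_inv_def)
        have regs1: "idx s1 10 = i" "idx s1 11 = d" "idx s1 12 = p" "idx s1 13 = q" "idx s1 14 = v"
          using af sp regs r by (auto simp: after_def)
        show ?case
        proof (rule runs_Seq'[OF runs_spawn_entry[OF F S1'(1-6) j regs1(1-3) lt'(1) lt(2,1) even], where ?T2.0 = 60], goal_cases)
          case (1 s2)
          then have af2: "after scratch (b + W) sp s1 s2" and red2: "reduced s2"
            and ac2: "acc s2 \<approx> acc s1 + pol D u * (monom (B i p d) d * haf_on (al B - {i,p}) (mat_of B))" by auto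
          have env2: "env b sp (Suc j) s2" by (rule after_env[OF S1'(1) af2]) auto
          have fr2: "frame s2 b B u"
            using after_frame[OF af2 order_refl envD(10)[OF S1'(1)]] S1'(3) by simp
          have regs2: "idx s2 10 = i" "idx s2 11 = d" "idx s2 12 = p" "idx s2 13 = q" "idx s2 14 = v"
            using af2 sp regs1 by (auto simp: after_def)
          let ?C = "clear i p d B"
          show ?case
          proof (rule runs_mono[OF runs_reduced[OF runs_clear_current[OF env2 fr2 regs2(1-3) lt'(1) lt] red2]], goal_cases)
            case (2 s3)
            then have eq: "idx_eq scratch s2 s3" and out: "outside b WO s2 s3" and fr3: "frame s3 b ?C u"
              and red3: "reduced s3" by auto
            have af3: "after scratch b sp s1 s3"
              using after_mono[OF af2 order_refl, of b sp] after_outside[OF eq out, of sp]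
              by (auto intro: after_trans)
            have haf: "haf B = haf ?C + monom (B i p d) d * haf_on (al B - {i,p}) (mat_of B)"
              by (rule haf_clear) (use S1' i p al1 lt in auto)
            have "acc s3 + pol D u * haf ?C \<approx>
                (acc s1 + pol D u * (monom (B i p d) d * haf_on (al B - {i,p}) (mat_of B))) + pol D u * haf ?C"
              unfolding acc_outside[OF env2 out] using ac2 by (intro pcong_add) simp_all
            also have "\<dots> = acc s1 + pol D u * haf B" unfolding haf by (simp add: algebra_simps)
            finally have "state_inv s0 b sp j X ?C u s3"
              by (intro state_inv_update[OF S1 af3 _ red3 fr3] symm_clear zero_diag_clear) (use S1' p in auto)
            moreover have "pivot_inv V i d (Suc p) ?C q v" by (rule pivot_inv_clear[OF P1 p(2,3)])
            moreover have "idx s3 10 = i" "idx s3 11 = d" "idx s3 12 = p" "idx s3 13 = q" "idx s3 14 = v"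
              using eq regs2 by (auto simp: idx_eq_def)
            ultimately show ?case unfolding row_inv_def by blast
          qed simp
        qed simp
      qed simp
    qed (simp add: current_odd_def current_def)
  next
    case 2
    then have "\<not> (p \<in> V \<and> p \<noteq> i \<and> p \<noteq> q)" using cand by blast
    with P have "pivot_inv V i d (Suc p) A q v" unfolding pivot_inv_def by (auto simp: less_Suc_eq)
    then show ?case
      by (intro runs_Skip) (use S r regs in \<open>auto simp: row_inv_def\<close>)
  qed (simp add: T_step_def bcost_alive)
qed

definition T_rows :: "nat \<Rightarrow> nat" where
  "T_rows T = D * (2 * n * (T_step T + 100) + 100) + D * (D * 300 + 300) + 500"

definition outer_inv :: "memory \<Rightarrow> nat \<Rightarrow> nat \<Rightarrow> nat \<Rightarrow> int poly \<Rightarrow> nat \<Rightarrow> memory \<Rightarrow> bool" where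
  "outer_inv s0 b sp j X i s \<longleftrightarrow> (\<exists>A u. state_inv s0 b sp j X A u s \<and> al A \<inter> {..<i} = {})"

lemma runs_process_row:
  assumes F: "solves P j T" and j: "Suc j \<le> k"
    and I: "outer_inv s0 b sp j X i s" and regs: "idx s 10 = i" and lt: "i < 2 * n"
  shows "runs P m process_row s (T_rows T) (\<lambda>s'. outer_inv s0 b sp j X (Suc i) s' \<and> idx s' 10 = i)"
proof -
  from I obtain A u where S: "state_inv s0 b sp j X A u s" and V: "al A \<inter> {..<i} = {}"
    unfolding outer_inv_def by blast
  note S' = state_invD[OF S]
  define V where "V = al A"
  have alive: "bval m s (alive (R 10)) \<longleftrightarrow> i \<in> V"
    unfolding V_def by (rule bval_alive[OF S'(1,3) regs lt])
  show ?thesis unfolding process_row_def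
  proof (rule runs_Cond[where ?T1.0 = "T_rows T - 30"], goal_cases)
    case 1
    then have i: "i \<in> V" using alive by simp
    let ?s = "s\<lparr>idx := (idx s)(13 := i)\<rparr>"
    have "state_inv s0 b sp j X A u ?s" by (rule state_inv_set_idx[OF S]) simp
    then have init: "row_inv s0 b sp j X u V i 0 0 ?s"
      unfolding row_inv_def using i regs by (intro exI[of _ A] exI[of _ i] exI[of _ "idx s 14"])
        (auto simp: pivot_inv_def V_def)
    have env_of: "idx s' 3 = 2 * n" "idx s' 4 = D" "idx s' 10 = i" if "row_inv s0 b sp j X u V i d p s'" for d p s'
      using that envD(1,2) state_invD(1) unfolding row_inv_def by blast+
    have upd: "row_inv s0 b sp j X u V i d p (s'\<lparr>idx := (idx s')(a := z)\<rparr>)"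
      if "row_inv s0 b sp j X u V i d p s'" "a = 11 \<or> a = 12" for d p s' a z
      using row_inv_set_idx[OF that(1)] that(2) by simp
    have loop: "runs P m (For 11 (R 4) (For 12 (R 3) elimination_step)) ?s (D * (2 * n * (T_step T + 100) + 100) + 100)
      (row_inv s0 b sp j X u V i D 0)"
    proof (rule runs_For[where bnd = D and B = "2 * n * (T_step T + 100) + 50" and
          I = "\<lambda>d s'. row_inv s0 b sp j X u V i d 0 s' \<and> idx s' 11 = d"], goal_cases)
      case 1
      then show ?case using upd[OF init] by simp
    next
      case (2 d s')
      then show ?case using env_of by auto
    next
      case (3 d s')
      show ?case
      proof (rule runs_For[where bnd = "2 * n" and B = "T_step T" and
          I = "\<lambda>p s'. row_inv s0 b sp j X u V i d p s' \<and> idx s' 11 = d \<and> idx s' 12 = p"], goal_cases)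
        case 1
        then show ?case using upd 3 by simp
      next
        case (2 p s'')
        then show ?case using env_of by auto
      next
        case (3 p s'')
        then have "row_inv s0 b sp j X u V i d p s''" "idx s'' 11 = d" "idx s'' 12 = p" by auto
        from runs_elimination_step[OF F j this \<open>d < D\<close> 3(1) i]
        show ?case by (rule runs_mono) (use upd in auto)
      next
        case (4 s'')
        \<comment> \<open>Passage to the next degree: live columns are below \<open>2 * n\<close>,
          so a finished degree \<open>d\<close> is the start of degree \<open>d + 1\<close>.\<close>
        have "pivot_inv V i (Suc d) 0 A q v" if "pivot_inv V i d (2 * n) A q v" for A q v
          using that unfolding pivot_inv_def by (auto simp: less_Suc_eq dest: al_less)
        with 4 have "row_inv s0 b sp j X u V i (Suc d) 0 s''" unfolding row_inv_def by blast
        then show ?case using upd 4 by simp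
      qed (simp add: algebra_simps)
    qed (auto simp: algebra_simps)
    show ?case
    proof (rule runs_Seq[where ?T1.0 = 5 and ?T2.0 = "T_rows T - 40"], rule runs_SetI, goal_cases)
      case 1
      have state: "s\<lparr>idx := (idx s)(ival s (INum 13) := ival s (R 10))\<rparr> = ?s" using regs by simp
      show ?case unfolding state
      proof (rule runs_Seq'[OF loop, where ?T2.0 = "D * (D * 300 + 300) + 20 + 100"], goal_cases)
        case (1 s1)
        then obtain B q v where S1: "state_inv s0 b sp j X B u s1" and P1: "pivot_inv V i D 0 B q v"
          and r1: "idx s1 10 = i" "idx s1 13 = q" unfolding row_inv_def by blast
        note S1' = state_invD[OF S1]
        have al1: "al B = V" "q \<in> V" using P1 by (auto simp: pivot_inv_def)
        have q: "q < 2 * n" using al1 al_less by blast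
        let ?u = "conv m (B i q) u"
        show ?case
        proof (rule runs_Seq'[OF runs_reduced[OF runs_mult_own[OF S1'(1,3) r1 lt q] S1'(2)], where ?T2.0 = 100], goal_cases)
          case (1 s2)
          then have eq2: "idx_eq scratch s1 s2" and out2: "outside b W s1 s2" and fr2: "frame s2 b B ?u"
            and red2: "reduced s2" by auto
          have af2: "after scratch b sp s1 s2" by (rule after_outside[OF eq2 out2])
          have env2: "env b sp (Suc j) s2" by (rule after_env[OF S1'(1) af2]) auto
          have r2: "idx s2 10 = i" "idx s2 13 = q" using eq2 r1 by (auto simp: idx_eq_def)
          show ?case
          proof (rule runs_Seq'[OF runs_reduced[OF runs_kill_cell[OF env2 fr2 r2(2) q] red2], where ?T2.0 = 40], goal_cases)
            case (1 s3)
            then have eq3: "idx_eq scratch s2 s3" and out3: "outside b WO s2 s3" and fr3: "frame s3 b (kill q B) ?u"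
              and red3: "reduced s3" by auto
            have af3: "after scratch b sp s2 s3" by (rule after_outside[OF eq3 out3])
            have env3: "env b sp (Suc j) s3" by (rule after_env[OF env2 af3]) auto
            have r3: "idx s3 10 = i" using eq3 r2 by (auto simp: idx_eq_def)
            show ?case
            proof (rule runs_mono[OF runs_reduced[OF runs_kill_cell[OF env3 fr3 r3 lt] red3]], goal_cases)
              case (2 s4)
              let ?C = "kill i (kill q B)"
              from 2 have eq4: "idx_eq scratch s3 s4" and out4: "outside b WO s3 s4" and fr4: "frame s4 b ?C ?u"
                and red4: "reduced s4" by auto
              have "after scratch b sp s3 s4" by (rule after_outside[OF eq4 out4])
              then have af4: "after scratch b sp s1 s4" using af2 af3 by (blast intro: after_trans)
              have acc4: "acc s4 = acc s1"
                using acc_outside[OF S1'(1) out2] acc_outside[OF env2 out3] acc_outside[OF env3 out4] by simp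
              \<comment> \<open>With all \<open>D\<close> degrees finished, the live part of row
                \<open>i\<close> is zero off the diagonal and outside column \<open>q\<close>, so
                its single entry can be moved into the weight.\<close>
              have "pol D u * haf B \<approx> pol D ?u * haf ?C"
                by (rule haf_single_entry) (use S1' P1 i al1 in \<open>auto simp: pivot_inv_def\<close>)
              then have "acc s4 + pol D ?u * haf ?C \<approx> acc s1 + pol D u * haf B"
                unfolding acc4 by (intro pcong_add[OF pcong_refl] pcong_sym[of _ _ "pol D u * haf B"])
              then have "state_inv s0 b sp j X ?C ?u s4"
                by (intro state_inv_update[OF S1 af4 _ red4 fr4] symm_kill zero_diag_kill dvw_conv)
                  (use S1' in auto)
              moreover have "al ?C \<inter> {..<Suc i} = {}"
                using V al1 by (auto simp: al_kill V_def less_Suc_eq)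
              moreover have "idx s4 10 = i" using eq4 r3 by (auto simp: idx_eq_def)
              ultimately show ?case unfolding outer_inv_def by blast
            qed simp
          qed simp
        qed simp
      qed (simp add: T_rows_def)
    qed (simp_all add: T_rows_def)
  next
    case 2
    then have "i \<notin> al A" using alive by (simp add: V_def)
    with V have "al A \<inter> {..<Suc i} = {}" by (auto simp: less_Suc_eq)
    then show ?case
      by (intro runs_Skip) (use S regs in \<open>auto simp: outer_inv_def T_rows_def\<close>)
  qed (simp add: bcost_alive T_rows_def)
qed

definition T_solver :: "nat \<Rightarrow> nat" where
  "T_solver T = 2 * n * (T_rows T + 100) + D * 60 + 500"

lemma runs_solver:
  assumes F: "solves P j T" and j: "Suc j \<le> k"
    and env: "env b sp (Suc j) s" and red: "reduced s" and fr: "frame s b A u"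
    and A: "symm A" "zero_diag A" "dvw (Suc j) u"
  shows "runs P m solver s (T_solver T) (\<lambda>s'. after scratch b sp s s' \<and> reduced s' \<and>
      acc s' \<approx> acc s + pol D u * haf A)"
proof -
  let ?X = "acc s + pol D u * haf A"
  have sp: "30 + 4 * n \<le> sp" using envD(11)[OF env] .
  define s1 where "s1 = s\<lparr>idx := (\<lambda>a. if a = 7 then sp + 7
    else if sp \<le> a \<and> a < sp + 7 then idx s (10 + (a - sp)) else idx s a)\<rparr>"
  have save: "runs P m save_registers s 100 (\<lambda>s'. s' = s1)"
  proof -
    define Sv where "Sv = (\<lambda>c s'. s' = s\<lparr>idx := (\<lambda>a. if sp \<le> a \<and> a < sp + c then idx s (10 + (a - sp)) else idx s a)\<rparr>)"
    show ?thesis unfolding save_registers_def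
    proof (rule runs_sequence[where I = Sv and B = 10 and ?T2.0 = 10], goal_cases)
      case 1
      have "(\<lambda>a. if sp \<le> a \<and> a < sp + 0 then idx s (10 + (a - sp)) else idx s a) = idx s" by auto
      then show ?case by (simp add: Sv_def)
    next
      case (2 c s')
      have r: "idx s' 7 = sp" "idx s' (10 + c) = idx s (10 + c)"
        using 2 sp envD(5)[OF env] by (simp_all add: Sv_def)
      have "map save_cell [10..<17] ! c = save_cell (10 + c)" using 2 by (simp add: nth_map del: upt_rec_numeral)
      then show ?case unfolding save_cell_def
        by (simp only:, intro runs_SetI) (use 2 r in \<open>auto simp: Sv_def fun_eq_iff\<close>)
    next
      case (3 s')
      then show ?case
        by (intro runs_SetI) (use sp envD(5)[OF env] in \<open>auto simp: Sv_def s1_def fun_eq_iff\<close>)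
    qed simp
  qed
  \<comment> \<open>The stack of the body begins above the seven saved variables, which protects
    them from nested calls.\<close>
  have env1: "env b (sp + 7) (Suc j) s1"
    using env sp unfolding env_def s1_def by auto
  have inv1: "state_inv s1 b (sp + 7) j ?X A u s1"
    unfolding state_inv_def using env1 red fr A
    by (auto simp: s1_def reduced_def frame_def acc_def)
  have outer_idx: "outer_inv s1 b (sp + 7) j ?X i (s'\<lparr>idx := (idx s')(10 := z)\<rparr>)"
    if "outer_inv s1 b (sp + 7) j ?X i s'" for i s' z
    using that state_inv_set_idx[of s1 b "sp + 7" j ?X _ _ s' 10 z] unfolding outer_inv_def by auto
  have loop: "runs P m (For 10 (R 3) process_row) s1 (2 * n * (T_rows T + 100) + 50)
    (outer_inv s1 b (sp + 7) j ?X (2 * n))"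
  proof (rule runs_For[where bnd = "2 * n" and B = "T_rows T" and
        I = "\<lambda>i s'. outer_inv s1 b (sp + 7) j ?X i s' \<and> idx s' 10 = i"], goal_cases)
    case 1
    have "outer_inv s1 b (sp + 7) j ?X 0 s1" unfolding outer_inv_def using inv1 by auto
    from outer_idx[OF this] show ?case by simp
  next
    case (2 i s')
    then show ?case using envD(1) state_invD(1) unfolding outer_inv_def by fastforce
  next
    case (3 i s')
    then have "outer_inv s1 b (sp + 7) j ?X i s'" "idx s' 10 = i" by auto
    from runs_process_row[OF F j this 3(1)] show ?case
      by (rule runs_mono) (use outer_idx in auto)
  qed (auto simp: algebra_simps)
  have bv: "bval m s (ILess (INum 0) (R 8))" using envD[OF env] by simp
  show ?thesis unfolding solver_def
  proof (rule runs_Cond[where ?T1.0 = "T_solver T - 20"], goal_cases)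
    case 1
    show ?case
    proof (rule runs_Seq'[OF save, where ?T2.0 = "T_solver T - 120"], goal_cases)
      case (1 s')
      show ?case unfolding 1
      proof (rule runs_Seq'[OF loop, where ?T2.0 = "D * 60 + 20 + 200"], goal_cases)
        case (1 s2)
        then obtain B w where S2: "state_inv s1 b (sp + 7) j ?X B w s2" and "al B \<inter> {..<2 * n} = {}"
          unfolding outer_inv_def by blast
        then have "al B = {}" by (auto simp: al_def)
        \<comment> \<open>No index is left and the empty hafnian is 1, so the frame is now worth
          exactly its weight, which \<open>add_weight\<close> transfers to the accumulator.\<close>
        then have haf1: "haf B = 1" by (simp add: haf_def haf_on_empty)
        note S2' = state_invD[OF S2]
        show ?case
        proof (rule runs_Seq'[OF runs_reduced[OF runs_add_weight[OF S2'(1) order_refl] S2'(2)], where ?T2.0 = 200], goal_cases)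
          case (1 s3)
          then have eq3: "idx_eq scratch s2 s3" and red3: "reduced s3"
            and cof3: "\<And>x. cof s3 x = (if x < D then (cof s2 x + cof s2 (b + WO + x)) mod m else cof s2 x)"
            by auto
          have "acc s3 \<approx> acc s2 + pol D w"
            using S2'(3) by (auto simp: acc_def pcong_iff_dvd coeff_pol cof3 frame_def dvd_mod_diff)
          also have "\<dots> \<approx> ?X" using S2'(8) haf1 by simp
          finally have acc3: "acc s3 \<approx> ?X" .
          have "after scratch b (sp + 7) s2 s3"
            using eq3 by (auto simp: after_def idx_eq_def cof3)
          then have "after {10..<20} b (sp + 7) s2 s3" by (rule after_mono) auto
          then have af3: "after {10..<20} b (sp + 7) s1 s3" using S2'(7) by (blast intro: after_trans)
          have stack: "idx s3 (sp + x) = idx s (10 + x)" if "x < 7" for x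
            using af3 that sp by (auto simp: after_def s1_def)
          have i7: "idx s3 7 = sp + 7" using af3 sp by (auto simp: after_def s1_def)
          define Rs where "Rs = (\<lambda>c s'. s' = s3\<lparr>idx := (\<lambda>a. if 10 \<le> a \<and> a < 10 + c then idx s a
            else if a = 7 then sp else idx s3 a)\<rparr>)"
          define s4 where "s4 = s3\<lparr>idx := (\<lambda>a. if 10 \<le> a \<and> a < 17 then idx s a
            else if a = 7 then sp else idx s3 a)\<rparr>"
          have low: "idx s3 a = idx s a" if "a < sp" "a \<notin> {10..<20}" "a \<noteq> 7" for a
            using af3 that by (auto simp: after_def s1_def)
          have idx4: "idx s4 a = idx s a" if "a < sp" "a \<notin> scratch" for a
            using low[OF that(1)] that(2) envD(5)[OF env] by (auto simp: s4_def)
          have "after scratch b sp s s4"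
            using af3 idx4 by (auto simp: after_def s4_def s1_def)
          moreover have "reduced s4" "acc s4 = acc s3"
            using red3 by (simp_all add: s4_def reduced_def acc_def)
          moreover have "runs P m restore_registers s3 200 (\<lambda>s'. s' = s4)"
            unfolding restore_registers_def
          proof (rule runs_Seq[where ?T1.0 = 10 and ?T2.0 = 100], rule runs_SetI,
              rule runs_sequence[where I = Rs and B = 10 and ?T2.0 = 10], goal_cases)
            case 1
            then show ?case using i7 by (auto simp: Rs_def fun_eq_iff)
          next
            case (2 c s')
            have "map restore_cell [10..<17] ! c = restore_cell (10 + c)"
              using 2 by (simp add: nth_map del: upt_rec_numeral)
            moreover have "idx s' 7 = sp" "idx s' (sp + c) = idx s (10 + c)"
              using 2 sp stack[of c] by (simp_all add: Rs_def)
            ultimately show ?case unfolding restore_cell_def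
              by (simp only:, intro runs_SetI) (use 2 in \<open>auto simp: Rs_def fun_eq_iff\<close>)
          next
            case (3 s')
            then show ?case by (intro runs_Skip) (auto simp: Rs_def s4_def)
          qed simp_all
          ultimately show ?case
            by (elim runs_mono) (use acc3 in auto)
        qed simp
      qed (simp add: T_solver_def)
    qed (simp add: T_solver_def)
  next
    case 2
    then show ?case using bv by simp
  qed (simp add: T_solver_def)
qed

primrec T_rec :: "nat \<Rightarrow> nat" where
  "T_rec 0 = 20"
| "T_rec (Suc j) = T_solver (T_rec j) + 1"

lemma solves_solver:
  assumes "length P > 1" "P ! 1 = solver" "j \<le> k"
  shows "solves P j (T_rec j)"
  using assms(3)
proof (induction j)
  case 0
  show ?case unfolding solves_def
  proof (intro allI impI)
    fix b sp s A u
    assume env: "env b sp 0 s" and red: "reduced s" and "dvw 0 u"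
    then have "0 + acc s \<approx> pol D u * haf A + acc s"
      by (intro pcong_add pcong_refl pcong_sym[OF dvw_0_eqv])
    then have "runs P m solver s 19 (\<lambda>s'. after scratch b sp s s' \<and> reduced s' \<and> acc s' \<approx> acc s + pol D u * haf A)"
      unfolding solver_def using red envD(6)[OF env]
      by (intro runs_Cond[where ?T1.0 = 1] runs_Skip) (auto simp: add.commute)
    then show "runs P m (Call 1) s (T_rec 0) (\<lambda>s'. after scratch b sp s s' \<and> reduced s' \<and> acc s' \<approx> acc s + pol D u * haf A)"
      using assms by (intro runs_Call) auto
  qed
next
  case (Suc j)
  then have IH: "solves P j (T_rec j)" by simp
  show ?case unfolding solves_def
  proof (intro allI impI)
    fix b sp s A u
    assume "env b sp (Suc j) s" "reduced s" "frame s b A u" "symm A" "zero_diag A" "dvw (Suc j) u"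
    from runs_solver[OF IH Suc.prems this]
    show "runs P m (Call 1) s (T_rec (Suc j)) (\<lambda>s'. after scratch b sp s s' \<and> reduced s' \<and> acc s' \<approx> acc s + pol D u * haf A)"
      using assms by (intro runs_Call[where ?T1.0 = "T_solver (T_rec j)"]) simp_all
  qed
qed

end

section \<open>The complete program\<close>

abbreviation incr :: "nat \<Rightarrow> iexp \<Rightarrow> com" where
  "incr x e \<equiv> SetI (INum x) (IAdd (R x) e)"

text \<open>All products arise by repeated addition. Cell 20 holds the row length
  \<open>2 * n * D\<close>; cells 9 and 22 run through the multiples entered into the two tables,
  and after the last round cell 9 has reached \<open>WO\<close>.\<close>

definition setup_registers :: com where
  "setup_registers = Seq (SetI (INum 3) (IAdd (R 0) (R 0))) (Seq (SetI (INum 4) (INum 1))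
    (Seq (For 17 (R 0) (incr 4 (R 1)))
    (Seq (SetI (INum 20) (INum 0)) (Seq (For 17 (R 3) (incr 20 (R 4)))
    (Seq (SetI (INum 21) (IAdd (INum 30) (R 3))) (Seq (SetI (INum 9) (INum 0)) (Seq (SetI (INum 22) (INum 0))
    (Seq (For 17 (R 3) (Seq (SetI (IAdd (INum 30) (R 17)) (R 9)) (Seq (SetI (IAdd (R 21) (R 17)) (R 22))
        (Seq (incr 9 (R 20)) (incr 22 (R 4))))))
    (Seq (SetI (INum 6) (IAdd (R 9) (R 4))) (Seq (SetI (INum 5) (R 9))
    (Seq (SetI (INum 7) (IAdd (INum 30) (IAdd (R 3) (R 3)))) (SetI (INum 8) (R 2)))))))))))))"

definition load_matrix :: com where
  "load_matrix = Seq (SetI (INum 22) (INum 0)) (For 17 (R 3) (For 18 (R 3) (For 19 (IAdd (R 1) (INum 1))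
    (Seq (SetC (ENT (R 9) (R 17) (R 18) (R 19)) (CCell (R 22))) (incr 22 (INum 1))))))"

text \<open>The low cells contain input until the matrix has been moved, so the accumulator is
  cleared only at this stage. The first frame has base \<open>WO\<close> and weight offset
  \<open>WO\<close>, hence the address \<open>IAdd (R 9) (R 9)\<close> for the constant coefficient
  of its weight.\<close>

definition setup_constants :: com where
  "setup_constants = Seq (For 17 (R 4) (SetC (R 17) (CNum 0))) (Seq (SetC (IAdd (R 9) (R 9)) (CNum 1))
    (Seq (SetC (R 4) (CNum 1)) (For 17 (ISub (R 2) (INum 1)) (SetC (R 4) (CAdd (CCell (R 4)) (CCell (R 4)))))))"

definition main :: com where
  "main = Seq setup_registers (Seq load_matrix (Seq setup_constants (Seq (Call 1) (SetI (INum 0) (R 4)))))"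

context hafnian_run
begin

section \<open>Initialisation\<close>

text \<open>The part of \<open>env\<close> that concerns index cells. Its claim about the constant
  for parity tests is not yet true during the setup and is met by a fictitious coefficient
  memory.\<close>

definition regs_ok :: "memory \<Rightarrow> bool" where
  "regs_ok s \<longleftrightarrow> idx s 1 = N \<and> idx s 2 = k \<and> env WO (30 + 4 * n) k (s\<lparr>cof := (\<lambda>_. 2 ^ (k - 1))\<rparr>)"

lemma regs_okD:
  assumes "regs_ok s"
  shows "idx s 1 = N" "idx s 2 = k" "idx s 3 = 2 * n" "idx s 4 = D" "idx s 9 = WO"
    "idx s (Suc 0) = N"
  using assms by (simp_all add: regs_ok_def env_def)

lemma regs_ok_set_idx:
  "regs_ok s \<Longrightarrow> a \<in> {10..<20} \<union> {22} \<Longrightarrow> regs_ok (s\<lparr>idx := (idx s)(a := v)\<rparr>)"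
  unfolding regs_ok_def env_def by auto

lemma regs_ok_cof [simp]: "regs_ok (s\<lparr>cof := f\<rparr>) = regs_ok s"
  by (simp add: regs_ok_def env_def)

lemma regs_ok_ENT:
  assumes "regs_ok s" "ival s x < 2 * n" "ival s y < 2 * n"
  shows "ival s (ENT (R 9) x y t) = WO + ent (ival s x) (ival s y) (ival s t)"
proof -
  have iv: "ival (s\<lparr>cof := f\<rparr>) e = ival s e" for e f by (induction e) simp_all
  show ?thesis
    using ival_ENT[of WO "30 + 4 * n" k "s\<lparr>cof := (\<lambda>_. 2 ^ (k - 1))\<rparr>" x y "R 9" t] assms regs_okD(5)[OF assms(1)]
    unfolding regs_ok_def iv by simp
qed

definition T_setup :: nat where
  "T_setup = 200 * n + 500"

lemma runs_setup_registers:
  assumes s: "idx s 0 = n" "idx s 1 = N" "idx s 2 = k"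
  shows "runs P m setup_registers s T_setup (\<lambda>s'. regs_ok s' \<and> cof s' = cof s)"
proof -
  have s0: "idx s (Suc 0) = N" using s by simp
  have l1: "runs P m (For 17 (R 0) (incr 4 (R 1))) s' (n * 30 + 30) (\<lambda>s'. cof s' = cof s \<and>
      idx s' 1 = N \<and> idx s' 2 = k \<and> idx s' 3 = 2 * n \<and> idx s' 4 = D)"
    if "cof s' = cof s \<and> idx s' 0 = n \<and> idx s' 1 = N \<and> idx s' 2 = k \<and> idx s' 3 = 2 * n \<and> idx s' 4 = 1" for s'
  proof (rule runs_For[where bnd = n and B = 10 and I = "\<lambda>i s'. cof s' = cof s \<and> idx s' 0 = n \<and>
      idx s' 1 = N \<and> idx s' 2 = k \<and> idx s' 3 = 2 * n \<and> idx s' 4 = i * N + 1 \<and> idx s' 17 = i"], goal_cases)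
    case (3 i s')
    then show ?case by (intro runs_SetI) auto
  qed (use that in \<open>auto simp: D_def\<close>)
  have l2: "runs P m (For 17 (R 3) (incr 20 (R 4))) s' (n * 60 + 30) (\<lambda>s'. cof s' = cof s \<and>
      idx s' 1 = N \<and> idx s' 2 = k \<and> idx s' 3 = 2 * n \<and> idx s' 4 = D \<and> idx s' 20 = 2 * n * D)"
    if "cof s' = cof s \<and> idx s' 1 = N \<and> idx s' 2 = k \<and> idx s' 3 = 2 * n \<and> idx s' 4 = D \<and> idx s' 20 = 0" for s'
  proof (rule runs_For[where bnd = "2 * n" and B = 10 and I = "\<lambda>i s'. cof s' = cof s \<and>
      idx s' 1 = N \<and> idx s' 2 = k \<and> idx s' 3 = 2 * n \<and> idx s' 4 = D \<and> idx s' 20 = i * D \<and> idx s' 17 = i"], goal_cases)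
    case (3 i s')
    then show ?case by (intro runs_SetI) auto
  qed (use that in auto)
  have l3: "runs P m (For 17 (R 3) (Seq (SetI (IAdd (INum 30) (R 17)) (R 9)) (Seq (SetI (IAdd (R 21) (R 17)) (R 22))
        (Seq (incr 9 (R 20)) (incr 22 (R 4)))))) s' (n * 100 + 30) (\<lambda>s'. cof s' = cof s \<and>
      idx s' 1 = N \<and> idx s' 2 = k \<and> idx s' 3 = 2 * n \<and> idx s' 4 = D \<and> idx s' 9 = WO \<and> idx s' 21 = 30 + 2 * n \<and>
      (\<forall>x<2*n. idx s' (30 + x) = x * (2 * n * D) \<and> idx s' (30 + 2 * n + x) = x * D))"
    if "cof s' = cof s \<and> idx s' 1 = N \<and> idx s' 2 = k \<and> idx s' 3 = 2 * n \<and> idx s' 4 = D \<and> idx s' 20 = 2 * n * D \<and>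
      idx s' 21 = 30 + 2 * n \<and> idx s' 9 = 0 \<and> idx s' 22 = 0" for s'
  proof (rule runs_For[where bnd = "2 * n" and B = 38 and I = "\<lambda>i s'. cof s' = cof s \<and>
      idx s' 1 = N \<and> idx s' 2 = k \<and> idx s' 3 = 2 * n \<and> idx s' 4 = D \<and> idx s' 20 = 2 * n * D \<and> idx s' 21 = 30 + 2 * n \<and>
      idx s' 9 = i * (2 * n * D) \<and> idx s' 22 = i * D \<and> idx s' 17 = i \<and>
      (\<forall>x<i. idx s' (30 + x) = x * (2 * n * D) \<and> idx s' (30 + 2 * n + x) = x * D)"], goal_cases)
    case (3 i s')
    then show ?case
      by - (rule runs_Seq[where ?T1.0 = 8 and ?T2.0 = 28], rule runs_SetI,
        rule runs_Seq[where ?T1.0 = 9 and ?T2.0 = 18], rule runs_SetI,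
        rule runs_Seq[where ?T1.0 = 8 and ?T2.0 = 8], rule runs_SetI, rule runs_SetI,
        auto simp: less_Suc_eq)
  qed (use that in \<open>auto simp: WO_def\<close>)
  show ?thesis unfolding setup_registers_def
  proof (rule runs_Seq[where ?T1.0 = 10 and ?T2.0 = "200 * n + 400"], rule runs_SetI,
      rule runs_Seq[where ?T1.0 = 10 and ?T2.0 = "200 * n + 380"], rule runs_SetI,
      rule runs_Seq'[OF l1, where ?T2.0 = "160 * n + 300"], goal_cases)
    case (2 s1)
    show ?case
    proof (rule runs_Seq[where ?T1.0 = 10 and ?T2.0 = "160 * n + 280"], rule runs_SetI,
        rule runs_Seq'[OF l2, where ?T2.0 = "100 * n + 200"], goal_cases)
      case (2 s2)
      show ?case
      proof (rule runs_Seq[where ?T1.0 = 10 and ?T2.0 = "100 * n + 180"], rule runs_SetI,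
          rule runs_Seq[where ?T1.0 = 10 and ?T2.0 = "100 * n + 160"], rule runs_SetI,
          rule runs_Seq[where ?T1.0 = 10 and ?T2.0 = "100 * n + 140"], rule runs_SetI,
          rule runs_Seq'[OF l3, where ?T2.0 = 80], goal_cases)
        case (2 s3)
        let ?s = "s3\<lparr>idx := (idx s3)(6 := W, 5 := WO, 7 := 30 + 4 * n, 8 := k)\<rparr>"
        have "regs_ok ?s" using 2 unfolding regs_ok_def env_def by (auto simp: W_def)
        then show ?case
          by - (rule runs_Seq[where ?T1.0 = 10 and ?T2.0 = 60], rule runs_SetI,
            rule runs_Seq[where ?T1.0 = 10 and ?T2.0 = 40], rule runs_SetI,
            rule runs_Seq[where ?T1.0 = 10 and ?T2.0 = 20], rule runs_SetI, rule runs_SetI,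
            use 2 in \<open>simp_all add: W_def\<close>)
      qed (use 2 in simp_all)
    qed (use 2 in simp_all)
  qed (use s s0 in \<open>simp_all add: T_setup_def\<close>)
qed

definition src :: "nat \<Rightarrow> nat \<Rightarrow> nat \<Rightarrow> nat" where
  "src x y t = (x * (2 * n) + y) * (N + 1) + t"

text \<open>Input and first frame are disjoint, since an input entry takes
  \<open>N + 1 \<le> D\<close> cells. Loading therefore never overwrites input that is still to be
  read.\<close>

lemma src_less: "x < 2 * n \<Longrightarrow> y < 2 * n \<Longrightarrow> t \<le> N \<Longrightarrow> src x y t < WO"
proof -
  assume x: "x < 2 * n" and y: "y < 2 * n" and t: "t \<le> N"
  have "src x y t < (x * (2 * n) + y) * (N + 1) + (N + 1)" using t by (simp add: src_def)
  also have "\<dots> = (x * (2 * n) + y + 1) * (N + 1)" by simp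
  also have "\<dots> \<le> (2 * n * (2 * n)) * D"
  proof (rule mult_mono)
    have "x * (2 * n) + y + 1 \<le> x * (2 * n) + 2 * n" using y by simp
    also have "\<dots> = (x + 1) * (2 * n)" by simp
    also have "\<dots> \<le> 2 * n * (2 * n)" using x by (intro mult_right_mono) auto
    finally show "x * (2 * n) + y + 1 \<le> 2 * n * (2 * n)" .
    show "N + 1 \<le> D" using n_pos by (simp add: D_def)
  qed auto
  finally show ?thesis by (simp add: WO_def mult.assoc)
qed

definition T_load :: nat where
  "T_load = 2 * n * (2 * n * ((N + 1) * 100 + 100) + 100) + 100"

lemma runs_load_matrix:
  assumes ok: "regs_ok s" and zero: "\<And>a. WO \<le> a \<Longrightarrow> cof s a = 0"
  shows "runs P m load_matrix s T_load (\<lambda>s'. regs_ok s' \<and> reduced s' \<and>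
    entries s' WO (\<lambda>x y t. if t \<le> N then cof s (src x y t) mod m else 0) \<and>
    (\<forall>a. WO + WO \<le> a \<longrightarrow> cof s' a = 0))"
proof -
  \<comment> \<open>\<open>C\<close> marks the coefficients already copied; below it is an initial
    segment of the order by row, column and degree.\<close>
  let ?A = "\<lambda>C x y t. if t \<le> N \<and> C x y t then cof s (src x y t) mod m else 0"
  define J where "J = (\<lambda>C z s'. regs_ok s' \<and> entries s' WO (?A C) \<and> idx s' 22 = z \<and>
    (\<forall>a. (a < WO \<or> WO + WO \<le> a) \<longrightarrow> cof s' a = cof s a))"
  have J_idx: "J C z (s'\<lparr>idx := (idx s')(a := v)\<rparr>)" if "J C z s'" "a \<in> scratch" for C z s' a v
    using that regs_ok_set_idx[of s' a v] by (auto simp: J_def)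
  have J_mono: "J C' z s'" if "J C z s'" "\<And>x y t. x < 2 * n \<Longrightarrow> y < 2 * n \<Longrightarrow> t \<le> N \<Longrightarrow> C x y t = C' x y t" for C C' z s'
  proof -
    have "entries s' WO (?A C')"
      by (rule entries_mono[of s' WO "?A C"]) (use that in \<open>auto simp: J_def\<close>)
    with that(1) show ?thesis by (simp add: J_def)
  qed
  have J_regs: "idx s' 1 = N" "idx s' (Suc 0) = N" "idx s' 3 = 2 * n" "idx s' 22 = z" if "J C z s'" for C z s'
    using that regs_okD[of s'] by (auto simp: J_def)
  let ?body = "Seq (SetC (ENT (R 9) (R 17) (R 18) (R 19)) (CCell (R 22))) (incr 22 (INum 1))"
  let ?C = "\<lambda>x y t x' y' t'. x' < x \<or> x' = x \<and> (y' < y \<or> y' = y \<and> t' < (t::nat))"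
  have ND: "N < D" unfolding D_def using n_pos by (simp add: less_Suc_eq_le)
  have l3: "runs P m (For 19 (IAdd (R 1) (INum 1)) ?body) s' ((N + 1) * 100 + 50)
     (\<lambda>s''. J (?C x (Suc y) 0) (src x (Suc y) 0) s'' \<and> idx s'' 17 = x \<and> idx s'' 18 = y)"
    if s': "J (?C x y 0) (src x y 0) s'" "idx s' 17 = x" "idx s' 18 = y" and xy: "x < 2 * n" "y < 2 * n" for x y s'
  proof (rule runs_For[where bnd = "N + 1" and B = 50 and I = "\<lambda>t s'. J (?C x y t) (src x y t) s' \<and>
      idx s' 17 = x \<and> idx s' 18 = y \<and> idx s' 19 = t"], goal_cases)
    case 1
    then show ?case using J_idx[OF s'(1), of 19 0] s' by simp
  next
    case (2 t s')
    then show ?case using J_regs[of _ _ s'] by auto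
  next
    case (3 t s'')
    then have J: "J (?C x y t) (src x y t) s''" and r: "idx s'' 17 = x" "idx s'' 18 = y" "idx s'' 19 = t" "t \<le> N"
      by auto
    note rg = J_regs[OF J]
    have adr: "ival s'' (ENT (R 9) (R 17) (R 18) (R 19)) = WO + ent x y t"
      by (subst regs_ok_ENT) (use J r xy in \<open>auto simp: J_def\<close>)
    let ?v = "cof s (src x y t) mod m"
    have val: "cval m s'' (CCell (R 22)) = ?v"
      using J rg src_less[OF xy r(4)] by (simp add: J_def)
    let ?s1 = "s''\<lparr>cof := (cof s'')(WO + ent x y t := ?v)\<rparr>"
    let ?s2 = "?s1\<lparr>idx := (idx s'')(22 := Suc (src x y t))\<rparr>"
    have lt: "ent x y t < WO" using ent_less xy r(4) ND by simp
    have "entries ?s1 WO (?A (?C x y (Suc t)))"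
      by (rule entries_mono[OF entries_update[of s'' WO "?A (?C x y t)" x y t ?v]])
        (use J xy r ND in \<open>auto simp: J_def less_Suc_eq\<close>)
    moreover have "regs_ok ?s2" using J regs_ok_set_idx[of ?s1 22] by (simp add: J_def)
    ultimately have "J (?C x y (Suc t)) (src x y (Suc t)) ?s2"
      using J lt by (auto simp: J_def src_def)
    from J_idx[OF this, of 19 "Suc t"] have "J (?C x y (Suc t)) (src x y (Suc t)) (?s2\<lparr>idx := (idx ?s2)(19 := Suc t)\<rparr>)"
      by simp
    then show ?case
      by - (rule runs_Seq[where ?T1.0 = 30 and ?T2.0 = 10], rule runs_SetC, rule runs_SetI, unfold adr val,
        use rg r in simp_all)
  next
    case (4 s'')
    then have "J (?C x y (N + 1)) (src x y (N + 1)) s''" by simp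
    then have "J (?C x (Suc y) 0) (src x y (N + 1)) s''"
      by (rule J_mono) (auto simp: less_Suc_eq)
    then show ?case using 4 by (simp add: src_def algebra_simps)
  qed simp
  have l2: "runs P m (For 18 (R 3) (For 19 (IAdd (R 1) (INum 1)) ?body)) s' (2 * n * ((N + 1) * 100 + 100) + 50)
     (\<lambda>s''. J (?C (Suc x) 0 0) (src (Suc x) 0 0) s'' \<and> idx s'' 17 = x)"
    if s': "J (?C x 0 0) (src x 0 0) s'" "idx s' 17 = x" and x: "x < 2 * n" for x s'
  proof (rule runs_For[where bnd = "2 * n" and B = "(N + 1) * 100 + 50" and I = "\<lambda>y s'. J (?C x y 0) (src x y 0) s' \<and>
      idx s' 17 = x \<and> idx s' 18 = y"], goal_cases)
    case 1
    then show ?case using J_idx[OF s'(1), of 18 0] s' by simp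
  next
    case (2 t s')
    then show ?case using J_regs[of _ _ s'] by auto
  next
    case (3 y s'')
    then show ?case by (intro runs_mono[OF l3[of x y s'']]) (use x J_idx in auto)
  next
    case (4 s'')
    then have "J (?C x (2 * n) 0) (src x (2 * n) 0) s''" by simp
    then have "J (?C (Suc x) 0 0) (src x (2 * n) 0) s''"
      by (rule J_mono) (auto simp: less_Suc_eq)
    then show ?case using 4 by (simp add: src_def algebra_simps)
  qed (simp add: algebra_simps)
  have "runs P m (For 17 (R 3) (For 18 (R 3) (For 19 (IAdd (R 1) (INum 1)) ?body))) (s\<lparr>idx := (idx s)(22 := 0)\<rparr>)
    (2 * n * (2 * n * ((N + 1) * 100 + 100) + 100) + 50) (\<lambda>s''. J (?C (2 * n) 0 0) (src (2 * n) 0 0) s'')"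
  proof (rule runs_For[where bnd = "2 * n" and B = "2 * n * ((N + 1) * 100 + 100) + 50" and
      I = "\<lambda>x s'. J (?C x 0 0) (src x 0 0) s' \<and> idx s' 17 = x"], goal_cases)
    case 1
    have "entries s WO (\<lambda>_ _ _. 0)" using zero by (simp add: entries_def)
    then have "J (?C 0 0 0) (src 0 0 0) (s\<lparr>idx := (idx s)(22 := 0)\<rparr>)"
      using ok regs_ok_set_idx[of s 22 0] by (simp add: J_def src_def)
    from J_idx[OF this, of 17 0] show ?case by simp
  next
    case (2 t s')
    then show ?case using J_regs[of _ _ s'] by auto
  next
    case (3 x s'')
    then show ?case by (intro runs_mono[OF l2[of x s'']]) (use J_idx in auto)
  qed (simp_all add: algebra_simps)
  then have "runs P m load_matrix s T_load (\<lambda>s''. J (?C (2 * n) 0 0) (src (2 * n) 0 0) s'')"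
    unfolding load_matrix_def T_load_def
    by - (rule runs_Seq[where ?T1.0 = 10 and ?T2.0 = "2 * n * (2 * n * ((N + 1) * 100 + 100) + 100) + 50"], rule runs_SetI, simp_all)
  moreover have "cof s a mod m = cof s a" if "WO \<le> a" for a using zero that by simp
  ultimately have "runs P m load_matrix s T_load (\<lambda>s''. J (?C (2 * n) 0 0) (src (2 * n) 0 0) s'' \<and> reduced s'')"
    by (intro runs_reduced) (auto simp: reduced_def)
  then show ?thesis
    by (rule runs_mono) (use zero in \<open>auto simp: J_def elim!: entries_mono\<close>)
qed

lemma regs_ok_update:
  "regs_ok s \<Longrightarrow> a \<in> {10..<20} \<union> {22} \<Longrightarrow> regs_ok (s\<lparr>cof := f, idx := (idx s)(a := v)\<rparr>)"
  using regs_ok_set_idx[of "s\<lparr>cof := f\<rparr>" a v] by simp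

definition T_const :: nat where
  "T_const = D * 30 + k * 40 + 100"

lemma runs_setup_constants:
  assumes ok: "regs_ok s" and red: "reduced s" and ent: "entries s WO A"
    and zero: "\<And>a. WO + WO \<le> a \<Longrightarrow> cof s a = 0"
  shows "runs P m setup_constants s T_const (\<lambda>s'. env WO (30 + 4 * n) k s' \<and> reduced s' \<and>
    frame s' WO A (\<lambda>t. if t = 0 then 1 else 0) \<and> (\<forall>a<D. cof s' a = 0))"
proof -
  let ?c1 = "\<lambda>a. if a < D then 0 else cof s a"
  let ?c2 = "?c1(WO + WO := 1)"
  have r: "idx s' 2 = k" "idx s' 4 = D" "idx s' 9 = WO" if "regs_ok s'" for s'
    using regs_okD[OF that] by auto
  have l1: "runs P m (For 17 (R 4) (SetC (R 17) (CNum 0))) s (D * 30 + 20) (\<lambda>s'. regs_ok s' \<and> cof s' = ?c1)"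
  proof (rule runs_For[where bnd = D and B = 10 and I = "\<lambda>i s'. regs_ok s' \<and> idx s' 17 = i \<and>
      cof s' = (\<lambda>a. if a < i then 0 else cof s a)"], goal_cases)
    case 1
    then show ?case using regs_ok_set_idx[OF ok] by simp
  next
    case (3 i s')
    then show ?case
      by (intro runs_SetC) (use regs_ok_update[of s' 17] in \<open>auto simp: fun_eq_iff less_Suc_eq\<close>)
  qed (use r in auto)
  have l2: "runs P m (For 17 (ISub (R 2) (INum 1)) (SetC (R 4) (CAdd (CCell (R 4)) (CCell (R 4))))) s'
      (k * 40 + 30) (\<lambda>s'. regs_ok s' \<and> cof s' = ?c2(D := 2 ^ (k - 1)))"
    if "regs_ok s'" "cof s' = ?c2(D := 1)" for s'
  proof (rule runs_For[where bnd = "k - 1" and B = 12 and I = "\<lambda>i s'. regs_ok s' \<and> idx s' 17 = i \<and>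
      cof s' = ?c2(D := 2 ^ i)"], goal_cases)
    case 1
    then show ?case using regs_ok_set_idx[OF that(1)] that(2) by simp
  next
    case (2 i s')
    then show ?case using r[of s'] by simp
  next
    case (3 i s')
    \<comment> \<open>Only \<open>k - 1\<close> doublings are made, so the power never wraps around
      modulo \<open>2 ^ k\<close>.\<close>
    have "(2::int) ^ Suc i < m" "(2::int) ^ i < m"
      unfolding m_def using 3(1) by (intro power_strict_increasing; simp)+
    then have "((2::int) ^ i mod m + 2 ^ i mod m) mod m = 2 ^ Suc i" by simp
    then have "cval m s' (CAdd (CCell (R 4)) (CCell (R 4))) = 2 ^ Suc i"
      using 3(2) r[of s'] by simp
    moreover have "ival s' (R 4) = D" using 3(2) r[of s'] by simp
    ultimately show ?case
      by (intro runs_SetC) (use 3 regs_ok_update[of s' 17] in \<open>simp_all del: power_Suc\<close>)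
  next
    case 5
    have "(k - 1) * 40 \<le> k * 40" by simp
    then show ?case by simp
  qed simp
  have "runs P m setup_constants s T_const (\<lambda>s'. regs_ok s' \<and> cof s' = ?c2(D := 2 ^ (k - 1)))"
    unfolding setup_constants_def
  proof (rule runs_Seq'[OF l1, where ?T2.0 = "k * 40 + 60"], goal_cases)
    case (1 s1)
    let ?s3 = "s1\<lparr>cof := ?c2(D := 1)\<rparr>"
    have "runs P m (For 17 (ISub (R 2) (INum 1)) (SetC (R 4) (CAdd (CCell (R 4)) (CCell (R 4))))) ?s3
      (k * 40 + 30) (\<lambda>s'. regs_ok s' \<and> cof s' = ?c2(D := 2 ^ (k - 1)))"
      by (rule l2) (use 1 in simp_all)
    then show ?case
      by - (rule runs_Seq[where ?T1.0 = 10 and ?T2.0 = "k * 40 + 40"], rule runs_SetC,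
        rule runs_Seq[where ?T1.0 = 10 and ?T2.0 = "k * 40 + 30"], rule runs_SetC,
        use 1 r[of s1] m_gt_1 in simp_all)
  qed (simp add: T_const_def)
  from runs_reduced[OF this red] show ?thesis
  proof (rule runs_mono, goal_cases)
    case (2 s')
    then have ok': "regs_ok s'" and cof': "cof s' = ?c2(D := 2 ^ (k - 1))" and red': "reduced s'" by auto
    have "D < WO" using D_add_2_le_WO by simp
    moreover have "idx (s'\<lparr>cof := \<lambda>_. 2 ^ (k - 1)\<rparr>) = idx s'" by simp
    ultimately have env: "env WO (30 + 4 * n) k s'"
      using ok' cof' unfolding regs_ok_def env_def by simp
    have "entries s' WO A"
      unfolding entries_def
    proof (intro allI impI)
      fix x y t assume xyt: "x < 2 * n" "y < 2 * n" "t < D"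
      show "cof s' (WO + ent x y t) = A x y t"
        using ent_less[OF xyt] entriesD[OF ent xyt] \<open>D < WO\<close> by (simp add: cof')
    qed
    moreover have "cof s' (WO + WO + t) = (if t = 0 then 1 else 0)" for t
      using zero[of "WO + WO + t"] \<open>D < WO\<close> by (simp add: cof')
    moreover have "\<forall>a<D. cof s' a = 0" using \<open>D < WO\<close> by (simp add: cof')
    ultimately show ?case using env red' by (simp add: frame_iff)
  qed simp
qed

section \<open>The complete run and its output\<close>

definition T_main :: nat where
  "T_main = T_setup + T_load + T_const + T_rec k + 20"

lemma runs_main:
  assumes A: "A \<in> poly_matrices n N"
  shows "runs [main, solver] m main (input_memory n N k A) T_main (\<lambda>s'. idx s' 0 = D \<and>
    (\<forall>t<D. cof s' t mod m = cof s' t) \<and> acc s' \<approx> haf_on {0..<2*n} (\<lambda>i j. A $$ (i,j)))"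
proof -
  let ?P = "[main, solver]"
  let ?s0 = "input_memory n N k A"
  let ?u = "\<lambda>t. if t = 0 then 1 else 0 :: int"
  let ?A = "\<lambda>x y t. if t \<le> N then cof ?s0 (src x y t) mod m else 0"
  have sym: "A $$ (x,y) = A $$ (y,x)" if "x < 2 * n" "y < 2 * n" for x y
  proof -
    have "transpose_mat A = A" "A \<in> carrier_mat (2 * n) (2 * n)" using A by (auto simp: poly_matrices_def)
    with that show ?thesis by (metis carrier_matD index_transpose_mat(1))
  qed
  have deg: "degree (A $$ (x,y)) \<le> N" and diag: "A $$ (x,x) = 0" if "x < 2 * n" "y < 2 * n" for x y
    using A that by (auto simp: poly_matrices_def)
  have input: "cof ?s0 (src x y t) = coeff (A $$ (x,y)) t" if "x < 2 * n" "y < 2 * n" "t \<le> N" for x y t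
  proof -
    have quot: "(a * c + r) div c = a" "(a * c + r) mod c = r" if "r < c" for a c r :: nat
      using that by simp_all
    have 1: "src x y t mod (N + 1) = t" "src x y t div (N + 1) = x * (2 * n) + y"
      unfolding src_def using that(3) by (intro quot; simp)+
    have "(x * (2 * n) + y) div (2 * n) = x" "(x * (2 * n) + y) mod (2 * n) = y"
      using that(2) by (intro quot; simp)+
    with 1 that show ?thesis by (simp add: input_memory_def Let_def)
  qed
  \<comment> \<open>The first frame lies in untouched memory; its zeros pad the entries from degree
    \<open>N + 1\<close> up to degree \<open>D - 1\<close>.\<close>
  have zero: "cof ?s0 a = 0" if "WO \<le> a" for a
  proof -
    have "2 * n * (2 * n) * (N + 1) \<le> WO"
      unfolding WO_def D_def mult.assoc using n_pos by (intro mult_le_mono) auto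
    then have "2 * n * (2 * n) * (N + 1) \<le> a" using that by simp
    then have "2 * n * (2 * n) \<le> a div (N + 1)" by (simp add: less_eq_div_iff_mult_less_eq)
    then have "2 * n \<le> a div (N + 1) div (2 * n)" using n_pos by (simp add: less_eq_div_iff_mult_less_eq)
    then show ?thesis by (simp add: input_memory_def Let_def)
  qed
  have entry: "?A x y t mod m = coeff (A $$ (x,y)) t mod m" if "x < 2 * n" "y < 2 * n" for x y t
    using input[OF that] deg[OF that] coeff_eq_0[of "A $$ (x,y)" t] by auto
  have al: "al ?A = {0..<2*n}"
    using input diag by (auto simp: al_def)
  have symm: "symm ?A" using input sym by (auto simp: symm_def)
  have zd: "zero_diag ?A" unfolding zero_diag_def al using input diag by auto
  have mat: "mat_of ?A x y \<approx> A $$ (x,y)" if "x < 2 * n" "y < 2 * n" for x y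
    unfolding mat_of_def pcong_iff_dvd using entry[OF that] by (simp add: mod_eq_dvd_iff)
  \<comment> \<open>The initial weight is 1; at precision \<open>k\<close> the weight has to be
    divisible by \<open>2 ^ 0\<close> only.\<close>
  have "pol D ?u = 1"
    using D_pos by (intro poly_eqI) (auto simp: coeff_pol)
  moreover have "haf ?A \<approx> haf_on {0..<2*n} (\<lambda>i j. A $$ (i,j))"
    unfolding haf_def al by (rule pcong_haf_on) (use mat in auto)
  ultimately have val: "pol D ?u * haf ?A \<approx> haf_on {0..<2*n} (\<lambda>i j. A $$ (i,j))" by simp
  have init: "idx ?s0 0 = n" "idx ?s0 1 = N" "idx ?s0 2 = k"
    by (simp_all add: input_memory_def)
  have call: "runs ?P m (Call 1) s (T_rec k) (\<lambda>s'. idx s' 4 = D \<and>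
      (\<forall>t<D. cof s' t mod m = cof s' t) \<and> acc s' \<approx> haf_on {0..<2*n} (\<lambda>i j. A $$ (i,j)))"
    if env: "env WO (30 + 4 * n) k s" and red: "reduced s" and fr: "frame s WO ?A ?u"
      and zero: "\<forall>a<D. cof s a = 0" for s
  proof -
    have "solves ?P k (T_rec k)" by (rule solves_solver) auto
    from this[unfolded solves_def, rule_format, OF env red fr symm zd dvw_k]
    obtain t s' where s': "exec ?P m (Call 1) s t s'" "t \<le> T_rec k" "after scratch WO (30 + 4 * n) s s'"
      "acc s' \<approx> acc s + pol D ?u * haf ?A" by (auto simp: runs_def)
    have "acc s = 0" unfolding acc_def using zero by (intro poly_eqI) (auto simp: coeff_pol)
    then have "acc s' \<approx> haf_on {0..<2*n} (\<lambda>i j. A $$ (i,j))"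
      using pcong_trans[OF s'(4)] val by simp
    moreover have "cof s' a mod m = cof s' a" if "a < D" for a
      using exec_reduced[OF s'(1)] zero that by simp
    moreover have "idx s' 4 = D" using s'(3) envD(2)[OF env] by (simp add: after_def)
    ultimately show ?thesis unfolding runs_def using s' by blast
  qed
  show ?thesis
  proof (subst (2) main_def, rule runs_Seq'[OF runs_setup_registers[OF init], where ?T2.0 = "T_load + (T_const + (T_rec k + 10))"], goal_cases)
    case (1 s1)
    then have ok1: "regs_ok s1" and cof1: "cof s1 = cof ?s0" by auto
    show ?case
    proof (rule runs_Seq'[OF runs_load_matrix[OF ok1], where ?T2.0 = "T_const + (T_rec k + 10)"], goal_cases)
      case (1 a)
      then show ?case using zero by (simp add: cof1)
    next
      case (2 s2)
      then have ok2: "regs_ok s2" "reduced s2" "entries s2 WO ?A" and z2: "\<And>a. WO + WO \<le> a \<Longrightarrow> cof s2 a = 0"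
        unfolding cof1 by blast+
      show ?case
      proof (rule runs_Seq'[OF runs_setup_constants[OF ok2 z2], where ?T2.0 = "T_rec k + 10"], goal_cases)
        case (2 s3)
        then have "env WO (30 + 4 * n) k s3" "reduced s3" "frame s3 WO ?A ?u" "\<forall>a<D. cof s3 a = 0"
          unfolding cof1 by blast+
        then show ?case
        proof (rule runs_Seq'[OF call, where ?T2.0 = 10], goal_cases)
          case (1 s4)
          then show ?case by (intro runs_SetI) (auto simp: acc_def)
        qed simp
      qed simp_all
    qed simp
  qed (simp add: T_main_def)
qed

text \<open>A partition of \<open>2 * n\<close> points into pairs has \<open>n\<close> blocks, each
  contributing degree at most \<open>N\<close>. Hence truncation at \<open>D = n * N + 1\<close>
  loses no coefficient of the result.\<close>

lemma degree_hafnian_le: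
  assumes A: "A \<in> poly_matrices n N"
  shows "degree (haf_on {0..<2*n} (\<lambda>i j. A $$ (i,j))) \<le> n * N"
  unfolding haf_on_def
proof (rule degree_sum_le)
  show "finite (pair_partitions {0..<2*n})" by (simp add: finite_pair_partitions)
  fix M assume M: "M \<in> pair_partitions {0..<2*n}"
  then have part: "partition_on {0..<2*n} M" and two: "\<And>e. e \<in> M \<Longrightarrow> card e = 2"
    by (auto simp: pair_partitions_def)
  have fin: "finite M" using finite_elements[OF _ part] by simp
  have "2 * n = card (\<Union>M)" unfolding partition_onD1[OF part, symmetric] by simp
  also have "\<dots> = (\<Sum>e\<in>M. card e)"
  proof (rule card_Union_disjoint)
    show "disjoint M" by (rule partition_onD2[OF part])
    show "finite e" if "e \<in> M" for e using two[OF that] by (auto intro: card_ge_0_finite)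
  qed
  also have "\<dots> = 2 * card M" using two by simp
  finally have card: "card M = n" by simp
  have "degree (\<Prod>e\<in>M. A $$ (Min e, Max e)) \<le> (\<Sum>e\<in>M. degree (A $$ (Min e, Max e)))"
    using degree_prod_sum_le[OF fin, of "\<lambda>e. A $$ (Min e, Max e)"] by (simp add: o_def)
  also have "\<dots> \<le> (\<Sum>e\<in>M. N)"
  proof (rule sum_mono)
    fix e assume e: "e \<in> M"
    have "finite e" "e \<noteq> {}" using two[OF e] by (auto intro: card_ge_0_finite)
    then have "Min e \<in> e" "Max e \<in> e" by simp_all
    then have "Min e < 2 * n" "Max e < 2 * n" using pair_partitions_subset[OF M e] by auto
    then show "degree (A $$ (Min e, Max e)) \<le> N" using A by (simp add: poly_matrices_def)
  qed
  finally show "degree (\<Prod>e\<in>M. A $$ (Min e, Max e)) \<le> n * N" using card by simp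
qed

lemma computes_main:
  assumes A: "A \<in> poly_matrices n N" and T: "real T_main + 1 \<le> T"
  shows "computes_within [main, solver] n N k A (hafnian_mod k A) T"
proof -
  let ?h = "haf_on {0..<2*n} (\<lambda>i j. A $$ (i,j))"
  have haf: "hafnian A = ?h"
    using A by (auto simp: hafnian_def haf_on_def poly_matrices_def)
  from runs_main[OF A] obtain t s' where ex: "exec [main, solver] m main (input_memory n N k A) t s'"
    and t: "t \<le> T_main" and len: "idx s' 0 = D" and red: "\<And>t. t < D \<Longrightarrow> cof s' t mod m = cof s' t"
    and eq: "acc s' \<approx> ?h" by (auto simp: runs_def)
  have "exec [main, solver] (2 ^ k) (Call 0) (input_memory n N k A) (t + 1) s'"
    using exec.Call[of 0 "[main, solver]" m] ex by (simp add: m_def)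
  moreover have "output_poly s' = hafnian_mod k A"
  proof (rule poly_eqI)
    fix i
    have "coeff (hafnian_mod k A) i = coeff ?h i mod m"
      by (simp add: hafnian_mod_def haf coeff_map_poly m_def)
    also have "\<dots> = coeff (output_poly s') i"
    proof (cases "i < D")
      case True
      then have "m dvd cof s' i - coeff ?h i" using eq by (simp add: acc_def pcong_iff_dvd)
      then have "coeff ?h i mod m = cof s' i" using red[OF True] by (simp add: mod_eq_dvd_iff[symmetric])
      then show ?thesis using True by (simp add: output_poly_def len coeff_Poly_eq nth_default_def)
    next
      case False
      then have "coeff ?h i = 0" using degree_hafnian_le[OF A] by (intro coeff_eq_0) (simp add: D_def)
      then show ?thesis using False by (simp add: output_poly_def len coeff_Poly_eq nth_default_def)
    qed
    finally show "coeff (output_poly s') i = coeff (hafnian_mod k A) i" by simp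
  qed
  moreover have "real (t + 1) \<le> T" using t T by simp
  ultimately show ?thesis unfolding computes_within_def by blast
qed

section \<open>Running time\<close>

text \<open>One quantity that dominates \<open>n\<close>, \<open>N\<close> and \<open>D\<close>, so
  that all time bounds become monomials in it.\<close>

definition width :: nat where "width = n * D"

lemma width_facts: "1 \<le> width" "n \<le> width" "D \<le> width" "N \<le> width"
proof -
  show "1 \<le> width" "n \<le> width" "D \<le> width"
    using n_pos D_pos by (simp_all add: width_def Suc_le_eq)
  moreover have "N + 1 \<le> D" using n_pos by (simp add: D_def)
  ultimately show "N \<le> width" by simp
qed

lemma width_power: "i \<le> j \<Longrightarrow> width ^ i \<le> width ^ j"
  by (rule power_increasing[OF _ width_facts(1)])

lemma T_spawn_le: "T_spawn T \<le> 2300 * width ^ 2 + T"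
proof -
  have "W = 2 * n * (2 * n * D) + D" by (simp add: W_def WO_def)
  also have "\<dots> = 4 * (n * width) + D" by (simp add: width_def)
  also have "\<dots> \<le> 4 * (width * width) + width * width"
    using width_facts by (intro add_mono mult_left_mono mult_right_mono) (auto intro: order_trans)
  finally have W: "W \<le> 5 * width ^ 2" by (simp add: power2_eq_square)
  have D: "D * D \<le> width ^ 2" unfolding power2_eq_square using width_facts by (intro mult_mono) auto
  have "D \<le> width ^ 2" "1 \<le> width ^ 2" using width_facts width_power[of 1 2] by simp_all
  then show ?thesis using W D by (simp add: T_spawn_def T_copy_def algebra_simps)
qed

lemma T_step_le: "T_step T \<le> 20000 * width ^ 4 + 5 * width ^ 2 * T"
proof -
  have p: "1 \<le> width ^ 2" "width ^ 2 \<le> width ^ 4" "n \<le> width ^ 2" "width \<le> width ^ 2"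
    using width_facts width_power[of 1 2] width_power[of 2 4] by simp_all
  have nn: "n * n \<le> width ^ 2" unfolding power2_eq_square using width_facts by (intro mult_mono) auto
  have "T_pairs T \<le> 4 * (n * n) * (T_spawn T + 300) + 600 * n + 300"
    by (simp add: T_pairs_def algebra_simps)
  also have "\<dots> \<le> 4 * width ^ 2 * (2300 * width ^ 2 + T + 300) + 600 * n + 300"
    using nn T_spawn_le[of T] by (intro add_mono mult_mono) auto
  also have "\<dots> = 9200 * width ^ 4 + 4 * width ^ 2 * T + 1200 * width ^ 2 + 600 * n + 300"
    by (simp add: algebra_simps power_numeral_reduce)
  finally have pairs: "T_pairs T \<le> 9200 * width ^ 4 + 4 * width ^ 2 * T + 1200 * width ^ 2 + 600 * n + 300" .
  have row: "T_row = 800 * width + 800 * n + 400" by (simp add: T_row_def width_def algebra_simps)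
  have T: "T \<le> width ^ 2 * T" using p(1) by simp
  show ?thesis unfolding T_step_def mult.assoc
    using pairs[unfolded mult.assoc] row T_spawn_le[of T] p T by linarith
qed

text \<open>Over all rows there are order \<open>width ^ 2\<close> elimination steps, each with
  order \<open>width ^ 2\<close> pairs. This gives a factor \<open>width ^ 4\<close> at
  \<open>T\<close>; the preparation of a child, of order \<open>width ^ 2\<close>, raises the
  additive part to \<open>width ^ 6\<close>, the exponent then used for both.\<close>

lemma T_solver_le: "T_solver T \<le> 90000 * width ^ 6 * (T + 1)"
proof -
  have p: "1 \<le> width ^ 6" "width \<le> width ^ 6" "width ^ 2 \<le> width ^ 6" "width ^ 3 \<le> width ^ 6" "width ^ 4 \<le> width ^ 6" "width ^ 5 \<le> width ^ 6"
    using width_facts width_power[of 1 6] width_power[of 2 6] width_power[of 3 6] width_power[of 4 6] width_power[of 5 6] by simp_all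
  have nD: "n * D \<le> width" by (simp add: width_def)
  have "n * T_rows T = 2 * (n * width) * T_step T + 200 * (n * width) + 100 * width + 300 * (D * width) + 300 * width + 500 * n"
    by (simp add: T_rows_def width_def algebra_simps)
  also have "\<dots> \<le> 2 * (width * width) * (20000 * width ^ 4 + 5 * width ^ 2 * T) + 200 * (width * width) + 100 * width
      + 300 * (width * width) + 300 * width + 500 * width"
    using T_step_le[of T] width_facts by (intro add_mono mult_mono) auto
  also have "\<dots> = 40000 * width ^ 6 + 10 * width ^ 4 * T + 500 * width ^ 2 + 900 * width"
    by (simp add: algebra_simps power_numeral_reduce)
  finally have rows: "n * T_rows T \<le> 40000 * width ^ 6 + 10 * width ^ 4 * T + 500 * width ^ 2 + 900 * width" .
  have "T_solver T = 2 * (n * T_rows T) + 200 * n + D * 60 + 500" by (simp add: T_solver_def algebra_simps)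
  also have "\<dots> \<le> 2 * (40000 * width ^ 6 + 10 * width ^ 4 * T + 500 * width ^ 2 + 900 * width) + 200 * width + width * 60 + 500"
    using rows width_facts by (intro add_mono mult_left_mono mult_right_mono) auto
  also have "\<dots> \<le> 90000 * width ^ 6 + 20 * (width ^ 4 * T)"
    using p by (simp add: mult.assoc)
  also have "\<dots> \<le> 90000 * width ^ 6 + 90000 * (width ^ 6 * T)"
    using p(5) by (intro add_mono mult_mono) auto
  finally show ?thesis by (simp add: algebra_simps)
qed

text \<open>The shift by 2 absorbs the additive terms and makes the recurrence purely
  multiplicative; 22 is \<open>T_rec 0 + 2\<close>.\<close>

lemma T_rec_le: "T_rec j + 2 \<le> 22 * (90000 * width ^ 6) ^ j"
proof (induction j)
  case (Suc j)
  let ?y = "90000 * width ^ 6"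
  have y: "3 \<le> ?y" using width_facts(1) one_le_power[of width 6] by simp
  have "T_rec (Suc j) + 2 \<le> ?y * (T_rec j + 1) + 3" using T_solver_le[of "T_rec j"] by simp
  also have "\<dots> \<le> ?y * (T_rec j + 1) + ?y" using y by simp
  also have "\<dots> = ?y * (T_rec j + 2)" by (simp add: algebra_simps)
  also have "\<dots> \<le> ?y * (22 * ?y ^ j)" using Suc by (intro mult_left_mono) auto
  finally show ?case by (simp add: algebra_simps)
qed simp

lemma T_main_le: "T_main + 1 \<le> 5000 * (90000 * width ^ 6) ^ k"
proof -
  let ?y = "90000 * width ^ 6"
  have p: "1 \<le> width ^ 6" "width \<le> width ^ 6" "width ^ 2 \<le> width ^ 6" "width ^ 3 \<le> width ^ 6"
    using width_facts width_power[of 1 6] width_power[of 2 6] width_power[of 3 6] by simp_all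
  have nn: "n * n \<le> width ^ 2" unfolding power2_eq_square using width_facts by (intro mult_mono) auto
  have nnN: "n * n * N \<le> width ^ 3"
    unfolding power3_eq_cube using width_facts by (intro mult_mono) auto
  have "T_load = 400 * (n * n * N) + 800 * (n * n) + 200 * n + 100"
    by (simp add: T_load_def algebra_simps)
  then have ld: "T_load \<le> 1500 * width ^ 6" using nn nnN p width_facts by simp
  have st: "T_setup \<le> 700 * width ^ 6" using p width_facts by (simp add: T_setup_def)
  have cst: "T_const \<le> 130 * width ^ 6 + 40 * k" using p width_facts by (simp add: T_const_def)
  have y1: "width ^ 6 \<le> ?y ^ k"
  proof -
    have "width ^ 6 \<le> ?y ^ 1" by simp
    also have "\<dots> \<le> ?y ^ k" using k_pos p(1) by (intro power_increasing) auto
    finally show ?thesis .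
  qed
  \<comment> \<open>The time for building \<open>2 ^ (k - 1)\<close> is linear in \<open>k\<close>
    and disappears in the exponential bound.\<close>
  have "k \<le> 2 ^ k" by simp
  also have "\<dots> \<le> ?y ^ k" using p(1) by (intro power_mono) auto
  finally have k: "k \<le> ?y ^ k" .
  show ?thesis using ld st cst y1 k T_rec_le[of k] p(1) by (simp add: T_main_def)
qed

lemma width_le: "width \<le> 2 * n ^ 2 * N"
proof -
  have "D \<le> 2 * (n * N)" using n_pos N_pos by (simp add: D_def)
  then have "width \<le> n * (2 * (n * N))" unfolding width_def by (rule mult_left_mono) simp
  then show ?thesis by (simp add: power2_eq_square algebra_simps)
qed

end

theorem theorem2p1:
  shows "\<exists>f :: real poly poly. \<exists>P :: program. \<exists>C :: real.
    \<forall>n N k :: nat. n > 0 \<longrightarrow> N > 0 \<longrightarrow> k > 0 \<longrightarrow>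
      (\<forall>A \<in> poly_matrices n N.
        computes_within P n N k A (hafnian_mod k A) (C * eval2 f (real n) (real N) ^ k))"
proof (intro exI allI impI ballI)
  fix n N k :: nat and A
  assume pos: "n > 0" "N > 0" "k > 0" and A: "A \<in> poly_matrices n N"
  interpret hafnian_run n N k using pos by unfold_locales
  \<comment> \<open>This is \<open>90000 * (2 * n ^ 2 * N) ^ 6\<close>, the growth factor per level
    after \<open>width_le\<close>; the outer variable stands for \<open>n\<close>, the inner one for
    \<open>N\<close>.\<close>
  let ?f = "monom (monom 5760000 6) 12 :: real poly poly"
  have f: "eval2 ?f (real n) (real N) = 5760000 * real n ^ 12 * real N ^ 6"
    by (simp add: eval2_def poly_monom algebra_simps poly_pCons flip: monom_0 mult_monom)
  have "width ^ 6 \<le> (2 * n ^ 2 * N) ^ 6" using width_le by (rule power_mono) simp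
  also have "\<dots> = 64 * n ^ 12 * N ^ 6" by (simp add: power_mult_distrib flip: power_mult)
  finally have "90000 * width ^ 6 \<le> 5760000 * n ^ 12 * N ^ 6" by (simp add: mult_ac)
  then have "(90000 * width ^ 6) ^ k \<le> (5760000 * n ^ 12 * N ^ 6) ^ k" by (rule power_mono) simp
  with T_main_le have "T_main + 1 \<le> 5000 * (5760000 * n ^ 12 * N ^ 6) ^ k" by linarith
  then have "real (T_main + 1) \<le> real (5000 * (5760000 * n ^ 12 * N ^ 6) ^ k)" by (simp only: of_nat_le_iff)
  then have "real T_main + 1 \<le> 5000 * eval2 ?f (real n) (real N) ^ k" unfolding f by simp
  then show "computes_within [main, solver] n N k A (hafnian_mod k A) (5000 * eval2 ?f (real n) (real N) ^ k)"
    by (rule computes_main[OF A])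
qed

end
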